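(* Let the coefficients $v_i,w_i\in\mathbb{R}^{n^i}$, $i=2,\dots,d$, of the controllability and observability energy functions of an $n$-dimensional control-affine system be given to degree $d$. Then the computational complexity (number of floating-point operations) of forming the equations $$2N_k\,\mathrm{vec}(\hat T_{k-1})=-N_k\Big(\sum_{\substack{i,j\ge2\\ i+j=k}}\mathrm{vec}(\hat T_j^\top\hat T_i)+\sum_{i=3}^k\hat{\mathcal{T}}_{i,k}^\top\tilde v_i\Big),$$ $$2\hat N_k\left(I_{n^{k-1}}\otimes\Sigma^2\right)\mathrm{vec}(\hat T_{k-1})=-\hat N_k\Big(\sum_{\substack{i,j\ge2\\ i+j=k}}\mathrm{vec}(\hat T_j^\top\Sigma^2\hat T_i)+\sum_{i=3}^k\hat{\mathcal{T}}_{i,k}^\top\tilde w_i\Big),\qquad k=3,\dots,d,$$ needed to compute a degree $d-1$ polynomial transformation that balances the energy functions to degree $d$ (i.e. puts them in input-normal/output-diagonal form to degree $d$), is $O(dn^{d+1})$.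
   Context: The energy functions have expansions $\mathcal{E}_c(x)=\frac12\sum_{i=2}^dv_i^\top x^{\otimes i}+\dots$ and $\mathcal{E}_o(x)=\frac12\sum_{i=2}^dw_i^\top x^{\otimes i}+\dots$. Here $V_2,W_2$ are the symmetric positive definite matrices with $v_2=\mathrm{vec}(V_2)$, $w_2=\mathrm{vec}(W_2)$; $V_2=RR^\top$, $W_2=LL^\top$ with square factors; $L^\top R^{-\top}=\mathcal{U}\Sigma\mathcal{V}^\top$ is a singular value decomposition; $T_1=R^{-\top}\mathcal{V}$; and $\tilde v_i=(T_1^{\otimes i})^\top v_i$, $\tilde w_i=(T_1^{\otimes i})^\top w_i$. Forming the equations means computing, from the given $v_i,w_i$, the factors $R,L$, the singular value decomposition, $T_1$, the transformed coefficients $\tilde v_i,\tilde w_i$, and all terms of the equations, where the lower-degree coefficients $\hat T_2,\dots,\hat T_{k-2}$ are available when the $k$th pair of equations is formed; the cost of solving the linear systems is not included. Matrix factorizations (square-root factors, SVD) of $n\times n$ matrices are counted as $O(n^3)$ operations, and multiplying an $a\times b$ by a $b\times c$ matrix as $O(abc)$. Notation: $\otimes$ is the Kronecker product, $x^{\otimes k}=x\otimes\dots\otimes x$ ($k$ factors; likewise for matrices), and $\mathrm{vec}$ stacks the columns of a matrix. $\hat T_1=I_n$, $\hat T_i\in\mathbb{R}^{n\times n^i}$, and $\hat{\mathcal{T}}_{m,l}:=\sum_{i_1+\dots+i_m=l}\hat T_{i_1}\otimes\dots\otimes\hat T_{i_m}\in\mathbb{R}^{n^m\times n^l}$, over all ordered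 tuples of positive integers with sum $l$. The matrix $N_k$ is the binary $\binom{n+k-1}{k}\times n^k$ matrix whose rows are indexed by the distinct degree-$k$ monomials in $x_1,\dots,x_n$, with entry $1$ in row $\mu$ and column $j$ exactly when the $j$th entry of $x^{\otimes k}$ equals $\mu$, ordered so that the first $n$ rows correspond to $x_1^k,\dots,x_n^k$; $\hat N_k$ consists of the remaining rows. Input-normal/output-diagonal form to degree $d$: in the new coordinates $z$, up to terms of degree greater than $d$, $\mathcal{E}_c=\frac12\sum_iz_i^2$ and $\mathcal{E}_o=\frac12\sum_iz_i^2\sigma_i^2(z_i)$ with each $\sigma_i^2$ a polynomial in $z_i$ alone. *)

theory Defs
  imports
    "HOL-Analysis.Equivalence_Lebesgue_Henstock_Integration"
    "HOL-Library.Landau_Symbols"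
    "HOL-Computational_Algebra.Polynomial"
    "Jordan_Normal_Form.Matrix"
    "Jordan_Normal_Form.Gauss_Jordan_Elimination"
begin

unbundle no vec_syntax
unbundle no inner_syntax

definition kron_mat :: "real mat \<Rightarrow> real mat \<Rightarrow> real mat" where
  "kron_mat A B = mat (dim_row A * dim_row B) (dim_col A * dim_col B)
     (\<lambda>(i, j). A $$ (i div dim_row B, j div dim_col B) * B $$ (i mod dim_row B, j mod dim_col B))"

definition kron_list :: "real mat list \<Rightarrow> real mat" where
  "kron_list As = foldr kron_mat As (1\<^sub>m 1)"

definition kpow_mat :: "real mat \<Rightarrow> nat \<Rightarrow> real mat" where
  "kpow_mat A k = kron_list (replicate k A)"

definition kron_vec :: "real Matrix.vec \<Rightarrow> real Matrix.vec \<Rightarrow> real Matrix.vec" where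
  "kron_vec x y = Matrix.vec (dim_vec x * dim_vec y) (\<lambda>i. x $ (i div dim_vec y) * y $ (i mod dim_vec y))"

primrec kpow_vec :: "real Matrix.vec \<Rightarrow> nat \<Rightarrow> real Matrix.vec" where
  "kpow_vec x 0 = Matrix.vec 1 (\<lambda>_. 1)"
| "kpow_vec x (Suc k) = kron_vec x (kpow_vec x k)"

definition vec_of :: "real mat \<Rightarrow> real Matrix.vec" where
  "vec_of A = Matrix.vec (dim_row A * dim_col A) (\<lambda>i. A $$ (i mod dim_row A, i div dim_row A))"

definition vsum :: "nat \<Rightarrow> 'a set \<Rightarrow> ('a \<Rightarrow> real Matrix.vec) \<Rightarrow> real Matrix.vec" where
  "vsum N I F = Matrix.vec N (\<lambda>a. \<Sum>i\<in>I. F i $ a)"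

definition vnorm :: "real Matrix.vec \<Rightarrow> real" where
  "vnorm x = sqrt (x \<bullet> x)"

text \<open>The system is \<open>x' = f(x) + g(x) u\<close>, \<open>y = h(x)\<close> with state dimension \<open>n\<close>, input dimension
  \<open>m\<close> and output dimension \<open>p\<close>. Trajectories are solutions in the sense of Caratheodory.\<close>

definition control_affine_system ::
  "nat \<Rightarrow> nat \<Rightarrow> nat \<Rightarrow> (real Matrix.vec \<Rightarrow> real Matrix.vec) \<Rightarrow> (real Matrix.vec \<Rightarrow> real mat)
    \<Rightarrow> (real Matrix.vec \<Rightarrow> real Matrix.vec) \<Rightarrow> bool" where
  "control_affine_system n m p f g h \<longleftrightarrow>
     (\<forall>x\<in>carrier_vec n. f x \<in> carrier_vec n \<and> g x \<in> carrier_mat n m \<and> h x \<in> carrier_vec p)"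

definition trajectory ::
  "nat \<Rightarrow> (real Matrix.vec \<Rightarrow> real Matrix.vec) \<Rightarrow> (real Matrix.vec \<Rightarrow> real mat)
    \<Rightarrow> real set \<Rightarrow> (real \<Rightarrow> real Matrix.vec) \<Rightarrow> (real \<Rightarrow> real Matrix.vec) \<Rightarrow> bool" where
  "trajectory n f g I u x \<longleftrightarrow>
     (\<forall>t\<in>I. x t \<in> carrier_vec n) \<and>
     (\<forall>s\<in>I. \<forall>t\<in>I. s \<le> t \<longrightarrow> (\<forall>i<n.
        (\<lambda>\<tau>. (f (x \<tau>) + g (x \<tau>) *\<^sub>v u \<tau>) $ i) absolutely_integrable_on {s..t} \<and>
        x t $ i - x s $ i = integral {s..t} (\<lambda>\<tau>. (f (x \<tau>) + g (x \<tau>) *\<^sub>v u \<tau>) $ i)))"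

definition L2_input :: "nat \<Rightarrow> (real \<Rightarrow> real Matrix.vec) \<Rightarrow> bool" where
  "L2_input m u \<longleftrightarrow>
     (\<forall>t\<le>0. u t \<in> carrier_vec m) \<and>
     (\<forall>i<m. (\<lambda>t. u t $ i) \<in> borel_measurable (lebesgue_on {..0})) \<and>
     (\<lambda>t. u t \<bullet> u t) absolutely_integrable_on {..0}"

definition steering_costs ::
  "nat \<Rightarrow> nat \<Rightarrow> (real Matrix.vec \<Rightarrow> real Matrix.vec) \<Rightarrow> (real Matrix.vec \<Rightarrow> real mat)
    \<Rightarrow> real Matrix.vec \<Rightarrow> real set" where
  "steering_costs n m f g x0 =
     {1/2 * integral {..0} (\<lambda>t. u t \<bullet> u t) | u x.
        L2_input m u \<and> trajectory n f g {..0} u x \<and>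
        ((\<lambda>t. vnorm (x t)) \<longlongrightarrow> 0) at_bot \<and> x 0 = x0}"

text \<open>Energy functions are only needed near the origin, where they are expanded.\<close>

definition controllability_energy ::
  "nat \<Rightarrow> nat \<Rightarrow> (real Matrix.vec \<Rightarrow> real Matrix.vec) \<Rightarrow> (real Matrix.vec \<Rightarrow> real mat)
    \<Rightarrow> (real Matrix.vec \<Rightarrow> real) \<Rightarrow> bool" where
  "controllability_energy n m f g Ec \<longleftrightarrow>
     (\<exists>\<delta>>0. \<forall>x0\<in>carrier_vec n. vnorm x0 < \<delta> \<longrightarrow>
        steering_costs n m f g x0 \<noteq> {} \<and> Ec x0 = Inf (steering_costs n m f g x0))"

definition observability_energy ::
  "nat \<Rightarrow> nat \<Rightarrow> (real Matrix.vec \<Rightarrow> real Matrix.vec) \<Rightarrow> (real Matrix.vec \<Rightarrow> real mat)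
    \<Rightarrow> (real Matrix.vec \<Rightarrow> real Matrix.vec) \<Rightarrow> (real Matrix.vec \<Rightarrow> real) \<Rightarrow> bool" where
  "observability_energy n m f g h Eo \<longleftrightarrow>
     (\<exists>\<delta>>0. \<forall>x0\<in>carrier_vec n. vnorm x0 < \<delta> \<longrightarrow>
        (\<exists>x. trajectory n f g {0..} (\<lambda>_. 0\<^sub>v m) x \<and> x 0 = x0) \<and>
        (\<forall>x. trajectory n f g {0..} (\<lambda>_. 0\<^sub>v m) x \<and> x 0 = x0 \<longrightarrow>
           (\<lambda>t. h (x t) \<bullet> h (x t)) absolutely_integrable_on {0..} \<and>
           Eo x0 = 1/2 * integral {0..} (\<lambda>t. h (x t) \<bullet> h (x t))))"

definition agree_to_degree ::
  "nat \<Rightarrow> nat \<Rightarrow> (real Matrix.vec \<Rightarrow> real) \<Rightarrow> (real Matrix.vec \<Rightarrow> real) \<Rightarrow> bool" where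
  "agree_to_degree n d F G \<longleftrightarrow>
     (\<exists>C. \<exists>\<delta>>0. \<forall>x\<in>carrier_vec n. vnorm x < \<delta> \<longrightarrow> \<bar>F x - G x\<bar> \<le> C * vnorm x ^ (d + 1))"

definition energy_expansion ::
  "nat \<Rightarrow> nat \<Rightarrow> (nat \<Rightarrow> real Matrix.vec) \<Rightarrow> (real Matrix.vec \<Rightarrow> real) \<Rightarrow> bool" where
  "energy_expansion n d v E \<longleftrightarrow>
     (\<forall>i\<in>{2..d}. v i \<in> carrier_vec (n ^ i)) \<and>
     agree_to_degree n d E (\<lambda>x. 1/2 * (\<Sum>i=2..d. v i \<bullet> kpow_vec x i))"

definition spd :: "nat \<Rightarrow> real mat \<Rightarrow> bool" where
  "spd n A \<longleftrightarrow> A \<in> carrier_mat n n \<and> (transpose_mat A) = A \<and>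
     (\<forall>x\<in>carrier_vec n. x \<noteq> 0\<^sub>v n \<longrightarrow> x \<bullet> (A *\<^sub>v x) > 0)"

definition is_svd :: "nat \<Rightarrow> real mat \<Rightarrow> real mat \<times> real mat \<times> real mat \<Rightarrow> bool" where
  "is_svd n A = (\<lambda>(U, S, V).
     U \<in> carrier_mat n n \<and> S \<in> carrier_mat n n \<and> V \<in> carrier_mat n n \<and>
     transpose_mat U * U = 1\<^sub>m n \<and> transpose_mat V * V = 1\<^sub>m n \<and>
     diagonal_mat S \<and> (\<forall>i<n. S $$ (i, i) \<ge> 0) \<and> A = U * S * transpose_mat V)"

text \<open>Square-root factors and singular value decompositions are not unique. They are supplied by
  functions that return some valid factorization of every matrix that has one.\<close>

definition sqrt_factorizer :: "(real mat \<Rightarrow> real mat) \<Rightarrow> bool" where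
  "sqrt_factorizer sqf \<longleftrightarrow>
     (\<forall>n A. spd n A \<longrightarrow> sqf A \<in> carrier_mat n n \<and> sqf A * transpose_mat (sqf A) = A)"

definition svd_factorizer :: "(real mat \<Rightarrow> real mat \<times> real mat \<times> real mat) \<Rightarrow> bool" where
  "svd_factorizer svd \<longleftrightarrow> (\<forall>n. \<forall>A\<in>carrier_mat n n. is_svd n A (svd A))"

definition inv_transpose :: "real mat \<Rightarrow> real mat" where
  "inv_transpose A = the (mat_inverse ((transpose_mat A)))"

definition transformed_coeff :: "real mat \<Rightarrow> (nat \<Rightarrow> real Matrix.vec) \<Rightarrow> nat \<Rightarrow> real Matrix.vec" where
  "transformed_coeff T1 v i = transpose_mat (kpow_mat T1 i) *\<^sub>v v i"

text \<open>A monomial of degree \<open>k\<close> is represented by the sorted list of its variable indices; the pure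
  powers come first, provided that \<open>k \<ge> 2\<close>.\<close>

definition monomials :: "nat \<Rightarrow> nat \<Rightarrow> nat list list" where
  "monomials n k = map (replicate k) [0..<n] @
     filter (\<lambda>\<mu>. sorted \<mu> \<and> hd \<mu> \<noteq> last \<mu>) (List.n_lists k [0..<n])"

text \<open>Equality of an entry of a Kronecker power with a monomial is equality of functions on
  \<open>n\<close>-dimensional space, which for real polynomials is equality of polynomials.\<close>

definition N_mat :: "nat \<Rightarrow> nat \<Rightarrow> real mat" where
  "N_mat n k = mat (length (monomials n k)) (n ^ k)
     (\<lambda>(r, j). if \<forall>x\<in>carrier_vec n. kpow_vec x k $ j = (\<Prod>i\<leftarrow>monomials n k ! r. x $ i) then 1 else 0)"

definition Nhat_mat :: "nat \<Rightarrow> nat \<Rightarrow> real mat" where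
  "Nhat_mat n k = mat (dim_row (N_mat n k) - n) (n ^ k) (\<lambda>(r, j). N_mat n k $$ (n + r, j))"

definition compositions :: "nat \<Rightarrow> nat \<Rightarrow> nat list set" where
  "compositions m l = {is. length is = m \<and> sum_list is = l \<and> (\<forall>i\<in>set is. 1 \<le> i)}"

definition T_sum :: "nat \<Rightarrow> (nat \<Rightarrow> real mat) \<Rightarrow> nat \<Rightarrow> nat \<Rightarrow> real mat" where
  "T_sum n T m l = mat (n ^ m) (n ^ l)
     (\<lambda>ab. \<Sum>is\<in>compositions m l. kron_list (map T is) $$ ab)"

definition lhs_c :: "nat \<Rightarrow> nat \<Rightarrow> real mat" where
  "lhs_c n k = 2 \<cdot>\<^sub>m N_mat n k"

definition rhs_c :: "nat \<Rightarrow> nat \<Rightarrow> (nat \<Rightarrow> real mat) \<Rightarrow> (nat \<Rightarrow> real Matrix.vec) \<Rightarrow> real Matrix.vec" where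
  "rhs_c n k T vt = - (N_mat n k *\<^sub>v
     (vsum (n ^ k) {(i, j). 2 \<le> i \<and> 2 \<le> j \<and> i + j = k} (\<lambda>(i, j). vec_of (transpose_mat (T j) * T i)) +
      vsum (n ^ k) {3..k} (\<lambda>i. transpose_mat (T_sum n T i k) *\<^sub>v vt i)))"

definition lhs_o :: "nat \<Rightarrow> nat \<Rightarrow> real mat \<Rightarrow> real mat" where
  "lhs_o n k S = 2 \<cdot>\<^sub>m (Nhat_mat n k * kron_mat (1\<^sub>m (n ^ (k - 1))) (S * S))"

definition rhs_o :: "nat \<Rightarrow> nat \<Rightarrow> real mat \<Rightarrow> (nat \<Rightarrow> real mat) \<Rightarrow> (nat \<Rightarrow> real Matrix.vec)
    \<Rightarrow> real Matrix.vec" where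
  "rhs_o n k S T wt = - (Nhat_mat n k *\<^sub>v
     (vsum (n ^ k) {(i, j). 2 \<le> i \<and> 2 \<le> j \<and> i + j = k} (\<lambda>(i, j). vec_of (transpose_mat (T j) * (S * S) * T i)) +
      vsum (n ^ k) {3..k} (\<lambda>i. transpose_mat (T_sum n T i k) *\<^sub>v wt i)))"

definition satisfies_equations ::
  "nat \<Rightarrow> nat \<Rightarrow> real mat \<Rightarrow> (nat \<Rightarrow> real mat) \<Rightarrow> (nat \<Rightarrow> real Matrix.vec) \<Rightarrow> (nat \<Rightarrow> real Matrix.vec)
    \<Rightarrow> bool" where
  "satisfies_equations n k S T vt wt \<longleftrightarrow>
     lhs_c n k *\<^sub>v vec_of (T (k - 1)) = rhs_c n k T vt \<and>
     lhs_o n k S *\<^sub>v vec_of (T (k - 1)) = rhs_o n k S T wt"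

text \<open>The degree-\<open>k\<close> coefficient of the transformation is \<open>T1 * T k\<close>; here and below the \<open>T k\<close> are
  the hatted coefficients, with \<open>T 1\<close> the identity.\<close>

definition transformation :: "nat \<Rightarrow> nat \<Rightarrow> real mat \<Rightarrow> (nat \<Rightarrow> real mat) \<Rightarrow> real Matrix.vec \<Rightarrow> real Matrix.vec" where
  "transformation n d T1 T z = vsum n {1..d - 1} (\<lambda>k. (T1 * T k) *\<^sub>v kpow_vec z k)"

definition input_normal_output_diagonal ::
  "nat \<Rightarrow> nat \<Rightarrow> (real Matrix.vec \<Rightarrow> real) \<Rightarrow> (real Matrix.vec \<Rightarrow> real) \<Rightarrow> bool" where
  "input_normal_output_diagonal n d Ec Eo \<longleftrightarrow>
     agree_to_degree n d Ec (\<lambda>z. 1/2 * (\<Sum>i<n. (z $ i)\<^sup>2)) \<and>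
     (\<exists>\<sigma>sq :: nat \<Rightarrow> real poly.
        agree_to_degree n d Eo (\<lambda>z. 1/2 * (\<Sum>i<n. (z $ i)\<^sup>2 * poly (\<sigma>sq i) (z $ i))))"

text \<open>Straight-line programs in exact real arithmetic. A register is an entry \<open>(i, j)\<close> of a named
  array; a vector occupies column \<open>0\<close>. Scalar arithmetic costs one operation, a factorization of an
  \<open>n \<times> n\<close> matrix costs \<open>\<kappa> n\<^sup>3\<close> with \<open>\<kappa>\<close> the constant of the factorization algorithms, and storing
  constants or moving data is free. A product of an \<open>a \<times> b\<close> and a \<open>b \<times> c\<close> matrix is carried out by
  scalar arithmetic.\<close>

datatype array =
    Coeff_v nat | Coeff_w nat | Lower_T nat
  | Out_R | Out_L | Out_U | Out_S | Out_V | Out_T1 | Out_vt nat | Out_wt nat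
  | Out_lhs_c nat | Out_rhs_c nat | Out_lhs_o nat | Out_rhs_o nat
  | Temp "nat list"

type_synonym register = "array \<times> nat \<times> nat"
type_synonym memory = "register \<Rightarrow> real"

datatype instr =
    Const register real
  | Copy register register
  | Add register register register
  | Sub register register register
  | Mul register register register
  | Div register register register
  | Sqrt_Factor nat array array
  | SVD nat array array array array

definition read_mat :: "memory \<Rightarrow> array \<Rightarrow> nat \<Rightarrow> nat \<Rightarrow> real mat" where
  "read_mat M x r c = mat r c (\<lambda>(i, j). M (x, i, j))"

definition read_vec :: "memory \<Rightarrow> array \<Rightarrow> nat \<Rightarrow> real Matrix.vec" where
  "read_vec M x r = Matrix.vec r (\<lambda>i. M (x, i, 0))"

definition write_mat :: "array \<Rightarrow> nat \<Rightarrow> nat \<Rightarrow> real mat \<Rightarrow> memory \<Rightarrow> memory" where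
  "write_mat x r c A M = (\<lambda>(y, i, j). if y = x \<and> i < r \<and> j < c then A $$ (i, j) else M (y, i, j))"

primrec exec :: "(real mat \<Rightarrow> real mat) \<Rightarrow> (real mat \<Rightarrow> real mat \<times> real mat \<times> real mat)
    \<Rightarrow> instr \<Rightarrow> memory \<Rightarrow> memory" where
  "exec sqf svd (Const r c) M = M(r := c)"
| "exec sqf svd (Copy r a) M = M(r := M a)"
| "exec sqf svd (Add r a b) M = M(r := M a + M b)"
| "exec sqf svd (Sub r a b) M = M(r := M a - M b)"
| "exec sqf svd (Mul r a b) M = M(r := M a * M b)"
| "exec sqf svd (Div r a b) M = M(r := M a / M b)"
| "exec sqf svd (Sqrt_Factor n x a) M = write_mat x n n (sqf (read_mat M a n n)) M"
| "exec sqf svd (SVD n x y z a) M =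
     (case svd (read_mat M a n n) of (U, S, V) \<Rightarrow>
        write_mat z n n V (write_mat y n n S (write_mat x n n U M)))"

primrec instr_flops :: "nat \<Rightarrow> instr \<Rightarrow> nat" where
  "instr_flops \<kappa> (Const r c) = 0"
| "instr_flops \<kappa> (Copy r a) = 0"
| "instr_flops \<kappa> (Add r a b) = 1"
| "instr_flops \<kappa> (Sub r a b) = 1"
| "instr_flops \<kappa> (Mul r a b) = 1"
| "instr_flops \<kappa> (Div r a b) = 1"
| "instr_flops \<kappa> (Sqrt_Factor n x a) = \<kappa> * n ^ 3"
| "instr_flops \<kappa> (SVD n x y z a) = \<kappa> * n ^ 3"

type_synonym program = "instr list"

definition flops :: "nat \<Rightarrow> program \<Rightarrow> nat" where
  "flops \<kappa> P = sum_list (map (instr_flops \<kappa>) P)"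

definition initial_memory :: "nat \<Rightarrow> nat \<Rightarrow> (nat \<Rightarrow> real Matrix.vec) \<Rightarrow> (nat \<Rightarrow> real Matrix.vec) \<Rightarrow> memory" where
  "initial_memory n d v w = (\<lambda>(x, a, b). case x of
       Coeff_v i \<Rightarrow> if 2 \<le> i \<and> i \<le> d \<and> a < n ^ i \<and> b = 0 then v i $ a else 0
     | Coeff_w i \<Rightarrow> if 2 \<le> i \<and> i \<le> d \<and> a < n ^ i \<and> b = 0 then w i $ a else 0
     | _ \<Rightarrow> 0)"

text \<open>Stage \<open>2\<close> of a program sees only \<open>v\<close> and \<open>w\<close>. Stage \<open>k \<ge> 3\<close> forms the \<open>k\<close>th pair of
  equations; just before it starts, \<open>T (k - 2)\<close> is delivered, so that it sees exactly
  \<open>T 1, \<dots>, T (k - 2)\<close>.\<close>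

definition memory_after ::
  "(real mat \<Rightarrow> real mat) \<Rightarrow> (real mat \<Rightarrow> real mat \<times> real mat \<times> real mat) \<Rightarrow> nat \<Rightarrow> nat
    \<Rightarrow> (nat \<Rightarrow> real Matrix.vec) \<Rightarrow> (nat \<Rightarrow> real Matrix.vec) \<Rightarrow> (nat \<Rightarrow> real mat)
    \<Rightarrow> (nat \<Rightarrow> program) \<Rightarrow> nat \<Rightarrow> memory" where
  "memory_after sqf svd n d v w T P k =
     fold (\<lambda>l M. fold (exec sqf svd) (P l) (write_mat (Lower_T (l - 2)) n (n ^ (l - 2)) (T (l - 2)) M))
       [3..<Suc k] (fold (exec sqf svd) (P 2) (initial_memory n d v w))"

definition total_flops :: "nat \<Rightarrow> nat \<Rightarrow> (nat \<Rightarrow> program) \<Rightarrow> nat" where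
  "total_flops \<kappa> d P = (\<Sum>k=2..d. flops \<kappa> (P k))"

definition holds_balancing_data ::
  "memory \<Rightarrow> nat \<Rightarrow> nat \<Rightarrow> real mat \<Rightarrow> real mat \<Rightarrow> real mat \<Rightarrow> real mat \<Rightarrow> real mat \<Rightarrow> real mat
    \<Rightarrow> (nat \<Rightarrow> real Matrix.vec) \<Rightarrow> (nat \<Rightarrow> real Matrix.vec) \<Rightarrow> bool" where
  "holds_balancing_data M n d R L U S V T1 vt wt \<longleftrightarrow>
     read_mat M Out_R n n = R \<and> read_mat M Out_L n n = L \<and>
     read_mat M Out_U n n = U \<and> read_mat M Out_S n n = S \<and> read_mat M Out_V n n = V \<and>
     read_mat M Out_T1 n n = T1 \<and>
     (\<forall>i\<in>{2..d}. read_vec M (Out_vt i) (n ^ i) = vt i \<and> read_vec M (Out_wt i) (n ^ i) = wt i)"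

definition holds_equations ::
  "memory \<Rightarrow> nat \<Rightarrow> nat \<Rightarrow> real mat \<Rightarrow> (nat \<Rightarrow> real mat) \<Rightarrow> (nat \<Rightarrow> real Matrix.vec)
    \<Rightarrow> (nat \<Rightarrow> real Matrix.vec) \<Rightarrow> bool" where
  "holds_equations M n k S T vt wt \<longleftrightarrow>
     read_mat M (Out_lhs_c k) (dim_row (N_mat n k)) (n ^ k) = lhs_c n k \<and>
     read_vec M (Out_rhs_c k) (dim_row (N_mat n k)) = rhs_c n k T vt \<and>
     read_mat M (Out_lhs_o k) (dim_row (Nhat_mat n k)) (n ^ k) = lhs_o n k S \<and>
     read_vec M (Out_rhs_o k) (dim_row (Nhat_mat n k)) = rhs_o n k S T wt"

end

theory Submission
  imports Defs "HOL-Library.Poly_Mapping" "Jordan_Normal_Form.Determinant"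
begin

text \<open>A word over \<open>{0..<n}\<close> of length \<open>k\<close> indexes an entry of a \<open>k\<close>-fold Kronecker product, and a vector of
  such entries is a noncommutative homogeneous polynomial. The sum over \<open>i\<close> of the transposed
  \<open>T_sum n T i k\<close> applied to the \<open>i\<close>th coefficient is the degree-\<open>k\<close> part of a composition of polynomials.
  Substituting the tensors as they stand would need about \<open>k\<^sup>2\<close> products of \<open>n ^ (k + 1)\<close> operations, a factor \<open>k\<close> too many.

  The matrix \<open>N_mat n k\<close> only sees the symmetrization of its argument, so the coefficients may be collected
  on sorted words beforehand and the substitution be carried out by a Horner scheme on the tree of sorted
  words. At depth \<open>r\<close> this tree has at most \<open>(3/4) ^ (r div 2) * n ^ r\<close> nodes, hence the costs of the levels
  form a convergent geometric series and the \<open>k\<close>th pair of equations costs only \<open>O(k * n ^ (k + 1))\<close>.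

  If the equations hold, then the degree-\<open>k\<close> parts of the energies in the new coordinates, grouped by monomials,
  have exactly the residuals of the equations as coefficients.\<close>

text \<open>Each entry computed in the tree takes up to about \<open>n * k\<close> products, which
  uses up the one factor \<open>k\<close> that is allowed, so the number of entries summed over all
  depths must stay within a constant times \<open>n ^ k\<close>. A node of depth \<open>r\<close>
  carries \<open>n ^ (k - r)\<close> entries. With all words as nodes every depth would contribute
  \<open>n ^ k\<close> again; the decay of the share of sorted words saves the sum. The ratio 3/4
  bounds \<open>n * (n + 1) / 2\<close> against \<open>n ^ 2\<close>, which needs
  \<open>n \<ge> 2\<close>; for \<open>n = 1\<close> there is one word of each length and nothing
  decays.

  The other constraint is availability: the \<open>k\<close>th pair of equations is formed before
  \<open>T (k - 1)\<close> is known. Substituting into terms of degree at least 3 involves at most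
  \<open>T (k - 2)\<close>, and in the scheme this appears as the vanishing of all Horner entries of
  total degree below 3, where the total degree adds the lengths of the node and of the output word.

  Every register has one intended value for the whole run. Hence entries of smaller total degree
  survive from earlier stages, and no aliasing has to be discussed.\<close>

definition words :: "nat \<Rightarrow> nat \<Rightarrow> nat list set" where
  "words n k = {\<alpha>. length \<alpha> = k \<and> set \<alpha> \<subseteq> {..<n}}"

definition short_words :: "nat \<Rightarrow> nat \<Rightarrow> nat list set" where
  "short_words n N = {\<alpha>. length \<alpha> \<le> N \<and> set \<alpha> \<subseteq> {..<n}}"

text \<open>The first letter is the most significant digit, in accordance with the
  \<open>div\<close>/\<open>mod\<close> indexing of \<open>kron_mat\<close>: concatenating words
  corresponds to combining the indices of Kronecker factors.\<close>

fun idx :: "nat \<Rightarrow> nat list \<Rightarrow> nat" where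
  "idx n [] = 0"
| "idx n (a # \<alpha>) = a * n ^ length \<alpha> + idx n \<alpha>"

section \<open>Words over a finite alphabet and sums over them\<close>

lemma wordsD: "\<alpha> \<in> words n k \<Longrightarrow> length \<alpha> = k" "\<alpha> \<in> words n k \<Longrightarrow> set \<alpha> \<subseteq> {..<n}"
  by (auto simp: words_def)

lemma finite_words [simp]: "finite (words n k)"
  using finite_lists_length_eq[of "{..<n}" k] by (auto simp: words_def conj_commute)

lemma card_words: "card (words n k) = n ^ k"
  using card_lists_length_eq[of "{..<n}" k] by (auto simp: words_def conj_commute)

lemma finite_short_words [simp]: "finite (short_words n N)"
  using finite_lists_length_le[of "{..<n}" N] by (auto simp: short_words_def conj_commute)

lemma words_0 [simp]: "words n 0 = {[]}"
  by (auto simp: words_def)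

lemma Cons_in_words [simp]: "a # \<alpha> \<in> words n k \<longleftrightarrow> a < n \<and> (\<exists>k'. k = Suc k' \<and> \<alpha> \<in> words n k')"
  by (auto simp: words_def)

lemma append_in_words: "\<alpha> \<in> words n i \<Longrightarrow> \<beta> \<in> words n j \<Longrightarrow> \<alpha> @ \<beta> \<in> words n (i + j)"
  by (auto simp: words_def)

lemma take_in_words: "\<alpha> \<in> words n k \<Longrightarrow> j \<le> k \<Longrightarrow> take j \<alpha> \<in> words n j"
  by (auto simp: words_def dest: in_set_takeD)

lemma drop_in_words: "\<alpha> \<in> words n k \<Longrightarrow> drop j \<alpha> \<in> words n (k - j)"
  by (auto simp: words_def dest: in_set_dropD)

lemma words_Suc: "words n (Suc k) = (\<lambda>(a, \<alpha>). a # \<alpha>) ` ({..<n} \<times> words n k)"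
proof (rule Set.set_eqI)
  fix \<beta> show "\<beta> \<in> words n (Suc k) \<longleftrightarrow> \<beta> \<in> (\<lambda>(a, \<alpha>). a # \<alpha>) ` ({..<n} \<times> words n k)"
    by (cases \<beta>) (auto simp: words_def image_iff)
qed

lemma sum_words_Suc:
  "(\<Sum>\<alpha>\<in>words n (Suc k). f \<alpha>) = (\<Sum>a<n. \<Sum>\<alpha>\<in>words n k. f (a # \<alpha>))"
proof -
  have "inj_on (\<lambda>(a, \<alpha>). a # \<alpha>) ({..<n} \<times> words n k)" by (auto simp: inj_on_def)
  then show ?thesis
    by (simp add: words_Suc sum.reindex sum.cartesian_product case_prod_unfold)
qed

lemma sum_words_add:
  "(\<Sum>\<alpha>\<in>words n (i + j). f \<alpha>) = (\<Sum>\<alpha>\<in>words n i. \<Sum>\<beta>\<in>words n j. f (\<alpha> @ \<beta>))"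
  by (induction i arbitrary: f) (auto simp: sum_words_Suc)

lemma sum_words_snoc:
  "(\<Sum>\<alpha>\<in>words n (Suc k). f \<alpha>) = (\<Sum>a<n. \<Sum>\<alpha>\<in>words n k. f (\<alpha> @ [a]))"
proof -
  have "(\<Sum>\<alpha>\<in>words n (Suc k). f \<alpha>) = (\<Sum>\<alpha>\<in>words n k. \<Sum>\<beta>\<in>words n 1. f (\<alpha> @ \<beta>))"
    using sum_words_add[where i = k and j = 1] by simp
  also have "\<dots> = (\<Sum>\<alpha>\<in>words n k. \<Sum>a<n. f (\<alpha> @ [a]))"
    unfolding One_nat_def by (subst sum_words_Suc) simp
  finally show ?thesis by (simp add: sum.swap[of _ "{..<n}"])
qed

lemma sum_short_words:
  "(\<Sum>\<alpha>\<in>short_words n N. f \<alpha>) = (\<Sum>k\<le>N. \<Sum>\<alpha>\<in>words n k. f \<alpha>)"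
proof -
  have "short_words n N = (\<Union>k\<in>{..N}. words n k)" by (auto simp: short_words_def words_def)
  moreover have "\<forall>k\<in>{..N}. \<forall>k'\<in>{..N}. k \<noteq> k' \<longrightarrow> words n k \<inter> words n k' = {}"
    by (auto simp: words_def)
  ultimately show ?thesis by (simp add: sum.UNION_disjoint)
qed

section \<open>Words as base-\<open>n\<close> numerals\<close>

lemma idx_append: "idx n (\<alpha> @ \<beta>) = idx n \<alpha> * n ^ length \<beta> + idx n \<beta>"
  by (induction \<alpha>) (auto simp: algebra_simps power_add)

lemma idx_less: "\<alpha> \<in> words n k \<Longrightarrow> idx n \<alpha> < n ^ k"
proof (induction \<alpha> arbitrary: k)
  case (Cons a \<alpha>)
  then obtain k' where k: "k = Suc k'" "\<alpha> \<in> words n k'" "a < n" by auto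
  then have "idx n \<alpha> < n ^ k'" "length \<alpha> = k'" using Cons.IH by (auto dest: wordsD)
  moreover from \<open>a < n\<close> have "Suc a * n ^ k' \<le> n * n ^ k'" by (intro mult_le_mono) auto
  ultimately show ?case using k by simp
qed (auto simp: words_def)

text \<open>This turns the \<open>div\<close> and \<open>mod\<close> in \<open>kron_mat\<close>,
  \<open>kron_vec\<close> and \<open>vec_of\<close> into the cutting of a word.\<close>

lemma idx_append_div:
  assumes "\<beta> \<in> words n k" shows "idx n (\<alpha> @ \<beta>) div n ^ k = idx n \<alpha>" "idx n (\<alpha> @ \<beta>) mod n ^ k = idx n \<beta>"
  using idx_less[OF assms] wordsD(1)[OF assms] by (cases "n ^ k = 0"; auto simp: idx_append)+

lemma inj_on_idx: "inj_on (idx n) (words n k)"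
proof (induction k)
  case (Suc k)
  show ?case
  proof (rule inj_onI)
    fix x y assume xy: "x \<in> words n (Suc k)" "y \<in> words n (Suc k)" "idx n x = idx n y"
    then obtain a \<alpha> b \<beta> where ab: "x = a # \<alpha>" "y = b # \<beta>" "\<alpha> \<in> words n k" "\<beta> \<in> words n k"
      by (auto simp: words_Suc)
    then have "idx n ([a] @ \<alpha>) div n ^ k = idx n ([b] @ \<beta>) div n ^ k"
      "idx n ([a] @ \<alpha>) mod n ^ k = idx n ([b] @ \<beta>) mod n ^ k" using xy by auto
    then have "idx n [a] = idx n [b]" "idx n \<alpha> = idx n \<beta>"
      unfolding idx_append_div[OF ab(3)] idx_append_div[OF ab(4)] .
    with ab Suc.IH show "x = y" by (auto simp: inj_on_def)
  qed
qed auto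

text \<open>An injection of \<open>n ^ k\<close> words into \<open>n ^ k\<close> numbers is
  onto.\<close>

lemma idx_image: "idx n ` words n k = {..<n ^ k}"
  by (rule card_subset_eq) (auto simp: idx_less card_image[OF inj_on_idx] card_words)

lemma bij_betw_idx: "bij_betw (idx n) (words n k) {..<n ^ k}"
  by (simp add: bij_betw_def inj_on_idx idx_image)

lemma sum_idx: "(\<Sum>j<n ^ k. f j) = (\<Sum>\<alpha>\<in>words n k. f (idx n \<alpha>))"
  by (rule sum.reindex_bij_betw[OF bij_betw_idx, symmetric])

lemma idx_cases:
  assumes "j < n ^ k" obtains \<alpha> where "\<alpha> \<in> words n k" "j = idx n \<alpha>"
proof -
  have "j \<in> idx n ` words n k" using assms by (simp add: idx_image)
  then show thesis using that by auto
qed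

text \<open>Registers carry only numbers; recovering the word lets the intended value of a register
  be given as a function of the register.\<close>

definition digits :: "nat \<Rightarrow> nat \<Rightarrow> nat \<Rightarrow> nat list" where
  "digits n k = the_inv_into (words n k) (idx n)"

lemma digits_idx [simp]: "\<alpha> \<in> words n k \<Longrightarrow> digits n k (idx n \<alpha>) = \<alpha>"
  by (simp add: digits_def the_inv_into_f_f[OF inj_on_idx])

lemma set_n_lists_words: "set (List.n_lists k [0..<n]) = words n k"
  by (auto simp: set_n_lists words_def)

lemma sum_list_n_lists: "(\<Sum>\<alpha>\<leftarrow>List.n_lists k [0..<n]. f \<alpha>) = (\<Sum>\<alpha>\<in>words n k. f \<alpha>)"
  by (simp add: sum_list_distinct_conv_sum_set distinct_n_lists set_n_lists_words)

section \<open>Convolution of coefficient functions on words\<close>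

text \<open>Multiplication of noncommutative polynomials given by their coefficients. The
  coefficient ring is left open because it is taken to be the reals as well as a ring of formal
  polynomials.\<close>

definition conv :: "(nat list \<Rightarrow> 'a::comm_ring_1) \<Rightarrow> (nat list \<Rightarrow> 'a) \<Rightarrow> nat list \<Rightarrow> 'a" where
  "conv f g \<alpha> = (\<Sum>j\<le>length \<alpha>. f (take j \<alpha>) * g (drop j \<alpha>))"

definition word_prod :: "(nat \<Rightarrow> 'a::comm_ring_1) \<Rightarrow> nat list \<Rightarrow> 'a" where
  "word_prod z \<alpha> = (\<Prod>i\<leftarrow>\<alpha>. z i)"

lemma word_prod_simps [simp]: "word_prod z [] = 1" "word_prod z (a # \<alpha>) = z a * word_prod z \<alpha>"
  "word_prod z (\<alpha> @ \<beta>) = word_prod z \<alpha> * word_prod z \<beta>"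
  by (simp_all add: word_prod_def)

lemma word_prod_cong: "mset \<alpha> = mset \<beta> \<Longrightarrow> word_prod z \<alpha> = word_prod z \<beta>"
  unfolding word_prod_def by (metis mset_map prod_mset_prod_list)

text \<open>A pair of words is the same as a concatenated word with a cut point. The pairs with
  short concatenation include all of the product on the left, and the degree bounds make the
  additional ones vanish.\<close>

lemma sum_short_words_conv:
  assumes f: "\<And>\<alpha>. N < length \<alpha> \<Longrightarrow> f \<alpha> = 0" and g: "\<And>\<alpha>. M < length \<alpha> \<Longrightarrow> g \<alpha> = 0"
  shows "(\<Sum>\<alpha>\<in>short_words n N. f \<alpha> * word_prod z \<alpha>) * (\<Sum>\<alpha>\<in>short_words n M. g \<alpha> * word_prod z \<alpha>)
    = (\<Sum>\<alpha>\<in>short_words n (N + M). conv f g \<alpha> * word_prod z \<alpha>)"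
proof -
  let ?S = "short_words n"
  let ?F = "\<lambda>(\<beta>, \<gamma>). f \<beta> * g \<gamma> * word_prod z (\<beta> @ \<gamma>)"
  let ?B = "{(\<beta>, \<gamma>). \<beta> @ \<gamma> \<in> ?S (N + M)}"
  have B: "?B = (\<lambda>(\<alpha>, j). (take j \<alpha>, drop j \<alpha>)) ` (SIGMA \<alpha>:?S (N + M). {..length \<alpha>})" (is "_ = ?h ` _")
  proof (rule Set.set_eqI)
    fix p show "p \<in> ?B \<longleftrightarrow> p \<in> ?h ` (SIGMA \<alpha>:?S (N + M). {..length \<alpha>})"
    proof (cases p)
      case (Pair \<beta> \<gamma>)
      have "p = ?h (\<beta> @ \<gamma>, length \<beta>)" using Pair by simp
      moreover have "(\<beta> @ \<gamma>, length \<beta>) \<in> (SIGMA \<alpha>:?S (N + M). {..length \<alpha>})" if "p \<in> ?B"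
        using that Pair by simp
      ultimately have "p \<in> ?B \<Longrightarrow> p \<in> ?h ` (SIGMA \<alpha>:?S (N + M). {..length \<alpha>})" by (rule image_eqI)
      then show ?thesis by auto
    qed
  qed
  have inj: "inj_on ?h (SIGMA \<alpha>:?S (N + M). {..length \<alpha>})"
  proof (rule inj_onI, clarsimp)
    fix \<alpha> i \<beta> j assume "take i \<alpha> = take j \<beta>" "drop i \<alpha> = drop j \<beta>" "i \<le> length \<alpha>" "j \<le> length \<beta>"
    then show "\<alpha> = \<beta> \<and> i = j" by (metis append_take_drop_id length_take min.absorb2)
  qed
  have fin: "finite ?B" unfolding B by (intro finite_imageI finite_SigmaI) auto
  have "(\<Sum>\<alpha>\<in>?S N. f \<alpha> * word_prod z \<alpha>) * (\<Sum>\<alpha>\<in>?S M. g \<alpha> * word_prod z \<alpha>) = sum ?F (?S N \<times> ?S M)"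
    by (simp add: sum_product sum.cartesian_product case_prod_unfold algebra_simps)
  also have "\<dots> = sum ?F ?B"
  proof (rule sum.mono_neutral_left[OF fin])
    show "?S N \<times> ?S M \<subseteq> ?B" by (auto simp: short_words_def)
    show "\<forall>p\<in>?B - ?S N \<times> ?S M. ?F p = 0"
    proof
      fix p assume p: "p \<in> ?B - ?S N \<times> ?S M"
      obtain \<beta> \<gamma> where "p = (\<beta>, \<gamma>)" by (cases p)
      with p have "N < length \<beta> \<or> M < length \<gamma>" by (auto simp: short_words_def)
      then show "?F p = 0" using f g \<open>p = _\<close> by auto
    qed
  qed
  also have "\<dots> = (\<Sum>\<alpha>\<in>?S (N + M). \<Sum>j\<le>length \<alpha>. f (take j \<alpha>) * g (drop j \<alpha>) * word_prod z \<alpha>)"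
    unfolding B by (subst sum.reindex[OF inj]) (simp add: sum.Sigma case_prod_unfold word_prod_simps(3)[symmetric] del: word_prod_simps(3))
  finally show ?thesis by (simp add: conv_def sum_distrib_right)
qed

text \<open>Coefficients of the ordered product of the polynomials \<open>\<tau> a\<close> along the
  letters \<open>a\<close> of the word; \<open>T_sum_idx\<close> identifies them with the entries of
  \<open>T_sum\<close>.\<close>

primrec W :: "(nat \<Rightarrow> nat list \<Rightarrow> 'a::comm_ring_1) \<Rightarrow> nat list \<Rightarrow> nat list \<Rightarrow> 'a" where
  "W \<tau> [] = (\<lambda>\<alpha>. if \<alpha> = [] then 1 else 0)"
| "W \<tau> (a # \<mu>) = conv (\<tau> a) (W \<tau> \<mu>)"

text \<open>Factors without constant term contribute degree at least 1 each.\<close>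

lemma W_eq_0_short:
  assumes "\<And>a. \<tau> a [] = 0" "length \<alpha> < length \<mu>" shows "W \<tau> \<mu> \<alpha> = 0"
  using assms(2)
proof (induction \<mu> arbitrary: \<alpha>)
  case (Cons a \<mu>)
  have "\<tau> a (take j \<alpha>) * W \<tau> \<mu> (drop j \<alpha>) = 0" if "j \<le> length \<alpha>" for j
  proof (cases "j = 0")
    case False
    then have "length (drop j \<alpha>) < length \<mu>" using Cons.prems that by simp
    then show ?thesis using Cons.IH by simp
  qed (simp add: assms)
  then show ?case by (simp add: conv_def)
qed simp

lemma W_eq_0_long:
  assumes "\<And>a \<beta>. d < length \<beta> \<Longrightarrow> \<tau> a \<beta> = 0" "length \<mu> * d < length \<alpha>" shows "W \<tau> \<mu> \<alpha> = 0"
  using assms(2)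
proof (induction \<mu> arbitrary: \<alpha>)
  case (Cons a \<mu>)
  have "\<tau> a (take j \<alpha>) * W \<tau> \<mu> (drop j \<alpha>) = 0" if "j \<le> length \<alpha>" for j
  proof (cases "d < j")
    case True then show ?thesis using that assms(1)[of "take j \<alpha>" a] by simp
  next
    case False
    then have "length \<mu> * d < length (drop j \<alpha>)" using Cons.prems that by simp
    then show ?thesis using Cons.IH by simp
  qed
  then show ?case by (simp add: conv_def)
qed simp

text \<open>Evaluation at commuting values is multiplicative from \<open>conv\<close> to the ring
  product. The degree bound on \<open>\<tau>\<close> keeps the sums finite.\<close>

lemma word_prod_substitute:
  assumes \<tau>: "\<And>a \<beta>. d < length \<beta> \<Longrightarrow> \<tau> a \<beta> = 0"
  shows "word_prod (\<lambda>a. \<Sum>\<alpha>\<in>short_words n d. \<tau> a \<alpha> * word_prod z \<alpha>) \<mu>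
    = (\<Sum>\<alpha>\<in>short_words n (length \<mu> * d). W \<tau> \<mu> \<alpha> * word_prod z \<alpha>)"
proof (induction \<mu>)
  case Nil
  have "short_words n 0 = {[]}" by (auto simp: short_words_def)
  then show ?case by simp
next
  case (Cons a \<mu>)
  have "(\<Sum>\<alpha>\<in>short_words n d. \<tau> a \<alpha> * word_prod z \<alpha>) * (\<Sum>\<alpha>\<in>short_words n (length \<mu> * d). W \<tau> \<mu> \<alpha> * word_prod z \<alpha>)
    = (\<Sum>\<alpha>\<in>short_words n (d + length \<mu> * d). conv (\<tau> a) (W \<tau> \<mu>) \<alpha> * word_prod z \<alpha>)"
    by (rule sum_short_words_conv) (use \<tau> W_eq_0_long[OF \<tau>] in auto)
  with Cons.IH show ?case by simp
qed

text \<open>Read in the ring of formal polynomials, whose monomials are the multisets of variables, the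
  two sides of \<open>word_prod_substitute\<close> can be compared coefficientwise.\<close>

lemma sum_class_W_cong:
  fixes \<tau> :: "nat \<Rightarrow> nat list \<Rightarrow> real"
  assumes \<tau>: "\<And>a \<beta>. d < length \<beta> \<Longrightarrow> \<tau> a \<beta> = 0" and \<mu>: "mset \<mu> = mset \<nu>"
  shows "(\<Sum>\<alpha> | \<alpha> \<in> words n k \<and> mset \<alpha> = A. W \<tau> \<mu> \<alpha>) = (\<Sum>\<alpha> | \<alpha> \<in> words n k \<and> mset \<alpha> = A. W \<tau> \<nu> \<alpha>)"
proof -
  define c :: "real \<Rightarrow> nat multiset \<Rightarrow>\<^sub>0 real" where "c = Poly_Mapping.single {#}"
  define z :: "nat \<Rightarrow> nat multiset \<Rightarrow>\<^sub>0 real" where "z i = Poly_Mapping.single {#i#} 1" for i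
  let ?\<tau> = "\<lambda>a \<beta>. c (\<tau> a \<beta>)"
  have c_sum: "c (sum f X) = (\<Sum>x\<in>X. c (f x))" for f and X :: "nat set"
    by (induction X rule: infinite_finite_induct) (auto simp: c_def single_add)
  have W_c: "W ?\<tau> \<mu> \<alpha> = c (W \<tau> \<mu> \<alpha>)" for \<mu> \<alpha>
  proof (induction \<mu> arbitrary: \<alpha>)
    case (Cons a \<mu>) then show ?case
      by (simp add: conv_def c_sum) (simp add: c_def mult_single)
  qed (simp add: c_def)
  have mono_z: "word_prod z \<alpha> = Poly_Mapping.single (mset \<alpha>) 1" for \<alpha>
    by (induction \<alpha>) (auto simp: z_def mult_single)
  have \<tau>': "d < length \<beta> \<Longrightarrow> ?\<tau> a \<beta> = 0" for a \<beta> using \<tau> by (simp add: c_def)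
  have coeff: "Poly_Mapping.lookup (word_prod (\<lambda>a. \<Sum>\<alpha>\<in>short_words n d. ?\<tau> a \<alpha> * word_prod z \<alpha>) \<mu>) A
     = (\<Sum>\<alpha> | \<alpha> \<in> short_words n (length \<mu> * d) \<and> mset \<alpha> = A. W \<tau> \<mu> \<alpha>)" for \<mu>
  proof -
    have "Poly_Mapping.lookup (c x * word_prod z \<alpha>) A = (if mset \<alpha> = A then x else 0)" for x \<alpha>
      by (simp add: c_def mono_z mult_single Poly_Mapping.lookup_single when_def)
    moreover have "word_prod (\<lambda>a. \<Sum>\<alpha>\<in>short_words n d. ?\<tau> a \<alpha> * word_prod z \<alpha>) \<mu>
        = (\<Sum>\<alpha>\<in>short_words n (length \<mu> * d). c (W \<tau> \<mu> \<alpha>) * word_prod z \<alpha>)"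
      using word_prod_substitute[where d = d and \<tau> = ?\<tau> and n = n and z = z and \<mu> = \<mu>] \<tau>' unfolding W_c by blast
    ultimately show ?thesis
      by (simp add: Poly_Mapping.lookup_sum sum.inter_filter)
  qed
  have len: "length \<mu> = length \<nu>" using \<mu> mset_eq_length by blast
  \<comment> \<open>Extracting a coefficient gives a sum up to the degree bound of the product;
    words of the class beyond that bound have coefficient 0.\<close>
  have key: "(\<Sum>\<alpha> | \<alpha> \<in> words n k \<and> mset \<alpha> = A. W \<tau> \<mu> \<alpha>)
     = (\<Sum>\<alpha> | \<alpha> \<in> short_words n (length \<mu> * d) \<and> mset \<alpha> = A. W \<tau> \<mu> \<alpha>)" if "size A = k" for \<mu>
  proof (rule sum.mono_neutral_right)
    show "{\<alpha> \<in> short_words n (length \<mu> * d). mset \<alpha> = A} \<subseteq> {\<alpha> \<in> words n k. mset \<alpha> = A}"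
      using that by (auto simp: short_words_def words_def)
    show "finite {\<alpha> \<in> words n k. mset \<alpha> = A}" by simp
  qed (auto simp: words_def short_words_def not_le intro!: W_eq_0_long[OF \<tau>])
  show ?thesis
  proof (cases "size A = k")
    case True
    show ?thesis unfolding key[OF True] coeff[symmetric] word_prod_cong[OF \<mu>] ..
  next
    case False
    then have "{\<alpha> \<in> words n k. mset \<alpha> = A} = {}" by (auto simp: words_def)
    then show ?thesis by (simp only: sum.empty)
  qed
qed

section \<open>Horner evaluation over sorted words\<close>

definition sorted_words :: "nat \<Rightarrow> nat \<Rightarrow> nat list set" where
  "sorted_words n r = {\<nu> \<in> words n r. sorted \<nu>}"

text \<open>The cutoff at 3 mirrors the range \<open>i \<ge> 3\<close> in the equations, where the
  quadratic term appears as the Gram part. It makes \<open>horner\<close> vanish in total degree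
  below 3, so that \<open>T (k - 1)\<close> is never requested at stage \<open>k\<close>.\<close>

definition class_sum :: "nat \<Rightarrow> (nat list \<Rightarrow> real) \<Rightarrow> nat list \<Rightarrow> real" where
  "class_sum n v \<nu> = (if length \<nu> < 3 then 0
     else \<Sum>\<mu> | \<mu> \<in> words n (length \<nu>) \<and> mset \<mu> = mset \<nu>. v \<mu>)"

text \<open>The Horner polynomial at the tree node \<open>\<nu>\<close>: the coefficients
  \<open>c\<close> of all sorted extensions of \<open>\<nu>\<close>, multiplied by the product of
  the factors still missing. At the root it is the whole substituted polynomial.\<close>

definition horner :: "nat \<Rightarrow> (nat \<Rightarrow> nat list \<Rightarrow> real) \<Rightarrow> (nat list \<Rightarrow> real) \<Rightarrow> nat list \<Rightarrow> nat list \<Rightarrow> real" where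
  "horner n \<tau> c \<nu> \<alpha> = (\<Sum>\<mu> | \<mu> \<in> short_words n (length \<alpha>) \<and> sorted (\<nu> @ \<mu>). c (\<nu> @ \<mu>) * W \<tau> \<mu> \<alpha>)"

lemma finite_sorted_words [simp]: "finite (sorted_words n r)"
  by (simp add: sorted_words_def)

lemma horner_Nil: "sorted \<nu> \<Longrightarrow> horner n \<tau> c \<nu> [] = c \<nu>"
proof -
  assume "sorted \<nu>"
  then have "{\<mu> \<in> short_words n 0. sorted (\<nu> @ \<mu>)} = {[]}" by (auto simp: short_words_def)
  then show ?thesis by (simp add: horner_def)
qed

lemma horner_eq_0:
  assumes "\<And>\<nu>. length \<nu> < m \<Longrightarrow> c \<nu> = 0" "length \<nu> + length \<alpha> < m" shows "horner n \<tau> c \<nu> \<alpha> = 0"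
  unfolding horner_def using assms by (intro sum.neutral) (auto simp: short_words_def)

text \<open>The missing factors are split into the first one, \<open>a\<close>, and the rest;
  \<open>j\<close> is the degree taken from the factor \<open>a\<close>. The case of no missing
  factor drops out because the empty product has no term of positive degree.\<close>

lemma horner_rec:
  assumes \<tau>: "\<And>a. \<tau> a [] = 0" and "\<alpha> \<noteq> []"
  shows "horner n \<tau> c \<nu> \<alpha> = (\<Sum>a | a < n \<and> sorted (\<nu> @ [a]). \<Sum>j\<in>{1..length \<alpha>}.
    \<tau> a (take j \<alpha>) * horner n \<tau> c (\<nu> @ [a]) (drop j \<alpha>))"
proof -
  let ?N = "length \<alpha> - 1"
  let ?A = "{a. a < n \<and> sorted (\<nu> @ [a])}"
  let ?M = "\<lambda>a N. {\<mu> \<in> short_words n N. sorted ((\<nu> @ [a]) @ \<mu>)}"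
  let ?h = "\<lambda>(a, \<mu>). a # \<mu>"
  have set_eq: "{\<mu> \<in> short_words n (length \<alpha>). sorted (\<nu> @ \<mu>)} - {[]} = ?h ` (SIGMA a:?A. ?M a ?N)" (is "?L = ?R")
  proof (rule Set.set_eqI)
    fix \<beta> show "\<beta> \<in> ?L \<longleftrightarrow> \<beta> \<in> ?R"
    proof (cases \<beta>)
      case (Cons a \<mu>)
      have "Suc (length \<mu>) \<le> length \<alpha> \<longleftrightarrow> length \<mu> \<le> ?N" using \<open>\<alpha> \<noteq> []\<close> by (cases \<alpha>) auto
      then show ?thesis using Cons by (auto simp: short_words_def sorted_append)
    qed auto
  qed
  have inj: "inj_on ?h X" for X by (auto simp: inj_on_def)
  have fin: "finite {\<mu> \<in> short_words n (length \<alpha>). sorted (\<nu> @ \<mu>)}" "\<And>a N. finite (?M a N)" by auto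
  \<comment> \<open>The cut \<open>j = 0\<close> vanishes since \<open>\<tau> a\<close> has no
    constant term.\<close>
  have W: "W \<tau> (a # \<mu>) \<alpha> = (\<Sum>j\<in>{1..length \<alpha>}. \<tau> a (take j \<alpha>) * W \<tau> \<mu> (drop j \<alpha>))" for a \<mu>
    unfolding W.simps conv_def by (rule sum.mono_neutral_right) (auto simp: \<tau> not_le)
  \<comment> \<open>The remaining factors are at most as many as the remaining letters, otherwise
    \<open>W\<close> is 0; so the length bound may depend on \<open>j\<close>.\<close>
  have inner: "(\<Sum>\<mu>\<in>?M a ?N. c (\<nu> @ a # \<mu>) * W \<tau> \<mu> (drop j \<alpha>)) = horner n \<tau> c (\<nu> @ [a]) (drop j \<alpha>)"
    if "j \<in> {1..length \<alpha>}" for a j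
  proof -
    have "(\<Sum>\<mu>\<in>?M a ?N. c (\<nu> @ a # \<mu>) * W \<tau> \<mu> (drop j \<alpha>))
        = (\<Sum>\<mu>\<in>?M a (length (drop j \<alpha>)). c (\<nu> @ a # \<mu>) * W \<tau> \<mu> (drop j \<alpha>))"
    proof (rule sum.mono_neutral_right)
      show "finite (?M a ?N)" by simp
      show "?M a (length (drop j \<alpha>)) \<subseteq> ?M a ?N" using that by (auto simp: short_words_def)
      show "\<forall>\<mu>\<in>?M a ?N - ?M a (length (drop j \<alpha>)). c (\<nu> @ a # \<mu>) * W \<tau> \<mu> (drop j \<alpha>) = 0"
      proof
        fix \<mu> assume "\<mu> \<in> ?M a ?N - ?M a (length (drop j \<alpha>))"
        then have "length (drop j \<alpha>) < length \<mu>" by (auto simp: short_words_def)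
        then show "c (\<nu> @ a # \<mu>) * W \<tau> \<mu> (drop j \<alpha>) = 0" using W_eq_0_short[of \<tau>, OF \<tau>] by simp
      qed
    qed
    then show ?thesis by (simp add: horner_def)
  qed
  have "horner n \<tau> c \<nu> \<alpha> = (\<Sum>\<mu>\<in>?L. c (\<nu> @ \<mu>) * W \<tau> \<mu> \<alpha>)"
    unfolding horner_def using \<open>\<alpha> \<noteq> []\<close> by (intro sum.mono_neutral_right[OF fin(1)]) auto
  also have "\<dots> = (\<Sum>a\<in>?A. \<Sum>\<mu>\<in>?M a ?N. c (\<nu> @ a # \<mu>) * W \<tau> (a # \<mu>) \<alpha>)"
    unfolding set_eq by (subst sum.reindex[OF inj]) (simp add: sum.Sigma fin(2) case_prod_unfold)
  also have "\<dots> = (\<Sum>a\<in>?A. \<Sum>j\<in>{1..length \<alpha>}. \<tau> a (take j \<alpha>) * (\<Sum>\<mu>\<in>?M a ?N. c (\<nu> @ a # \<mu>) * W \<tau> \<mu> (drop j \<alpha>)))"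
    unfolding W sum_distrib_left by (subst sum.swap) (simp add: algebra_simps)
  also have "\<dots> = (\<Sum>a\<in>?A. \<Sum>j\<in>{1..length \<alpha>}. \<tau> a (take j \<alpha>) * horner n \<tau> c (\<nu> @ [a]) (drop j \<alpha>))"
    by (intro sum.cong refl) (simp only: inner)
  finally show ?thesis .
qed

text \<open>Symmetrizing the output makes the tensor of a word of factors independent of their order, so that
  only the sorted words of factors need to be processed.\<close>

lemma sum_class_horner:
  assumes \<tau>: "\<And>a. \<tau> a [] = 0" "\<And>a \<beta>. d < length \<beta> \<Longrightarrow> \<tau> a \<beta> = 0"
  shows "(\<Sum>\<alpha> | \<alpha> \<in> words n k \<and> mset \<alpha> = A. horner n \<tau> (class_sum n v) [] \<alpha>)
    = (\<Sum>\<alpha> | \<alpha> \<in> words n k \<and> mset \<alpha> = A. \<Sum>i=3..k. \<Sum>\<mu>\<in>words n i. v \<mu> * W \<tau> \<mu> \<alpha>)"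
proof -
  let ?C = "{\<alpha> \<in> words n k. mset \<alpha> = A}"
  define F where "F \<mu> = (\<Sum>\<alpha>\<in>?C. W \<tau> \<mu> \<alpha>)" for \<mu>
  have "(\<Sum>\<alpha>\<in>?C. horner n \<tau> (class_sum n v) [] \<alpha>)
      = (\<Sum>\<alpha>\<in>?C. \<Sum>\<mu>\<in>short_words n k. if sorted \<mu> then class_sum n v \<mu> * W \<tau> \<mu> \<alpha> else 0)"
    by (intro sum.cong refl) (auto simp: horner_def words_def sum.inter_filter)
  also have "\<dots> = (\<Sum>\<mu>\<in>short_words n k. if sorted \<mu> then class_sum n v \<mu> * F \<mu> else 0)"
    unfolding F_def by (subst sum.swap) (intro sum.cong refl, simp add: sum_distrib_left)
  also have "\<dots> = (\<Sum>i\<le>k. \<Sum>\<mu>\<in>words n i. if sorted \<mu> then class_sum n v \<mu> * F \<mu> else 0)"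
    by (rule sum_short_words)
  also have "\<dots> = (\<Sum>i=3..k. \<Sum>\<mu>\<in>words n i. if sorted \<mu> then class_sum n v \<mu> * F \<mu> else 0)"
    by (rule sum.mono_neutral_right) (auto simp: class_sum_def words_def intro!: sum.neutral)
  also have "\<dots> = (\<Sum>i=3..k. \<Sum>\<mu>\<in>words n i. v \<mu> * F \<mu>)"
  proof (rule sum.cong[OF refl])
    fix i assume "i \<in> {3..k}"
    have "(\<Sum>\<mu>\<in>words n i. if sorted \<mu> then class_sum n v \<mu> * F \<mu> else 0)
        = (\<Sum>\<mu>\<in>sorted_words n i. class_sum n v \<mu> * F \<mu>)"
      by (simp add: sorted_words_def sum.inter_filter)
    also have "\<dots> = (\<Sum>\<nu>\<in>sorted_words n i. \<Sum>\<mu> | \<mu> \<in> words n i \<and> sort \<mu> = \<nu>. v \<mu> * F \<mu>)"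
    proof (rule sum.cong[OF refl])
      fix \<nu> assume \<nu>: "\<nu> \<in> sorted_words n i"
      have eq: "{\<mu> \<in> words n i. sort \<mu> = \<nu>} = {\<mu> \<in> words n i. mset \<mu> = mset \<nu>}"
        using \<nu> by (auto simp: sorted_words_def intro!: properties_for_sort)
      have len: "length \<nu> = i" using \<nu> by (auto simp: sorted_words_def words_def)
      have "class_sum n v \<nu> * F \<nu> = (\<Sum>\<mu> | \<mu> \<in> words n i \<and> mset \<mu> = mset \<nu>. v \<mu> * F \<nu>)"
        using \<open>i \<in> _\<close> by (simp add: class_sum_def len sum_distrib_right)
      \<comment> \<open>The factors are reordered here: by \<open>sum_class_W_cong\<close>,
        \<open>F\<close> depends only on the multiset of its argument.\<close>
      also have "\<dots> = (\<Sum>\<mu> | \<mu> \<in> words n i \<and> mset \<mu> = mset \<nu>. v \<mu> * F \<mu>)"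
        unfolding F_def using \<tau>(2)
        by (intro sum.cong refl arg_cong2[of _ _ _ _ "(*)"] sum_class_W_cong) auto
      finally show "class_sum n v \<nu> * F \<nu> = (\<Sum>\<mu> | \<mu> \<in> words n i \<and> sort \<mu> = \<nu>. v \<mu> * F \<mu>)"
        unfolding eq .
    qed
    also have "\<dots> = (\<Sum>\<mu>\<in>words n i. v \<mu> * F \<mu>)"
      by (rule sum.group[OF finite_words finite_sorted_words]) (auto simp: sorted_words_def words_def)
    finally show "(\<Sum>\<mu>\<in>words n i. if sorted \<mu> then class_sum n v \<mu> * F \<mu> else 0) = (\<Sum>\<mu>\<in>words n i. v \<mu> * F \<mu>)" .
  qed
  also have "\<dots> = (\<Sum>i=3..k. \<Sum>\<alpha>\<in>?C. \<Sum>\<mu>\<in>words n i. v \<mu> * W \<tau> \<mu> \<alpha>)"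
    unfolding F_def sum_distrib_left by (intro sum.cong refl sum.swap)
  also have "\<dots> = (\<Sum>\<alpha>\<in>?C. \<Sum>i=3..k. \<Sum>\<mu>\<in>words n i. v \<mu> * W \<tau> \<mu> \<alpha>)"
    by (rule sum.swap)
  finally show ?thesis .
qed

section \<open>Counting sorted words\<close>

definition density :: "nat \<Rightarrow> real" where
  "density r = (3/4) ^ (r div 2)"

text \<open>Two letters are stripped at a time. Of the order conditions only
  \<open>a \<le> b\<close> for the leading pair and sortedness of the tail are kept. There are
  \<open>n * (n + 1) / 2\<close> such pairs, at most \<open>3/4 * n ^ 2\<close> because
  \<open>n \<ge> 2\<close>.\<close>

lemma card_sorted_words:
  assumes "2 \<le> n" shows "real (card (sorted_words n r)) \<le> density r * real n ^ r"
proof (induction r rule: nat_induct2)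
  case 0
  have "sorted_words n 0 = {[]}" by (auto simp: sorted_words_def)
  then show ?case by (simp add: density_def)
next
  case 1
  have "card (sorted_words n 1) \<le> card (words n 1)" by (rule card_mono) (auto simp: sorted_words_def)
  then show ?case by (simp add: card_words density_def)
next
  case (step r)
  let ?P = "SIGMA b:{..<n}. {..b}"
  have "card (sorted_words n (r + 2)) \<le> card ((\<lambda>((b, a), \<mu>). a # b # \<mu>) ` (?P \<times> sorted_words n r))"
  proof (rule card_mono)
    show "sorted_words n (r + 2) \<subseteq> (\<lambda>((b, a), \<mu>). a # b # \<mu>) ` (?P \<times> sorted_words n r)"
    proof
      fix \<nu> assume \<nu>: "\<nu> \<in> sorted_words n (r + 2)"
      then obtain a b \<mu> where eq: "\<nu> = a # b # \<mu>"
        by (cases \<nu>; cases "tl \<nu>") (auto simp: sorted_words_def words_def)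
      then show "\<nu> \<in> (\<lambda>((b, a), \<mu>). a # b # \<mu>) ` (?P \<times> sorted_words n r)"
        using \<nu> by (intro image_eqI[of _ _ "((b, a), \<mu>)"]) (auto simp: sorted_words_def words_def)
    qed
  qed auto
  also have "\<dots> \<le> card (?P \<times> sorted_words n r)" by (rule card_image_le) auto
  also have "\<dots> = (\<Sum>b<n. Suc b) * card (sorted_words n r)"
    by (simp add: card_cartesian_product card_SigmaI)
  finally have "real (card (sorted_words n (r + 2))) \<le> real ((\<Sum>b<n. Suc b) * card (sorted_words n r))"
    by (simp only: of_nat_le_iff)
  also have "\<dots> = (\<Sum>b<n. real (Suc b)) * real (card (sorted_words n r))" by simp
  also have "(\<Sum>b<n. real (Suc b)) = real n * (real n + 1) / 2" by (induction n) (auto simp: field_simps)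
  also have "real n * (real n + 1) / 2 * real (card (sorted_words n r))
      \<le> (3/4 * real n ^ 2) * real (card (sorted_words n r))"
    using assms mult_left_mono[of 2 "real n" "real n"]
    by (intro mult_right_mono) (auto simp: power2_eq_square field_simps)
  also have "\<dots> \<le> (3/4 * real n ^ 2) * (density r * real n ^ r)" by (intro mult_left_mono step) auto
  finally show ?case by (simp add: density_def power_add power2_eq_square algebra_simps)
qed

text \<open>Each power of 3/4 occurs twice, so the full series has the value
  \<open>2 / (1 - 3/4) = 8\<close>.\<close>

lemma sum_density: "(\<Sum>r\<le>R. density r) \<le> 8"
proof -
  have "(\<Sum>r<2 * m. density r) = 8 - 8 * (3/4) ^ m" for m
    by (induction m) (auto simp: density_def)
  then have "(\<Sum>r<2 * Suc R. density r) \<le> 8" by (simp only:) simp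
  moreover have "(\<Sum>r\<le>R. density r) \<le> (\<Sum>r<2 * Suc R. density r)"
    by (rule sum_mono2) (auto simp: density_def)
  ultimately show ?thesis by linarith
qed

section \<open>Kronecker products on words\<close>

lemma kpow_vec_carrier: "x \<in> carrier_vec n \<Longrightarrow> kpow_vec x k \<in> carrier_vec (n ^ k)"
  by (induction k) (auto simp: kron_vec_def)

lemma kpow_vec_idx:
  assumes "x \<in> carrier_vec n" "\<alpha> \<in> words n k"
  shows "kpow_vec x k $ idx n \<alpha> = word_prod (\<lambda>i. x $ i) \<alpha>"
  using assms(2)
proof (induction \<alpha> arbitrary: k)
  case Nil then show ?case by (auto simp: words_def)
next
  case (Cons a \<alpha>)
  then obtain k' where k: "k = Suc k'" "a < n" "\<alpha> \<in> words n k'" by auto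
  have dim: "dim_vec (kpow_vec x k') = n ^ k'" "dim_vec x = n" using assms(1) kpow_vec_carrier by auto
  have lt: "idx n (a # \<alpha>) < n * n ^ k'" using idx_less[of "a # \<alpha>" n "Suc k'"] k by simp
  have "idx n ([a] @ \<alpha>) div n ^ k' = idx n [a]" "idx n ([a] @ \<alpha>) mod n ^ k' = idx n \<alpha>"
    using idx_append_div[OF k(3)] by blast+
  with lt Cons.IH[OF k(3)] show ?case by (simp add: k(1) kron_vec_def dim)
qed

lemma scalar_prod_words:
  assumes "u \<in> carrier_vec (n ^ k)" "w \<in> carrier_vec (n ^ k)"
  shows "u \<bullet> w = (\<Sum>\<alpha>\<in>words n k. u $ idx n \<alpha> * w $ idx n \<alpha>)"
  using assms by (simp add: scalar_prod_def atLeast0LessThan sum_idx)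

lemma kron_mat_idx:
  assumes A: "A \<in> carrier_mat n (n ^ i)" and B: "B \<in> carrier_mat (n ^ m) (n ^ l)"
    and "a < n" "\<mu> \<in> words n m" "\<alpha> \<in> words n i" "\<beta> \<in> words n l"
  shows "kron_mat A B $$ (idx n (a # \<mu>), idx n (\<alpha> @ \<beta>)) = A $$ (a, idx n \<alpha>) * B $$ (idx n \<mu>, idx n \<beta>)"
proof -
  have lt: "idx n (a # \<mu>) < n * n ^ m" using idx_less[of "a # \<mu>" n "Suc m"] assms by simp
  have lt': "idx n (\<alpha> @ \<beta>) < n ^ i * n ^ l"
    using idx_less[OF append_in_words[OF assms(5,6)]] by (simp add: power_add)
  have "idx n ([a] @ \<mu>) div n ^ m = idx n [a]" "idx n ([a] @ \<mu>) mod n ^ m = idx n \<mu>"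
    using idx_append_div[OF assms(4)] by blast+
  with lt lt' show ?thesis
    using A B unfolding kron_mat_def by (simp add: idx_append_div[OF assms(6)])
qed

lemma kron_mat_carrier:
  "A \<in> carrier_mat r c \<Longrightarrow> B \<in> carrier_mat r' c' \<Longrightarrow> kron_mat A B \<in> carrier_mat (r * r') (c * c')"
  by (auto simp: kron_mat_def)

lemma kron_list_carrier:
  assumes "\<And>i. i \<in> set is \<Longrightarrow> T i \<in> carrier_mat n (n ^ i)"
  shows "kron_list (map T is) \<in> carrier_mat (n ^ length is) (n ^ sum_list is)"
  using assms
proof (induction "is")
  case (Cons i "is")
  then have "kron_mat (T i) (kron_list (map T is)) \<in> carrier_mat (n * n ^ length is) (n ^ i * n ^ sum_list is)"
    by (intro kron_mat_carrier) auto
  then show ?case by (simp add: kron_list_def power_add)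
qed (simp add: kron_list_def)

text \<open>Component \<open>a\<close> of the transformation as a noncommutative polynomial without
  constant term. The value 0 off the admissible words makes degree bounds hold for all lists of
  letters, as \<open>word_prod_substitute\<close> requires.\<close>

definition coeff_fun :: "nat \<Rightarrow> (nat \<Rightarrow> real mat) \<Rightarrow> nat \<Rightarrow> nat list \<Rightarrow> real" where
  "coeff_fun n T a \<beta> = (if \<beta> = [] \<or> n \<le> a \<or> \<not> set \<beta> \<subseteq> {..<n} then 0 else T (length \<beta>) $$ (a, idx n \<beta>))"

lemma coeff_fun_Nil [simp]: "coeff_fun n T a [] = 0"
  by (simp add: coeff_fun_def)

lemma finite_compositions [simp]: "finite (compositions m l)"
proof (rule finite_subset)
  show "compositions m l \<subseteq> {is. set is \<subseteq> {..l} \<and> length is = m}"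
    by (auto simp: compositions_def member_le_sum_list)
qed (simp add: finite_lists_length_eq)

lemma compositions_Suc:
  "compositions (Suc m) l = (\<lambda>(i, is). i # is) ` (SIGMA i:{1..l}. compositions m (l - i))"
proof (rule Set.set_eqI)
  fix "is" show "is \<in> compositions (Suc m) l \<longleftrightarrow> is \<in> (\<lambda>(i, is). i # is) ` (SIGMA i:{1..l}. compositions m (l - i))"
    by (cases "is") (auto simp: compositions_def image_iff)
qed

text \<open>The first part \<open>i\<close> of a composition is the cut point of the convolution:
  the entry of the Kronecker product factors into an entry of \<open>T i\<close> at the first
  \<open>i\<close> letters and an entry of the remaining product.\<close>

lemma sum_compositions:
  assumes T: "\<And>i. T i \<in> carrier_mat n (n ^ i)" and "\<mu> \<in> words n m" "\<alpha> \<in> words n l"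
  shows "(\<Sum>is\<in>compositions m l. kron_list (map T is) $$ (idx n \<mu>, idx n \<alpha>)) = W (coeff_fun n T) \<mu> \<alpha>"
  using assms(2,3)
proof (induction m arbitrary: l \<mu> \<alpha>)
  case 0
  then have "\<mu> = []" by simp
  show ?case
  proof (cases "l = 0")
    case True
    have "compositions 0 0 = {[]}" by (auto simp: compositions_def)
    then show ?thesis using 0 True by (simp add: kron_list_def)
  next
    case False
    then have "compositions 0 l = {}" by (auto simp: compositions_def)
    then show ?thesis using 0 False by (auto simp: words_def)
  qed
next
  case (Suc m)
  then obtain a \<mu>' where \<mu>: "\<mu> = a # \<mu>'" "a < n" "\<mu>' \<in> words n m" by (auto simp: words_Suc)
  have len: "length \<alpha> = l" using Suc.prems by (auto dest: wordsD)
  have "(\<Sum>is\<in>compositions (Suc m) l. kron_list (map T is) $$ (idx n \<mu>, idx n \<alpha>))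
      = (\<Sum>i=1..l. \<Sum>is\<in>compositions m (l - i). kron_list (map T (i # is)) $$ (idx n \<mu>, idx n \<alpha>))"
    unfolding compositions_Suc
    by (subst sum.reindex) (auto simp: inj_on_def sum.Sigma case_prod_unfold)
  also have "\<dots> = (\<Sum>i=1..l. \<Sum>is\<in>compositions m (l - i).
      T i $$ (a, idx n (take i \<alpha>)) * kron_list (map T is) $$ (idx n \<mu>', idx n (drop i \<alpha>)))"
  proof (intro sum.cong refl)
    fix i "is" assume i: "i \<in> {1..l}" and "is": "is \<in> compositions m (l - i)"
    have B: "kron_list (map T is) \<in> carrier_mat (n ^ m) (n ^ (l - i))"
      using kron_list_carrier[of "is" T n] T "is" by (auto simp: compositions_def)
    have "kron_mat (T i) (kron_list (map T is)) $$ (idx n (a # \<mu>'), idx n (take i \<alpha> @ drop i \<alpha>))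
        = T i $$ (a, idx n (take i \<alpha>)) * kron_list (map T is) $$ (idx n \<mu>', idx n (drop i \<alpha>))"
      using i Suc.prems(2) \<mu> by (intro kron_mat_idx[OF T B]) (auto intro: take_in_words drop_in_words)
    then show "kron_list (map T (i # is)) $$ (idx n \<mu>, idx n \<alpha>)
        = T i $$ (a, idx n (take i \<alpha>)) * kron_list (map T is) $$ (idx n \<mu>', idx n (drop i \<alpha>))"
      by (simp add: kron_list_def \<mu>(1))
  qed
  also have "\<dots> = (\<Sum>i=1..l. coeff_fun n T a (take i \<alpha>) * W (coeff_fun n T) \<mu>' (drop i \<alpha>))"
  proof (intro sum.cong refl)
    fix i assume i: "i \<in> {1..l}"
    then have "take i \<alpha> \<noteq> []" "take i \<alpha> \<in> words n i" using len take_in_words[OF Suc.prems(2), of i] by auto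
    then have "coeff_fun n T a (take i \<alpha>) = T i $$ (a, idx n (take i \<alpha>))"
      using \<mu>(2) by (auto simp: coeff_fun_def words_def)
    then show "(\<Sum>is\<in>compositions m (l - i). T i $$ (a, idx n (take i \<alpha>)) * kron_list (map T is) $$ (idx n \<mu>', idx n (drop i \<alpha>)))
       = coeff_fun n T a (take i \<alpha>) * W (coeff_fun n T) \<mu>' (drop i \<alpha>)"
      using Suc.IH[OF \<mu>(3) drop_in_words[OF Suc.prems(2), of i]]
      by (simp add: sum_distrib_left[symmetric])
  qed
  also have "\<dots> = W (coeff_fun n T) \<mu> \<alpha>"
    unfolding \<mu>(1) W.simps conv_def len by (rule sum.mono_neutral_left) (auto simp: not_le)
  finally show ?case .
qed

lemma T_sum_idx:
  assumes "\<And>i. T i \<in> carrier_mat n (n ^ i)" "\<mu> \<in> words n m" "\<alpha> \<in> words n l"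
  shows "T_sum n T m l $$ (idx n \<mu>, idx n \<alpha>) = W (coeff_fun n T) \<mu> \<alpha>"
  using sum_compositions[OF assms] assms(2,3) by (simp add: T_sum_def idx_less)

lemma T_sum_transpose_mult:
  assumes T: "\<And>i. T i \<in> carrier_mat n (n ^ i)" and u: "u \<in> carrier_vec (n ^ m)" and \<alpha>: "\<alpha> \<in> words n l"
  shows "(transpose_mat (T_sum n T m l) *\<^sub>v u) $ idx n \<alpha> = (\<Sum>\<mu>\<in>words n m. u $ idx n \<mu> * W (coeff_fun n T) \<mu> \<alpha>)"
proof -
  have "T_sum n T m l \<in> carrier_mat (n ^ m) (n ^ l)" by (simp add: T_sum_def)
  then have "(transpose_mat (T_sum n T m l) *\<^sub>v u) $ idx n \<alpha> = (\<Sum>j<n ^ m. T_sum n T m l $$ (j, idx n \<alpha>) * u $ j)"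
    using u idx_less[OF \<alpha>] by (simp add: scalar_prod_def lessThan_atLeast0)
  also have "\<dots> = (\<Sum>\<mu>\<in>words n m. u $ idx n \<mu> * W (coeff_fun n T) \<mu> \<alpha>)"
    unfolding sum_idx using T_sum_idx[OF T _ \<alpha>] by (intro sum.cong) (auto simp: mult.commute)
  finally show ?thesis .
qed

text \<open>The transposed Kronecker power applied one tensor mode at a time, without forming the
  matrix. Its partial evaluations are the intermediate values \<open>mode_val\<close>.\<close>

primrec kron_apply :: "nat \<Rightarrow> real mat \<Rightarrow> nat list \<Rightarrow> (nat list \<Rightarrow> real) \<Rightarrow> real" where
  "kron_apply n A [] f = f []"
| "kron_apply n A (a # \<alpha>) f = (\<Sum>b<n. A $$ (b, a) * kron_apply n A \<alpha> (\<lambda>\<beta>. f (b # \<beta>)))"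

lemma kpow_mat_carrier: "A \<in> carrier_mat n n \<Longrightarrow> kpow_mat A k \<in> carrier_mat (n ^ k) (n ^ k)"
  by (induction k) (auto simp: kpow_mat_def kron_list_def dest: kron_mat_carrier)

lemma kpow_mat_transpose_sum:
  assumes A: "A \<in> carrier_mat n n" and "\<alpha> \<in> words n k"
  shows "(\<Sum>\<beta>\<in>words n k. kpow_mat A k $$ (idx n \<beta>, idx n \<alpha>) * f \<beta>) = kron_apply n A \<alpha> f"
  using assms(2)
proof (induction \<alpha> arbitrary: k f)
  case Nil
  then have "k = 0" by (auto simp: words_def)
  then show ?case by (simp add: kpow_mat_def kron_list_def)
next
  case (Cons a \<alpha>)
  then obtain k' where k: "k = Suc k'" "a < n" "\<alpha> \<in> words n k'" by auto
  have A': "A \<in> carrier_mat n (n ^ 1)" using A by simp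
  have "kpow_mat A (Suc k') $$ (idx n (b # \<beta>), idx n (a # \<alpha>)) = A $$ (b, a) * kpow_mat A k' $$ (idx n \<beta>, idx n \<alpha>)"
    if "b < n" "\<beta> \<in> words n k'" for b \<beta>
    using kron_mat_idx[OF A' kpow_mat_carrier[OF A, of k'] that, of "[a]" \<alpha>] k
    by (simp add: kpow_mat_def kron_list_def)
  then show ?case unfolding k(1) sum_words_Suc
    by (simp add: mult.assoc sum_distrib_left[symmetric] Cons.IH[OF k(3)])
qed

lemma transformed_coeff_idx:
  assumes "T1 \<in> carrier_mat n n" "v i \<in> carrier_vec (n ^ i)" "\<alpha> \<in> words n i"
  shows "transformed_coeff T1 v i $ idx n \<alpha> = kron_apply n T1 \<alpha> (\<lambda>\<beta>. v i $ idx n \<beta>)"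
proof -
  have "kpow_mat T1 i \<in> carrier_mat (n ^ i) (n ^ i)" using assms(1) by (rule kpow_mat_carrier)
  then have "transformed_coeff T1 v i $ idx n \<alpha> = (\<Sum>j<n ^ i. kpow_mat T1 i $$ (j, idx n \<alpha>) * v i $ j)"
    using assms idx_less[OF assms(3)] by (simp add: transformed_coeff_def scalar_prod_def lessThan_atLeast0)
  then show ?thesis by (simp add: sum_idx kpow_mat_transpose_sum[OF assms(1,3)])
qed

lemma transformed_coeff_carrier:
  "T1 \<in> carrier_mat n n \<Longrightarrow> transformed_coeff T1 v i \<in> carrier_vec (n ^ i)"
  using kpow_mat_carrier[of T1 n i] by (simp add: transformed_coeff_def carrier_vecI)

text \<open>Adjointness: transforming the coefficients by the transposed power of \<open>A\<close>
  amounts to inserting the linear forms given by the rows of \<open>A\<close> into the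
  polynomial.\<close>

lemma kron_apply_word_prod:
  "(\<Sum>\<alpha>\<in>words n k. kron_apply n A \<alpha> f * word_prod y \<alpha>)
    = (\<Sum>\<beta>\<in>words n k. f \<beta> * word_prod (\<lambda>b. \<Sum>a<n. A $$ (b, a) * y a) \<beta>)"
proof (induction k arbitrary: f)
  case (Suc k)
  let ?y = "\<lambda>b. \<Sum>a<n. A $$ (b, a) * y a"
  have "(\<Sum>\<alpha>\<in>words n (Suc k). kron_apply n A \<alpha> f * word_prod y \<alpha>)
      = (\<Sum>a<n. \<Sum>\<alpha>\<in>words n k. \<Sum>b<n. A $$ (b, a) * y a * (kron_apply n A \<alpha> (\<lambda>\<beta>. f (b # \<beta>)) * word_prod y \<alpha>))"
    by (simp add: sum_words_Suc sum_distrib_right sum_distrib_left algebra_simps)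
  also have "\<dots> = (\<Sum>a<n. \<Sum>b<n. \<Sum>\<alpha>\<in>words n k. A $$ (b, a) * y a * (kron_apply n A \<alpha> (\<lambda>\<beta>. f (b # \<beta>)) * word_prod y \<alpha>))"
    by (intro sum.cong refl sum.swap)
  also have "\<dots> = (\<Sum>b<n. \<Sum>a<n. \<Sum>\<alpha>\<in>words n k. A $$ (b, a) * y a * (kron_apply n A \<alpha> (\<lambda>\<beta>. f (b # \<beta>)) * word_prod y \<alpha>))"
    by (rule sum.swap)
  also have "\<dots> = (\<Sum>b<n. ?y b * (\<Sum>\<beta>\<in>words n k. f (b # \<beta>) * word_prod ?y \<beta>))"
    by (simp add: sum_distrib_left[symmetric] sum_distrib_right[symmetric] Suc.IH)
  also have "\<dots> = (\<Sum>\<beta>\<in>words n (Suc k). f \<beta> * word_prod ?y \<beta>)"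
    by (simp add: sum_words_Suc sum_distrib_left algebra_simps)
  finally show ?case .
qed simp

text \<open>Stacking columns makes the column index the more significant one. Hence the leading
  letters address the right factor \<open>B\<close> and the trailing letters
  \<open>A\<close>.\<close>

lemma vec_of_gram_idx:
  assumes A: "A \<in> carrier_mat n (n ^ j)" and B: "B \<in> carrier_mat n (n ^ i)" and \<alpha>: "\<alpha> \<in> words n (i + j)"
  shows "vec_of (transpose_mat A * B) $ idx n \<alpha> = (\<Sum>a<n. A $$ (a, idx n (drop i \<alpha>)) * B $$ (a, idx n (take i \<alpha>)))"
proof -
  have parts: "take i \<alpha> \<in> words n i" "drop i \<alpha> \<in> words n j"
    using \<alpha> take_in_words[OF \<alpha>, of i] drop_in_words[OF \<alpha>, of i] by auto
  have "idx n (take i \<alpha> @ drop i \<alpha>) div n ^ j = idx n (take i \<alpha>)" "idx n (take i \<alpha> @ drop i \<alpha>) mod n ^ j = idx n (drop i \<alpha>)"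
    using idx_append_div[OF parts(2)] by blast+
  moreover have "idx n \<alpha> < n ^ j * n ^ i" using idx_less[OF \<alpha>] by (simp add: power_add mult.commute)
  ultimately show ?thesis
    using A B idx_less[OF parts(1)] idx_less[OF parts(2)]
    by (simp add: vec_of_def scalar_prod_def lessThan_atLeast0)
qed

lemma word_prod_count:
  assumes "set \<alpha> \<subseteq> {..<n}" "a < n"
  shows "word_prod (\<lambda>i. vec n (\<lambda>i. if i = a then 2 else (1::real)) $ i) \<alpha> = 2 ^ count (mset \<alpha>) a"
  using assms(1) by (induction \<alpha>) (use \<open>a < n\<close> in auto)

section \<open>The selection matrices\<close>

text \<open>A sorted word whose ends are equal is constant, so the two lists in
  \<open>monomials\<close> together exhaust the sorted words.\<close>

lemma monomials_words:
  assumes "1 \<le> k" shows "set (monomials n k) = sorted_words n k"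
proof (rule Set.set_eqI)
  fix \<mu> show "\<mu> \<in> set (monomials n k) \<longleftrightarrow> \<mu> \<in> sorted_words n k"
  proof
    assume "\<mu> \<in> set (monomials n k)"
    then show "\<mu> \<in> sorted_words n k"
      by (auto simp: monomials_def sorted_words_def set_n_lists_words words_def sorted_replicate)
  next
    assume \<mu>: "\<mu> \<in> sorted_words n k"
    then have len: "length \<mu> = k" "\<mu> \<noteq> []" and "set \<mu> \<subseteq> {..<n}" "sorted \<mu>"
      using assms by (auto simp: sorted_words_def words_def)
    show "\<mu> \<in> set (monomials n k)"
    proof (cases "hd \<mu> = last \<mu>")
      case True
      have "x = hd \<mu>" if x: "x \<in> set \<mu>" for x
      proof (rule antisym)
        show "hd \<mu> \<le> x" using x \<open>sorted \<mu>\<close> by (cases \<mu>) auto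
        obtain ys y where "\<mu> = ys @ [y]" using len(2) by (cases \<mu> rule: rev_cases) auto
        then show "x \<le> hd \<mu>" using x \<open>sorted \<mu>\<close> True by (auto simp: sorted_append)
      qed
      then have "\<mu> = replicate k (hd \<mu>)" using len by (intro replicate_eqI) auto
      moreover have "hd \<mu> < n" using \<open>set \<mu> \<subseteq> _\<close> len(2) by (cases \<mu>) auto
      ultimately show ?thesis by (auto simp: monomials_def)
    next
      case False
      with \<mu> show ?thesis by (auto simp: monomials_def sorted_words_def set_n_lists_words)
    qed
  qed
qed

lemma distinct_monomials:
  assumes "1 \<le> k" shows "distinct (monomials n k)"
proof -
  have "inj_on (replicate k) (set [0..<n])" using assms by (auto simp: inj_on_def)
  moreover have "hd \<mu> = last \<mu>" if "\<mu> \<in> replicate k ` {0..<n}" for \<mu> :: "nat list"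
    using that assms by auto
  ultimately show ?thesis
    by (auto simp: monomials_def distinct_map distinct_n_lists)
qed

lemma length_monomials_ge: "n \<le> length (monomials n k)"
  by (simp add: monomials_def)

lemma monomials_nth_pure: "r < n \<Longrightarrow> monomials n k ! r = replicate k r"
  by (simp add: monomials_def nth_append)

lemma monomials_nth_words: "1 \<le> k \<Longrightarrow> r < length (monomials n k) \<Longrightarrow> monomials n k ! r \<in> words n k"
  using monomials_words[of k n] nth_mem[of r "monomials n k"] by (auto simp: sorted_words_def)

lemma monomials_unique:
  assumes "1 \<le> k" "\<alpha> \<in> words n k"
  shows "\<exists>!r. r < length (monomials n k) \<and> mset \<alpha> = mset (monomials n k ! r)"
proof -
  have "sort \<alpha> \<in> set (monomials n k)"
    using assms by (auto simp: monomials_words sorted_words_def words_def)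
  then obtain r where r: "r < length (monomials n k)" "monomials n k ! r = sort \<alpha>" by (auto simp: in_set_conv_nth)
  show ?thesis
  proof (rule ex1I[of _ r])
    show "r < length (monomials n k) \<and> mset \<alpha> = mset (monomials n k ! r)" using r by simp
    fix s assume s: "s < length (monomials n k) \<and> mset \<alpha> = mset (monomials n k ! s)"
    then have "sorted (monomials n k ! s)" using monomials_words[OF assms(1), of n] nth_mem[of s "monomials n k"] by (auto simp: sorted_words_def)
    with s have "sort \<alpha> = monomials n k ! s" by (intro properties_for_sort) auto
    with r s distinct_monomials[OF assms(1), of n] show "s = r" by (simp add: nth_eq_iff_index_eq)
  qed
qed

lemma dim_N_mat [simp]: "dim_row (N_mat n k) = length (monomials n k)" "dim_col (N_mat n k) = n ^ k"
  by (simp_all add: N_mat_def)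

lemma dim_Nhat_mat [simp]: "dim_row (Nhat_mat n k) = length (monomials n k) - n" "dim_col (Nhat_mat n k) = n ^ k"
  by (simp_all add: Nhat_mat_def)

text \<open>Monomials that agree as functions have equal exponents: the point with 2 in coordinate
  \<open>a\<close> and 1 elsewhere gives the value 2 to the exponent of \<open>a\<close>.\<close>

lemma N_mat_idx:
  assumes "1 \<le> k" "r < length (monomials n k)" "\<alpha> \<in> words n k"
  shows "N_mat n k $$ (r, idx n \<alpha>) = (if mset \<alpha> = mset (monomials n k ! r) then 1 else 0)"
proof -
  let ?\<mu> = "monomials n k ! r"
  have \<mu>: "?\<mu> \<in> words n k" using assms by (intro monomials_nth_words)
  have "(\<forall>x\<in>carrier_vec n. kpow_vec x k $ idx n \<alpha> = (\<Prod>i\<leftarrow>?\<mu>. x $ i)) \<longleftrightarrow> mset \<alpha> = mset ?\<mu>"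
  proof
    assume eq: "\<forall>x\<in>carrier_vec n. kpow_vec x k $ idx n \<alpha> = (\<Prod>i\<leftarrow>?\<mu>. x $ i)"
    show "mset \<alpha> = mset ?\<mu>"
    proof (rule multiset_eqI)
      fix a show "count (mset \<alpha>) a = count (mset ?\<mu>) a"
      proof (cases "a < n")
        case True
        let ?x = "vec n (\<lambda>i. if i = a then 2 else (1::real))"
        have "word_prod (\<lambda>i. ?x $ i) \<alpha> = word_prod (\<lambda>i. ?x $ i) ?\<mu>"
          using eq kpow_vec_idx[of ?x n \<alpha> k] assms(3) by (simp add: word_prod_def)
        then show ?thesis using True assms(3) \<mu> by (simp add: word_prod_count wordsD)
      next
        case False
        then have "a \<notin> set \<alpha>" "a \<notin> set ?\<mu>" using wordsD(2)[OF assms(3)] wordsD(2)[OF \<mu>] by auto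
        then show ?thesis by (metis count_eq_zero_iff set_mset_mset)
      qed
    qed
  next
    assume "mset \<alpha> = mset ?\<mu>"
    then show "\<forall>x\<in>carrier_vec n. kpow_vec x k $ idx n \<alpha> = (\<Prod>i\<leftarrow>?\<mu>. x $ i)"
      using word_prod_cong[of \<alpha> ?\<mu>] assms(3) by (auto simp: kpow_vec_idx word_prod_def)
  qed
  then show ?thesis using assms by (simp add: N_mat_def idx_less)
qed

lemma N_mat_mult_vec:
  assumes "1 \<le> k" "r < length (monomials n k)" "y \<in> carrier_vec (n ^ k)"
  shows "(N_mat n k *\<^sub>v y) $ r = (\<Sum>\<alpha> | \<alpha> \<in> words n k \<and> mset \<alpha> = mset (monomials n k ! r). y $ idx n \<alpha>)"
proof -
  have "(N_mat n k *\<^sub>v y) $ r = (\<Sum>j<n ^ k. N_mat n k $$ (r, j) * y $ j)"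
    using assms by (simp add: scalar_prod_def lessThan_atLeast0)
  also have "\<dots> = (\<Sum>\<alpha>\<in>words n k. if mset \<alpha> = mset (monomials n k ! r) then y $ idx n \<alpha> else 0)"
    unfolding sum_idx using N_mat_idx[OF assms(1,2)] by (intro sum.cong) auto
  finally show ?thesis by (simp add: sum.inter_filter)
qed

lemma Nhat_mat_mult_vec:
  assumes "r < length (monomials n k) - n" "y \<in> carrier_vec (n ^ k)"
  shows "(Nhat_mat n k *\<^sub>v y) $ r = (N_mat n k *\<^sub>v y) $ (n + r)"
  using assms by (auto simp: Nhat_mat_def scalar_prod_def intro!: sum.cong)

lemma sum_words_by_monomial:
  assumes "1 \<le> k"
  shows "(\<Sum>\<alpha>\<in>words n k. f \<alpha>) = (\<Sum>r<length (monomials n k). \<Sum>\<alpha> | \<alpha> \<in> words n k \<and> mset \<alpha> = mset (monomials n k ! r). f \<alpha>)"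
proof -
  let ?R = "length (monomials n k)"
  have "(\<Sum>\<alpha>\<in>words n k. f \<alpha>) = (\<Sum>\<alpha>\<in>words n k. \<Sum>r<?R. if mset \<alpha> = mset (monomials n k ! r) then f \<alpha> else 0)"
  proof (rule sum.cong[OF refl])
    fix \<alpha> assume "\<alpha> \<in> words n k"
    then obtain r where r: "r < ?R" "mset \<alpha> = mset (monomials n k ! r)"
      "\<And>s. s < ?R \<Longrightarrow> mset \<alpha> = mset (monomials n k ! s) \<Longrightarrow> s = r"
      using monomials_unique[OF assms] by metis
    then have "(\<Sum>s<?R. if mset \<alpha> = mset (monomials n k ! s) then f \<alpha> else 0) = (\<Sum>s<?R. if s = r then f \<alpha> else 0)"
      by (intro sum.cong) auto
    then show "f \<alpha> = (\<Sum>s<?R. if mset \<alpha> = mset (monomials n k ! s) then f \<alpha> else 0)" using r(1) by simp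
  qed
  also have "\<dots> = (\<Sum>r<?R. \<Sum>\<alpha>\<in>words n k. if mset \<alpha> = mset (monomials n k ! r) then f \<alpha> else 0)"
    by (rule sum.swap)
  finally show ?thesis by (simp add: sum.inter_filter)
qed

section \<open>Entries of the equations\<close>

definition monomial_class :: "nat \<Rightarrow> nat \<Rightarrow> nat \<Rightarrow> nat list set" where
  "monomial_class n k r = {\<alpha> \<in> words n k. mset \<alpha> = mset (monomials n k ! r)}"

text \<open>The weights \<open>D\<close> are 1 for the first equation and the squared singular
  values for the second, so that both can be treated alike.\<close>

definition gram_part :: "nat \<Rightarrow> (nat \<Rightarrow> real mat) \<Rightarrow> (nat \<Rightarrow> real) \<Rightarrow> nat \<Rightarrow> nat list \<Rightarrow> real" where
  "gram_part n T D k \<alpha> = (\<Sum>i=2..k-2. \<Sum>a<n.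
     T (k - i) $$ (a, idx n (drop i \<alpha>)) * (D a * T i $$ (a, idx n (take i \<alpha>))))"

definition subst_part :: "nat \<Rightarrow> (nat \<Rightarrow> real mat) \<Rightarrow> (nat \<Rightarrow> real Matrix.vec) \<Rightarrow> nat \<Rightarrow> nat list \<Rightarrow> real" where
  "subst_part n T u k \<alpha> = (\<Sum>i=3..k. \<Sum>\<mu>\<in>words n i. u i $ idx n \<mu> * W (coeff_fun n T) \<mu> \<alpha>)"

lemma finite_monomial_class [simp]: "finite (monomial_class n k r)"
  by (simp add: monomial_class_def)

lemma vsum_pairs:
  fixes k :: nat
  assumes "3 \<le> k" "a < N"
  shows "vsum N {(i, j). 2 \<le> i \<and> 2 \<le> j \<and> i + j = k} F $ a = (\<Sum>i=2..k-2. F (i, k - i) $ a)"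
proof -
  have "{(i, j). 2 \<le> i \<and> 2 \<le> j \<and> i + j = k} = (\<lambda>i. (i, k - i)) ` {2..k-2}"
    using assms(1) by (auto simp: image_iff)
  moreover have "inj_on (\<lambda>i. (i, k - i)) {2..k-2}" by (auto simp: inj_on_def)
  ultimately show ?thesis using assms(2) by (simp add: vsum_def sum.reindex)
qed

lemma vsum_subst_part:
  assumes "\<And>i. T i \<in> carrier_mat n (n ^ i)" "\<And>i. i \<in> {3..k} \<Longrightarrow> u i \<in> carrier_vec (n ^ i)" "\<alpha> \<in> words n k"
  shows "vsum (n ^ k) {3..k} (\<lambda>i. transpose_mat (T_sum n T i k) *\<^sub>v u i) $ idx n \<alpha> = subst_part n T u k \<alpha>"
  using assms by (simp add: vsum_def idx_less subst_part_def T_sum_transpose_mult)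

lemma diagonal_mult_idx:
  assumes "S \<in> carrier_mat n n" "diagonal_mat S" "B \<in> carrier_mat n m" "a < n" "j < m"
  shows "(S * S * B) $$ (a, j) = S $$ (a, a) * S $$ (a, a) * B $$ (a, j)"
proof -
  have diag: "(S * C) $$ (b, j) = S $$ (b, b) * C $$ (b, j)" if "C \<in> carrier_mat n l" "b < n" "j < l" for C l b j
  proof -
    have "(S * C) $$ (b, j) = (\<Sum>c<n. S $$ (b, c) * C $$ (c, j))"
      using assms(1) that by (simp add: scalar_prod_def atLeast0LessThan)
    also have "\<dots> = (\<Sum>c<n. if c = b then S $$ (b, b) * C $$ (b, j) else 0)"
      using assms(1,2) \<open>b < n\<close> by (intro sum.cong) (auto simp: diagonal_mat_def)
    finally show ?thesis using \<open>b < n\<close> by simp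
  qed
  have "S * S * B = S * (S * B)" using assms(1,3) by (rule assoc_mult_mat[OF _ assms(1)])
  then show ?thesis using assms diag[of B m a j] diag[of "S * B" m a j] by (simp add: mult.assoc)
qed

lemma dim_vec_rhs [simp]:
  "dim_vec (rhs_c n k T u) = length (monomials n k)"
  "dim_vec (rhs_o n k S T u) = length (monomials n k) - n"
  by (simp_all add: rhs_c_def rhs_o_def)

text \<open>A row of the selection matrix sums over one monomial class, which reduces the right-hand
  side to quantities indexed by words.\<close>

lemma rhs_c_nth:
  assumes "3 \<le> k" "\<And>i. T i \<in> carrier_mat n (n ^ i)" "\<And>i. i \<in> {3..k} \<Longrightarrow> u i \<in> carrier_vec (n ^ i)"
    and r: "r < length (monomials n k)"
  shows "rhs_c n k T u $ r = - (\<Sum>\<alpha>\<in>monomial_class n k r. gram_part n T (\<lambda>_. 1) k \<alpha> + subst_part n T u k \<alpha>)"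
proof -
  let ?g = "vsum (n ^ k) {(i, j). 2 \<le> i \<and> 2 \<le> j \<and> i + j = k} (\<lambda>(i, j). vec_of (transpose_mat (T j) * T i))"
  let ?s = "vsum (n ^ k) {3..k} (\<lambda>i. transpose_mat (T_sum n T i k) *\<^sub>v u i)"
  have "?g $ idx n \<alpha> = gram_part n T (\<lambda>_. 1) k \<alpha>" if "\<alpha> \<in> words n k" for \<alpha>
  proof -
    have "vec_of (transpose_mat (T (k - i)) * T i) $ idx n \<alpha>
       = (\<Sum>a<n. T (k - i) $$ (a, idx n (drop i \<alpha>)) * T i $$ (a, idx n (take i \<alpha>)))" if "i \<in> {2..k-2}" for i
    proof -
      have "i + (k - i) = k" using that by auto
      then show ?thesis
        using vec_of_gram_idx[OF assms(2) assms(2), of \<alpha> i "k - i"] \<open>\<alpha> \<in> words n k\<close> by simp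
    qed
    then show ?thesis using that assms(1) by (simp add: vsum_pairs idx_less gram_part_def)
  qed
  moreover have "?g + ?s \<in> carrier_vec (n ^ k)" by (simp add: vsum_def)
  moreover have "(?g + ?s) $ idx n \<alpha> = ?g $ idx n \<alpha> + ?s $ idx n \<alpha>" if "\<alpha> \<in> words n k" for \<alpha>
    using that by (simp add: vsum_def idx_less)
  moreover have "rhs_c n k T u $ r = - (N_mat n k *\<^sub>v (?g + ?s)) $ r"
    using r by (simp add: rhs_c_def)
  moreover have "?s $ idx n \<alpha> = subst_part n T u k \<alpha>" if "\<alpha> \<in> words n k" for \<alpha>
    using assms(2,3) that by (rule vsum_subst_part)
  ultimately show ?thesis
    using assms(1) r by (simp add: N_mat_mult_vec monomial_class_def del: index_mult_mat_vec)
qed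

lemma rhs_o_nth:
  assumes "3 \<le> k" "\<And>i. T i \<in> carrier_mat n (n ^ i)" "\<And>i. i \<in> {3..k} \<Longrightarrow> u i \<in> carrier_vec (n ^ i)"
    and S: "S \<in> carrier_mat n n" "diagonal_mat S" and r: "r < length (monomials n k) - n"
  shows "rhs_o n k S T u $ r = - (\<Sum>\<alpha>\<in>monomial_class n k (n + r).
    gram_part n T (\<lambda>a. S $$ (a, a) * S $$ (a, a)) k \<alpha> + subst_part n T u k \<alpha>)"
proof -
  let ?g = "vsum (n ^ k) {(i, j). 2 \<le> i \<and> 2 \<le> j \<and> i + j = k} (\<lambda>(i, j). vec_of (transpose_mat (T j) * (S * S) * T i))"
  let ?s = "vsum (n ^ k) {3..k} (\<lambda>i. transpose_mat (T_sum n T i k) *\<^sub>v u i)"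
  have "?g $ idx n \<alpha> = gram_part n T (\<lambda>a. S $$ (a, a) * S $$ (a, a)) k \<alpha>" if \<alpha>: "\<alpha> \<in> words n k" for \<alpha>
  proof -
    have "vec_of (transpose_mat (T (k - i)) * (S * S) * T i) $ idx n \<alpha>
       = (\<Sum>a<n. T (k - i) $$ (a, idx n (drop i \<alpha>)) * (S $$ (a, a) * S $$ (a, a) * T i $$ (a, idx n (take i \<alpha>))))"
      if "i \<in> {2..k-2}" for i
    proof -
      have eq: "transpose_mat (T (k - i)) * (S * S) * T i = transpose_mat (T (k - i)) * (S * S * T i)"
        using S assms(2)[of i] assms(2)[of "k - i"] by (intro assoc_mult_mat[of _ "n ^ (k - i)" n _ n _ "n ^ i"]) auto
      have B: "S * S * T i \<in> carrier_mat n (n ^ i)" using S assms(2)[of i] by simp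
      have "i \<le> k" using that by auto
      then have lt: "idx n (take i \<alpha>) < n ^ i" using \<alpha> by (intro idx_less take_in_words)
      have "\<alpha> \<in> words n (i + (k - i))" using \<alpha> \<open>i \<le> k\<close> by simp
      from vec_of_gram_idx[OF assms(2) B this] show ?thesis
        unfolding eq by (simp add: diagonal_mult_idx[OF S assms(2) _ lt])
    qed
    then show ?thesis using \<alpha> assms(1) by (simp add: vsum_pairs idx_less gram_part_def)
  qed
  moreover have "?g + ?s \<in> carrier_vec (n ^ k)" by (simp add: vsum_def)
  moreover have "(?g + ?s) $ idx n \<alpha> = ?g $ idx n \<alpha> + ?s $ idx n \<alpha>" if "\<alpha> \<in> words n k" for \<alpha>
    using that by (simp add: vsum_def idx_less)
  moreover have "rhs_o n k S T u $ r = - (N_mat n k *\<^sub>v (?g + ?s)) $ (n + r)"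
    using r Nhat_mat_mult_vec[OF r, of "?g + ?s"] by (simp add: rhs_o_def vsum_def del: index_mult_mat_vec)
  moreover have "?s $ idx n \<alpha> = subst_part n T u k \<alpha>" if "\<alpha> \<in> words n k" for \<alpha>
    using assms(2,3) that by (rule vsum_subst_part)
  ultimately show ?thesis
    using assms(1) r by (simp add: N_mat_mult_vec monomial_class_def del: index_mult_mat_vec)
qed

lemma lhs_carrier [simp]:
  "lhs_c n k \<in> carrier_mat (length (monomials n k)) (n ^ k)"
  "S \<in> carrier_mat n n \<Longrightarrow> 1 \<le> k \<Longrightarrow> lhs_o n k S \<in> carrier_mat (length (monomials n k) - n) (n ^ k)"
  by (cases k; auto simp: lhs_c_def lhs_o_def kron_mat_def mult.commute)+

lemma lhs_c_idx:
  assumes "1 \<le> k" "r < length (monomials n k)" "\<alpha> \<in> words n k"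
  shows "lhs_c n k $$ (r, idx n \<alpha>) = (if \<alpha> \<in> monomial_class n k r then 2 else 0)"
  using assms by (simp add: lhs_c_def N_mat_idx idx_less monomial_class_def)

lemma idx_snoc_mod: "a < n \<Longrightarrow> idx n (\<alpha> @ [a]) mod n = a" "a < n \<Longrightarrow> idx n (\<alpha> @ [a]) div n = idx n \<alpha>"
  by (simp_all add: idx_append)

text \<open>In the Kronecker product with the identity on the left, the diagonal factor belongs to
  the least significant digit, hence to the last letter.\<close>

lemma lhs_o_idx:
  assumes k: "1 \<le> k" and S: "S \<in> carrier_mat n n" "diagonal_mat S"
    and r: "r < length (monomials n k) - n" and \<alpha>: "\<alpha> \<in> words n k"
  shows "lhs_o n k S $$ (r, idx n \<alpha>)
    = (if \<alpha> \<in> monomial_class n k (n + r) then 2 * (S $$ (last \<alpha>, last \<alpha>) * S $$ (last \<alpha>, last \<alpha>)) else 0)"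
proof -
  let ?K = "kron_mat (1\<^sub>m (n ^ (k - 1))) (S * S)"
  have pow: "n ^ (k - 1) * n = n ^ k" using k by (cases k) auto
  have K: "?K \<in> carrier_mat (n ^ k) (n ^ k)" using S pow by (auto simp: kron_mat_def)
  have "\<alpha> \<noteq> []" "length \<alpha> = k" using k \<alpha> by (auto simp: words_def)
  then have "last \<alpha> \<in> set \<alpha>" and \<alpha>_eq: "\<alpha> = butlast \<alpha> @ [last \<alpha>]" by simp_all
  then have last: "last \<alpha> < n" using wordsD(2)[OF \<alpha>] by auto
  let ?s = "\<lambda>a. S $$ (a, a) * S $$ (a, a)"
  have SS: "(S * S) $$ (a, b) = (if a = b then ?s a else 0)" if "a < n" "b < n" for a b
    using diagonal_mult_idx[OF S one_carrier_mat that] S that by simp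
  have Kent: "?K $$ (j, idx n \<alpha>) = (if j = idx n \<alpha> then ?s (last \<alpha>) else 0)" if j: "j < n ^ k" for j
  proof -
    have n: "0 < n" using last by auto
    have dm: "idx n \<alpha> mod n = last \<alpha>" "idx n \<alpha> div n = idx n (butlast \<alpha>)"
      using idx_snoc_mod[OF last, of "butlast \<alpha>", folded \<alpha>_eq] .
    have less: "j div n < n ^ (k - 1)" "idx n \<alpha> div n < n ^ (k - 1)"
      using j idx_less[OF \<alpha>] pow by (simp_all add: less_mult_imp_div_less)
    \<comment> \<open>An index is determined by its digits, so the product of the two identity
      patterns is a single one on full indices.\<close>
    have "j = idx n \<alpha> \<longleftrightarrow> j div n = idx n \<alpha> div n \<and> j mod n = idx n \<alpha> mod n"
    proof
      assume eq: "j div n = idx n \<alpha> div n \<and> j mod n = idx n \<alpha> mod n"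
      have "j = j div n * n + j mod n" by simp
      also have "\<dots> = idx n \<alpha> div n * n + idx n \<alpha> mod n" using eq by (simp only:)
      finally show "j = idx n \<alpha>" by simp
    qed simp
    then show ?thesis
      using j idx_less[OF \<alpha>] S n pow less last SS[of "j mod n" "last \<alpha>"]
      by (auto simp: kron_mat_def dm)
  qed
  have "(Nhat_mat n k * ?K) $$ (r, idx n \<alpha>) = (\<Sum>j<n ^ k. Nhat_mat n k $$ (r, j) * ?K $$ (j, idx n \<alpha>))"
    using K r idx_less[OF \<alpha>] by (simp add: scalar_prod_def atLeast0LessThan)
  also have "\<dots> = (\<Sum>j<n ^ k. if j = idx n \<alpha> then Nhat_mat n k $$ (r, idx n \<alpha>) * ?s (last \<alpha>) else 0)"
    using Kent by (intro sum.cong refl) (simp del: One_nat_def)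
  also have "\<dots> = N_mat n k $$ (n + r, idx n \<alpha>) * ?s (last \<alpha>)"
    using r idx_less[OF \<alpha>] by (simp add: Nhat_mat_def)
  finally show ?thesis
    using r K idx_less[OF \<alpha>] k \<alpha> by (simp add: lhs_o_def N_mat_idx monomial_class_def)
qed

section \<open>Programs made of dot products\<close>

text \<open>Apart from the factorizations and \<open>n\<close> divisions, all arithmetic is written
  as dot products; even a copy is a product with \<open>one_reg\<close>. One lemma on execution and
  one on cost then suffice.\<close>

definition dot :: "register \<Rightarrow> (register \<times> register) list \<Rightarrow> program" where
  "dot r ps = Const (Temp [], 0, 1) 0
     # concat (map (\<lambda>(a, b). [Mul (Temp [], 0, 0) a b, Add (Temp [], 0, 1) (Temp [], 0, 1) (Temp [], 0, 0)]) ps)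
     @ [Copy r (Temp [], 0, 1)]"

definition layer :: "('a \<Rightarrow> register) \<Rightarrow> ('a \<Rightarrow> (register \<times> register) list) \<Rightarrow> 'a list \<Rightarrow> program" where
  "layer dst ps xs = concat (map (\<lambda>x. dot (dst x) (ps x)) xs)"

text \<open>\<open>val\<close> assigns to every register the one value that it is meant to hold throughout the run, so that
  correctness of a program reduces to which registers already hold their value. The array
  \<open>Temp []\<close> is scratch space.\<close>

definition agree :: "register set \<Rightarrow> (register \<Rightarrow> real) \<Rightarrow> memory \<Rightarrow> bool" where
  "agree K val M \<longleftrightarrow> (\<forall>r\<in>K. fst r \<noteq> Temp [] \<and> M r = val r)"

lemma agree_mono: "agree K val M \<Longrightarrow> K' \<subseteq> K \<Longrightarrow> agree K' val M"
  by (auto simp: agree_def)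

lemma agreeD: "agree K val M \<Longrightarrow> r \<in> K \<Longrightarrow> M r = val r"
  by (auto simp: agree_def)

lemma exec_products:
  assumes "\<forall>p\<in>set ps. fst p \<in> K \<and> snd p \<in> K" "agree K val M"
  defines "Q \<equiv> concat (map (\<lambda>(a, b). [Mul (Temp [], 0, 0) a b, Add (Temp [], 0, 1) (Temp [], 0, 1) (Temp [], 0, 0)]) ps)"
  shows "agree K val (fold (exec sqf svd) Q M) \<and>
    fold (exec sqf svd) Q M (Temp [], 0, 1) = M (Temp [], 0, 1) + (\<Sum>p\<leftarrow>ps. val (fst p) * val (snd p))"
  using assms(1,2) unfolding Q_def
proof (induction ps arbitrary: M)
  case (Cons p ps)
  obtain a b where p: "p = (a, b)" by (cases p)
  have "a \<in> K" "b \<in> K" using Cons.prems(1) p by simp_all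
  then have ab: "M a = val a" "M b = val b" using Cons.prems(2) by (auto dest: agreeD)
  let ?M = "exec sqf svd (Add (Temp [], 0, 1) (Temp [], 0, 1) (Temp [], 0, 0)) (exec sqf svd (Mul (Temp [], 0, 0) a b) M)"
  have M: "agree K val ?M" using Cons.prems(2) by (auto simp: agree_def)
  have acc: "?M (Temp [], 0, 1) = M (Temp [], 0, 1) + val a * val b" by (simp add: ab)
  have "\<forall>p\<in>set ps. fst p \<in> K \<and> snd p \<in> K" using Cons.prems(1) by simp
  note IH = Cons.IH[OF this M, unfolded acc]
  have step: "fold (exec sqf svd) (concat (map F (p # ps))) M = fold (exec sqf svd) (concat (map F ps)) ?M"
    if "F p = [Mul (Temp [], 0, 0) a b, Add (Temp [], 0, 1) (Temp [], 0, 1) (Temp [], 0, 0)]" for F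
    using that by simp
  show ?case
    using IH by (subst (1 2) step) (simp_all only: p prod.case list.map sum_list.Cons fst_conv snd_conv add.assoc simp_thms)
qed simp

text \<open>Writing to \<open>r\<close> does no harm even if \<open>r\<close> already lies in
  \<open>K\<close>, because the value written is the only one intended for \<open>r\<close>.\<close>

lemma exec_dot:
  assumes "\<forall>p\<in>set ps. fst p \<in> K \<and> snd p \<in> K" "agree K val M"
    and "fst r \<noteq> Temp []" "val r = (\<Sum>p\<leftarrow>ps. val (fst p) * val (snd p))"
  shows "agree (insert r K) val (fold (exec sqf svd) (dot r ps) M)"
proof -
  let ?M = "M((Temp [], 0, 1) := 0)"
  have "agree K val ?M" using assms(2) by (auto simp: agree_def)
  from exec_products[OF assms(1) this, where sqf = sqf and svd = svd] show ?thesis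
    using assms(3,4) by (auto simp: dot_def agree_def)
qed

text \<open>Operands come from \<open>K\<close>, known before the layer starts; dependencies among
  results are expressed by successive layers.\<close>

lemma exec_layer:
  assumes "agree K val M"
    and "\<And>x. x \<in> set xs \<Longrightarrow> fst (dst x) \<noteq> Temp []"
    and "\<And>x. x \<in> set xs \<Longrightarrow> \<forall>p\<in>set (ps x). fst p \<in> K \<and> snd p \<in> K"
    and "\<And>x. x \<in> set xs \<Longrightarrow> val (dst x) = (\<Sum>p\<leftarrow>ps x. val (fst p) * val (snd p))"
  shows "agree (K \<union> dst ` set xs) val (fold (exec sqf svd) (layer dst ps xs) M)"
  using assms
proof (induction xs arbitrary: K M)
  case (Cons x xs)
  let ?M = "fold (exec sqf svd) (dot (dst x) (ps x)) M"
  have M: "agree (insert (dst x) K) val ?M"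
    by (rule exec_dot[OF Cons.prems(3,1,2,4)]) simp_all
  have sub: "\<forall>p\<in>set (ps y). fst p \<in> insert (dst x) K \<and> snd p \<in> insert (dst x) K" if "y \<in> set xs" for y
    using Cons.prems(3)[of y] that by simp
  have "agree (insert (dst x) K \<union> dst ` set xs) val (fold (exec sqf svd) (layer dst ps xs) ?M)"
    by (rule Cons.IH[OF M _ sub]) (simp_all add: Cons.prems(2,4))
  then show ?case by (simp add: layer_def)
qed (simp add: layer_def)

lemma agree_write_mat:
  assumes "agree K val M" "x \<noteq> Temp []" "\<And>i j. i < r \<Longrightarrow> j < c \<Longrightarrow> val (x, i, j) = A $$ (i, j)"
  shows "agree (K \<union> {(x, i, j) | i j. i < r \<and> j < c}) val (write_mat x r c A M)"
  using assms by (auto simp: agree_def write_mat_def)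

lemma flops_append [simp]: "flops \<kappa> (P @ Q) = flops \<kappa> P + flops \<kappa> Q"
  by (simp add: flops_def)

lemma flops_Nil [simp]: "flops \<kappa> [] = 0"
  by (simp add: flops_def)

lemma flops_concat: "flops \<kappa> (concat Ps) = (\<Sum>P\<leftarrow>Ps. flops \<kappa> P)"
  by (induction Ps) auto

lemma flops_dot: "flops \<kappa> (dot r ps) = 2 * length ps"
proof -
  have "sum_list (map (instr_flops \<kappa>) (concat (map (\<lambda>(a, b). [Mul (Temp [], 0, 0) a b,
    Add (Temp [], 0, 1) (Temp [], 0, 1) (Temp [], 0, 0)]) ps))) = 2 * length ps"
    by (induction ps) auto
  then show ?thesis by (simp add: flops_def dot_def)
qed

lemma flops_layer: "flops \<kappa> (layer dst ps xs) = (\<Sum>x\<leftarrow>xs. 2 * length (ps x))"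
  by (simp add: layer_def flops_concat o_def flops_dot)

lemma flops_layer_le:
  assumes "\<And>x. x \<in> set xs \<Longrightarrow> length (ps x) \<le> c"
  shows "flops \<kappa> (layer dst ps xs) \<le> length xs * (2 * c)"
proof -
  have "(\<Sum>x\<leftarrow>xs. 2 * length (ps x)) \<le> (\<Sum>x\<leftarrow>xs. 2 * c)"
    using assms by (intro sum_list_mono) auto
  then show ?thesis by (simp add: flops_layer sum_list_triv)
qed

lemma sum_list_product: "(\<Sum>p\<leftarrow>List.product xs ys. f p) = (\<Sum>x\<leftarrow>xs. \<Sum>y\<leftarrow>ys. f (x, y))"
  by (induction xs) (simp_all add: o_def)

section \<open>Forming one pair of equations\<close>

text \<open>The tag \<open>t\<close> is \<open>0\<close> for the equation of the controllability energy and \<open>1\<close> for that of the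
  observability energy.\<close>

abbreviation "one_reg \<equiv> (Temp [0], 0, 0) :: register"
abbreviation "two_reg \<equiv> (Temp [0], 0, 1) :: register"
abbreviation "neg_reg \<equiv> (Temp [0], 0, 2) :: register"

text \<open>In this and the following \<open>Temp\<close> registers the number heading the list
  marks the family, from which \<open>temp_val\<close> determines how the remaining data are
  decoded.\<close>

definition mat_reg :: "nat \<Rightarrow> nat \<Rightarrow> nat \<Rightarrow> register" where
  "mat_reg x i j = (Temp [1, x], i, j)"

definition diag_reg :: "nat \<Rightarrow> nat \<Rightarrow> register" where
  "diag_reg t a = (Temp [2, t], a, 0)"

definition horner_reg :: "nat \<Rightarrow> nat \<Rightarrow> nat list \<Rightarrow> nat list \<Rightarrow> register" where
  "horner_reg n t \<nu> \<alpha> = (Temp (3 # t # \<nu>), length \<alpha>, idx n \<alpha>)"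

definition mode_reg :: "nat \<Rightarrow> nat \<Rightarrow> nat \<Rightarrow> nat list \<Rightarrow> register" where
  "mode_reg n t p \<alpha> = (Temp [4, t, length \<alpha>, p], idx n \<alpha>, 0)"

definition scaled_reg :: "nat \<Rightarrow> nat \<Rightarrow> nat \<Rightarrow> nat list \<Rightarrow> register" where
  "scaled_reg n t a \<beta> = (Temp [5, t, length \<beta>], a, idx n \<beta>)"

definition total_reg :: "nat \<Rightarrow> nat \<Rightarrow> nat list \<Rightarrow> register" where
  "total_reg n t \<alpha> = (Temp [6, t, length \<alpha>], idx n \<alpha>, 0)"

definition T_reg :: "nat \<Rightarrow> nat \<Rightarrow> nat list \<Rightarrow> register" where
  "T_reg n a \<beta> = (Lower_T (length \<beta>), a, idx n \<beta>)"

definition coeff_reg :: "nat \<Rightarrow> nat \<Rightarrow> nat list \<Rightarrow> register" where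
  "coeff_reg n t \<mu> = ((if t = 0 then Coeff_v else Coeff_w) (length \<mu>), idx n \<mu>, 0)"

definition tilde_reg :: "nat \<Rightarrow> nat \<Rightarrow> nat list \<Rightarrow> register" where
  "tilde_reg n t \<mu> = ((if t = 0 then Out_vt else Out_wt) (length \<mu>), idx n \<mu>, 0)"

definition lhs_reg :: "nat \<Rightarrow> nat \<Rightarrow> nat \<Rightarrow> nat list \<Rightarrow> register" where
  "lhs_reg n t r \<alpha> = ((if t = 0 then Out_lhs_c else Out_lhs_o) (length \<alpha>), r, idx n \<alpha>)"

definition rhs_reg :: "nat \<Rightarrow> nat \<Rightarrow> nat \<Rightarrow> register" where
  "rhs_reg t k r = ((if t = 0 then Out_rhs_c else Out_rhs_o) k, r, 0)"

lemmas reg_defs = mat_reg_def diag_reg_def horner_reg_def mode_reg_def scaled_reg_def total_reg_def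
  T_reg_def coeff_reg_def tilde_reg_def lhs_reg_def rhs_reg_def

abbreviation all_words :: "nat \<Rightarrow> nat \<Rightarrow> nat list list" where
  "all_words n k \<equiv> List.n_lists k [0..<n]"

text \<open>The second equation leaves out the first \<open>n\<close> rows, those of the pure
  powers.\<close>

definition row_offset :: "nat \<Rightarrow> nat \<Rightarrow> nat" where
  "row_offset n t = (if t = 0 then 0 else n)"

definition class_words :: "nat \<Rightarrow> nat \<Rightarrow> nat list \<Rightarrow> nat list list" where
  "class_words n k \<nu> = filter (\<lambda>\<mu>. mset \<mu> = mset \<nu>) (all_words n k)"

text \<open>The leaves of the tree in total degree \<open>k\<close>, where no output letters remain:
  the coefficients are collected over each class of words.\<close>

definition horner_start :: "nat \<Rightarrow> nat \<Rightarrow> nat \<Rightarrow> program" where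
  "horner_start n t k = layer (\<lambda>\<nu>. horner_reg n t \<nu> [])
     (\<lambda>\<nu>. map (\<lambda>\<mu>. (tilde_reg n t \<mu>, one_reg)) (class_words n k \<nu>))
     (filter sorted (all_words n k))"

text \<open>Only total degree \<open>k\<close> is computed, for output words of length
  \<open>s\<close>. The operand belonging to \<open>j\<close> has total degree
  \<open>k + 1 - j\<close>: for \<open>j = 1\<close> it comes from the previous step, for larger
  \<open>j\<close> from an earlier stage. The bound \<open>k - 2\<close> drops only operands of
  total degree below 3, which are 0, and with them every use of undelivered coefficients.\<close>

definition horner_step :: "nat \<Rightarrow> nat \<Rightarrow> nat \<Rightarrow> nat \<Rightarrow> program" where
  "horner_step n t k s = layer (\<lambda>(\<nu>, \<alpha>). horner_reg n t \<nu> \<alpha>)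
     (\<lambda>(\<nu>, \<alpha>). map (\<lambda>(a, j). (T_reg n a (take j \<alpha>), horner_reg n t (\<nu> @ [a]) (drop j \<alpha>)))
        (List.product (filter (\<lambda>a. sorted (\<nu> @ [a])) [0..<n]) [1..<Suc (min s (k - 2))]))
     (List.product (filter sorted (all_words n (k - s))) (all_words n s))"

text \<open>The weights are multiplied in once per delivered coefficient; otherwise each product of
  the Gram part would need an additional multiplication. Stage \<open>k\<close> has to do this only
  for \<open>i = k - 2\<close>.\<close>

definition scaled_layer :: "nat \<Rightarrow> nat \<Rightarrow> nat \<Rightarrow> program" where
  "scaled_layer n t i = layer (\<lambda>(a, \<beta>). scaled_reg n t a \<beta>) (\<lambda>(a, \<beta>). [(diag_reg t a, T_reg n a \<beta>)])
     (List.product [0..<n] (all_words n i))"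

definition total_layer :: "nat \<Rightarrow> nat \<Rightarrow> nat \<Rightarrow> program" where
  "total_layer n t k = layer (total_reg n t)
     (\<lambda>\<alpha>. (horner_reg n t [] \<alpha>, one_reg)
        # map (\<lambda>(i, a). (T_reg n a (drop i \<alpha>), scaled_reg n t a (take i \<alpha>))) (List.product [2..<k - 1] [0..<n]))
     (all_words n k)"

definition rhs_layer :: "nat \<Rightarrow> nat \<Rightarrow> nat \<Rightarrow> program" where
  "rhs_layer n t k = layer (rhs_reg t k)
     (\<lambda>r. map (\<lambda>\<alpha>. (total_reg n t \<alpha>, neg_reg)) (class_words n k (monomials n k ! (row_offset n t + r))))
     [0..<length (monomials n k) - row_offset n t]"

text \<open>The array has far more than \<open>n ^ k\<close> entries, but a zero entry is an empty
  dot product and costs nothing. Since each word belongs to one monomial, at most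
  \<open>n ^ k\<close> entries are charged.\<close>

definition lhs_layer :: "nat \<Rightarrow> nat \<Rightarrow> nat \<Rightarrow> program" where
  "lhs_layer n t k = layer (\<lambda>(r, \<alpha>). lhs_reg n t r \<alpha>)
     (\<lambda>(r, \<alpha>). if mset \<alpha> = mset (monomials n k ! (row_offset n t + r)) then [(two_reg, diag_reg t (last \<alpha>))] else [])
     (List.product [0..<length (monomials n k) - row_offset n t] (all_words n k))"

definition equation_program :: "nat \<Rightarrow> nat \<Rightarrow> nat \<Rightarrow> program" where
  "equation_program n t k = horner_start n t k @ concat (map (horner_step n t k) [1..<Suc k])
     @ scaled_layer n t (k - 2) @ total_layer n t k @ rhs_layer n t k @ lhs_layer n t k"

section \<open>Operation count for one pair of equations\<close>

lemma length_all_words: "length (all_words n k) = n ^ k"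
  by (simp add: length_n_lists)

lemma length_class_words: "length (class_words n k \<nu>) = card {\<mu> \<in> words n k. mset \<mu> = mset \<nu>}"
  by (simp add: class_words_def distinct_length_filter distinct_n_lists set_n_lists_words Int_def conj_commute)

lemma set_class_words: "set (class_words n k \<nu>) = {\<mu> \<in> words n k. mset \<mu> = mset \<nu>}"
  by (auto simp: class_words_def set_n_lists_words)

lemma sum_list_class_words: "(\<Sum>\<mu>\<leftarrow>class_words n k \<nu>. f \<mu>) = (\<Sum>\<mu> | \<mu> \<in> words n k \<and> mset \<mu> = mset \<nu>. f \<mu>)"
  by (simp add: sum_list_distinct_conv_sum_set class_words_def distinct_n_lists set_n_lists_words)

lemma sum_card_classes:
  assumes "1 \<le> k"
  shows "(\<Sum>r<length (monomials n k). card {\<mu> \<in> words n k. mset \<mu> = mset (monomials n k ! r)}) = n ^ k"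
  using sum_words_by_monomial[OF assms, where n = n and f = "\<lambda>_. 1 :: nat"] by (simp add: card_words)

lemma sum_card_classes_offset:
  assumes "1 \<le> k"
  shows "(\<Sum>r<length (monomials n k) - c. card {\<mu> \<in> words n k. mset \<mu> = mset (monomials n k ! (c + r))}) \<le> n ^ k"
proof -
  let ?f = "\<lambda>r. card {\<mu> \<in> words n k. mset \<mu> = mset (monomials n k ! r)}"
  have "(\<Sum>r<length (monomials n k) - c. ?f (c + r)) = sum ?f ((+) c ` {..<length (monomials n k) - c})"
    by (simp add: sum.reindex)
  also have "\<dots> \<le> sum ?f {..<length (monomials n k)}" by (rule sum_mono2) auto
  finally show ?thesis by (simp add: sum_card_classes[OF assms])
qed

text \<open>The monomial classes partition the words, so each word is used exactly once.\<close>

lemma flops_horner_start: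
  assumes "1 \<le> k" shows "flops \<kappa> (horner_start n t k) \<le> 2 * n ^ k"
proof -
  have "flops \<kappa> (horner_start n t k) = 2 * (\<Sum>\<nu>\<in>sorted_words n k. card {\<mu> \<in> words n k. mset \<mu> = mset \<nu>})"
    by (simp add: horner_start_def flops_layer length_class_words sum_list_distinct_conv_sum_set
        distinct_n_lists set_n_lists_words sorted_words_def sum_distrib_left)
  also have "(\<Sum>\<nu>\<in>sorted_words n k. card {\<mu> \<in> words n k. mset \<mu> = mset \<nu>})
      = (\<Sum>\<nu>\<leftarrow>monomials n k. card {\<mu> \<in> words n k. mset \<mu> = mset \<nu>})"
    by (simp add: sum_list_distinct_conv_sum_set distinct_monomials[OF assms] monomials_words[OF assms])
  also have "\<dots> = n ^ k"
    by (simp add: sum_list_sum_nth atLeast0LessThan sum_card_classes[OF assms])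
  finally show ?thesis by simp
qed

lemma length_sorted_filter: "length (filter sorted (all_words n k)) = card (sorted_words n k)"
  by (simp add: distinct_length_filter distinct_n_lists set_n_lists_words sorted_words_def Int_def conj_commute)

lemma flops_horner_step:
  "flops \<kappa> (horner_step n t k s) \<le> card (sorted_words n (k - s)) * n ^ s * (2 * (n * s))"
proof -
  have "flops \<kappa> (horner_step n t k s) \<le> length (List.product (filter sorted (all_words n (k - s))) (all_words n s)) * (2 * (n * s))"
    unfolding horner_step_def
  proof (rule flops_layer_le)
    fix x assume "x \<in> set (List.product (filter sorted (all_words n (k - s))) (all_words n s))"
    obtain \<nu> \<alpha> where x: "x = (\<nu>, \<alpha>)" by (cases x)
    have "length (filter (\<lambda>a. sorted (\<nu> @ [a])) [0..<n]) \<le> n"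
      using length_filter_le[of _ "[0..<n]"] by simp
    then have "length (filter (\<lambda>a. sorted (\<nu> @ [a])) [0..<n]) * min s (k - 2) \<le> n * s"
      by (intro mult_le_mono) auto
    then show "length (case x of (\<nu>, \<alpha>) \<Rightarrow> map (\<lambda>(a, j). (T_reg n a (take j \<alpha>), horner_reg n t (\<nu> @ [a]) (drop j \<alpha>)))
        (List.product (filter (\<lambda>a. sorted (\<nu> @ [a])) [0..<n]) [1..<Suc (min s (k - 2))])) \<le> n * s"
      by (simp add: x del: upt_Suc)
  qed
  then show ?thesis by (simp only: length_product length_sorted_filter length_all_words)
qed

text \<open>Step \<open>s\<close> has at most \<open>density (k - s) * n ^ (k - s)\<close> nodes,
  \<open>n ^ s\<close> output words per node and \<open>n * s\<close> products per entry, at two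
  operations each. With \<open>s \<le> k\<close> and the total density 8 this gives the constant
  16.\<close>

lemma flops_horner_steps:
  assumes "2 \<le> n" shows "real (flops \<kappa> (concat (map (horner_step n t k) [1..<Suc k]))) \<le> 16 * k * real n ^ (k + 1)"
proof -
  have "real (flops \<kappa> (horner_step n t k s)) \<le> density (k - s) * (2 * k * real n ^ (k + 1))" if "s \<in> {1..k}" for s
  proof -
    have "real (flops \<kappa> (horner_step n t k s)) \<le> real (card (sorted_words n (k - s))) * (real n ^ s * (2 * (n * s)))"
      using flops_horner_step[of \<kappa> n t k s] by (simp only: of_nat_le_iff[where 'a = real, symmetric] of_nat_mult of_nat_power of_nat_numeral mult.assoc)
    also have "\<dots> \<le> (density (k - s) * real n ^ (k - s)) * (real n ^ s * (2 * (n * k)))"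
      using that by (intro mult_mono card_sorted_words assms mult_left_mono mult_nonneg_nonneg) (auto simp: density_def intro: mult_left_mono)
    also have "\<dots> = density (k - s) * (2 * k * (real n ^ (k - s + s) * n))"
      by (simp only: power_add) (simp add: algebra_simps)
    finally show ?thesis using that by (simp add: mult.commute)
  qed
  then have "(\<Sum>s\<in>{1..k}. real (flops \<kappa> (horner_step n t k s))) \<le> (\<Sum>s\<in>{1..k}. density (k - s) * (2 * k * real n ^ (k + 1)))"
    by (rule sum_mono)
  also have "\<dots> = (\<Sum>s\<in>{1..k}. density (k - s)) * (2 * k * real n ^ (k + 1))"
    by (rule sum_distrib_right[symmetric])
  also have "(\<Sum>s\<in>{1..k}. density (k - s)) \<le> (\<Sum>r\<le>k. density r)"
  proof -
    have "(\<Sum>s\<in>{1..k}. density (k - s)) = sum density ((\<lambda>s. k - s) ` {1..k})"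
      by (subst sum.reindex) (auto simp: inj_on_def)
    also have "\<dots> \<le> (\<Sum>r\<le>k. density r)" by (rule sum_mono2) (auto simp: density_def)
    finally show ?thesis .
  qed
  then have "(\<Sum>s\<in>{1..k}. density (k - s)) * (2 * k * real n ^ (k + 1)) \<le> 8 * (2 * k * real n ^ (k + 1))"
    using sum_density[of k] by (intro mult_right_mono) auto
  finally show ?thesis
    by (simp add: flops_concat o_def sum_list_distinct_conv_sum_set atLeastLessThanSuc_atLeastAtMost del: upt_Suc)
qed

lemma flops_scaled_layer: "flops \<kappa> (scaled_layer n t i) = 2 * n ^ (i + 1)"
proof -
  have "flops \<kappa> (scaled_layer n t i) = (\<Sum>x\<leftarrow>List.product [0..<n] (all_words n i). 2)"
    unfolding scaled_layer_def flops_layer by (intro arg_cong[of _ _ sum_list] map_cong) auto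
  then show ?thesis by (simp add: sum_list_triv length_all_words)
qed

lemma flops_total_layer: "flops \<kappa> (total_layer n t k) \<le> n ^ k * (2 * (1 + k * n))"
proof -
  have "flops \<kappa> (total_layer n t k) \<le> length (all_words n k) * (2 * (1 + k * n))"
    unfolding total_layer_def by (rule flops_layer_le) auto
  then show ?thesis by (simp add: length_all_words)
qed

lemma flops_rhs_layer:
  assumes "1 \<le> k" shows "flops \<kappa> (rhs_layer n t k) \<le> 2 * n ^ k"
  using sum_card_classes_offset[OF assms, of n "row_offset n t"]
  by (simp add: rhs_layer_def flops_layer length_class_words interv_sum_list_conv_sum_set_nat
      atLeast0LessThan sum_distrib_left[symmetric])

lemma flops_lhs_layer:
  assumes "1 \<le> k" shows "flops \<kappa> (lhs_layer n t k) \<le> 2 * n ^ k"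
proof -
  have "(\<Sum>\<alpha>\<leftarrow>all_words n k. 2 * length (if mset \<alpha> = A then [(two_reg, diag_reg t (last \<alpha>))] else []))
      = 2 * card {\<alpha> \<in> words n k. mset \<alpha> = A}" for A
    by (simp add: sum_list_n_lists if_distrib[of length] if_distrib[of "(*) 2"] sum.If_cases Int_def cong: if_cong)
  then have "flops \<kappa> (lhs_layer n t k) = (\<Sum>r\<leftarrow>[0..<length (monomials n k) - row_offset n t].
      2 * card {\<alpha> \<in> words n k. mset \<alpha> = mset (monomials n k ! (row_offset n t + r))})"
    by (simp add: lhs_layer_def flops_layer sum_list_product)
  then show ?thesis using sum_card_classes_offset[OF assms, of n "row_offset n t"]
    by (simp add: interv_sum_list_conv_sum_set_nat atLeast0LessThan sum_distrib_left[symmetric])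
qed

text \<open>28 is 16 for the Horner steps and 12 for the remaining layers, whose terms
  \<open>8 * n ^ k\<close>, \<open>2 * n ^ (k - 1)\<close> and \<open>2 * k * n ^ (k + 1)\<close>
  are each compared with \<open>k * n ^ (k + 1)\<close>.\<close>

lemma flops_equation_program:
  assumes "2 \<le> n" "3 \<le> k" shows "real (flops \<kappa> (equation_program n t k)) \<le> 28 * k * real n ^ (k + 1)"
proof -
  have pow: "n ^ k \<le> k * n ^ (k + 1)" "n ^ (k - 2 + 1) \<le> k * n ^ (k + 1)"
    using assms power_increasing[of k "k + 1" n] power_increasing[of "k - 2 + 1" "k + 1" n]
    by (auto intro: order_trans[OF _ mult_le_mono1[of 1 k]])
  have "flops \<kappa> (equation_program n t k) \<le> flops \<kappa> (concat (map (horner_step n t k) [1..<Suc k]))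
      + 2 * n ^ k + 2 * n ^ (k - 2 + 1) + n ^ k * (2 * (1 + k * n)) + 2 * n ^ k + 2 * n ^ k"
    using assms flops_horner_start[of k \<kappa> n t] flops_scaled_layer[of \<kappa> n t "k - 2"] flops_total_layer[of \<kappa> n t k]
      flops_rhs_layer[of k \<kappa> n t] flops_lhs_layer[of k \<kappa> n t]
    by (simp only: equation_program_def flops_append) linarith
  also have "\<dots> = flops \<kappa> (concat (map (horner_step n t k) [1..<Suc k]))
      + 8 * n ^ k + 2 * n ^ (k - 2 + 1) + 2 * (k * n ^ (k + 1))"
    by (simp add: algebra_simps)
  also have "\<dots> \<le> flops \<kappa> (concat (map (horner_step n t k) [1..<Suc k])) + 12 * (k * n ^ (k + 1))"
    using pow by linarith
  finally have "real (flops \<kappa> (equation_program n t k))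
      \<le> real (flops \<kappa> (concat (map (horner_step n t k) [1..<Suc k]))) + 12 * (k * real n ^ (k + 1))"
    by (simp only: of_nat_le_iff[where 'a = real, symmetric] of_nat_add of_nat_mult of_nat_power of_nat_numeral)
  with flops_horner_steps[OF assms(1), of \<kappa> t k] show ?thesis by (simp add: algebra_simps)
qed

section \<open>The first stage\<close>

definition block :: "array \<Rightarrow> nat \<Rightarrow> nat \<Rightarrow> register set" where
  "block x r c = {(x, i, j) | i j. i < r \<and> j < c}"

lemma in_block [simp]: "(x, i, j) \<in> block y r c \<longleftrightarrow> x = y \<and> i < r \<and> j < c"
  by (auto simp: block_def)

definition square :: "array \<Rightarrow> nat \<Rightarrow> (nat \<Rightarrow> nat \<Rightarrow> (register \<times> register) list) \<Rightarrow> program" where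
  "square x n ps = layer (\<lambda>(i, j). (x, i, j)) (\<lambda>(i, j). ps i j) (List.product [0..<n] [0..<n])"

lemma exec_square:
  assumes "agree K val M" "x \<noteq> Temp []"
    and "\<And>i j. i < n \<Longrightarrow> j < n \<Longrightarrow> \<forall>p\<in>set (ps i j). fst p \<in> K \<and> snd p \<in> K"
    and "\<And>i j. i < n \<Longrightarrow> j < n \<Longrightarrow> val (x, i, j) = (\<Sum>p\<leftarrow>ps i j. val (fst p) * val (snd p))"
  shows "agree (K \<union> block x n n) val (fold (exec sqf svd) (square x n ps) M)"
proof -
  let ?xs = "List.product [0..<n] [0..<n]"
  have "agree (K \<union> (\<lambda>(i, j). (x, i, j)) ` set ?xs) val (fold (exec sqf svd) (square x n ps) M)"
    unfolding square_def
  proof (rule exec_layer[OF assms(1)])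
    fix p assume "p \<in> set ?xs"
    then obtain i j where p: "p = (i, j)" "i < n" "j < n" by auto
    show "fst (case p of (i, j) \<Rightarrow> (x, i, j)) \<noteq> Temp []" using assms(2) p by simp
    show "\<forall>q\<in>set (case p of (i, j) \<Rightarrow> ps i j). fst q \<in> K \<and> snd q \<in> K" using assms(3)[OF p(2,3)] p(1) by simp
    show "val (case p of (i, j) \<Rightarrow> (x, i, j)) = (\<Sum>q\<leftarrow>(case p of (i, j) \<Rightarrow> ps i j). val (fst q) * val (snd q))"
      using assms(4)[OF p(2,3)] p(1) by simp
  qed
  moreover have "(\<lambda>(i, j). (x, i, j)) ` set ?xs = block x n n" by (auto simp: block_def image_iff)
  ultimately show ?thesis by simp
qed

lemma flops_square_le:
  assumes "\<And>i j. length (ps i j) \<le> c" shows "flops \<kappa> (square x n ps) \<le> 2 * c * (n * n)"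
  using flops_layer_le[of "List.product [0..<n] [0..<n]" "\<lambda>(i, j). ps i j" c \<kappa> "\<lambda>(i, j). (x, i, j)"] assms
  by (auto simp: square_def algebra_simps split: prod.splits)

text \<open>The transposed inverse of \<open>R\<close> is computed without pivoting, from the singular value decomposition
  of the transpose of \<open>R\<close>.\<close>

definition factor_program :: "nat \<Rightarrow> program" where
  "factor_program n =
     [Const one_reg 1, Const two_reg 2, Const neg_reg (- 1)]
     @ square (Temp [1, 0]) n (\<lambda>i j. [((Coeff_v 2, i + j * n, 0), one_reg)])
     @ square (Temp [1, 1]) n (\<lambda>i j. [((Coeff_w 2, i + j * n, 0), one_reg)])
     @ [Sqrt_Factor n Out_R (Temp [1, 0]), Sqrt_Factor n Out_L (Temp [1, 1])]
     @ square (Temp [1, 2]) n (\<lambda>i j. [((Out_R, j, i), one_reg)])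
     @ [SVD n (Temp [1, 3]) (Temp [1, 4]) (Temp [1, 5]) (Temp [1, 2])]
     @ map (\<lambda>i. Div (mat_reg 6 i 0) one_reg (mat_reg 4 i i)) [0..<n]
     @ square (Temp [1, 7]) n (\<lambda>i l. [(mat_reg 5 i l, mat_reg 6 l 0)])
     @ square (Temp [1, 8]) n (\<lambda>i j. map (\<lambda>l. (mat_reg 7 i l, mat_reg 3 j l)) [0..<n])
     @ square (Temp [1, 9]) n (\<lambda>i j. map (\<lambda>l. ((Out_L, l, i), mat_reg 8 l j)) [0..<n])
     @ [SVD n Out_U Out_S Out_V (Temp [1, 9])]
     @ square Out_T1 n (\<lambda>i j. map (\<lambda>l. (mat_reg 8 i l, (Out_V, l, j))) [0..<n])
     @ layer (diag_reg 0) (\<lambda>_. [(one_reg, one_reg)]) [0..<n]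
     @ layer (diag_reg 1) (\<lambda>a. [((Out_S, a, a), (Out_S, a, a))]) [0..<n]"

definition mode_start :: "nat \<Rightarrow> nat \<Rightarrow> nat \<Rightarrow> program" where
  "mode_start n t i = layer (mode_reg n t 0) (\<lambda>\<gamma>. [(coeff_reg n t \<gamma>, one_reg)]) (all_words n i)"

text \<open>Each pass contracts one letter with \<open>T1\<close>, from the last letter to the
  first. The \<open>i\<close> passes cost \<open>2 * n ^ (i + 1)\<close> each, whereas the full
  Kronecker power has \<open>n ^ (2 * i)\<close> entries.\<close>

definition mode_step :: "nat \<Rightarrow> nat \<Rightarrow> nat \<Rightarrow> nat \<Rightarrow> program" where
  "mode_step n t i p = layer (mode_reg n t (Suc p))
     (\<lambda>\<gamma>. map (\<lambda>b. ((Out_T1, b, \<gamma> ! (i - Suc p)), mode_reg n t p (\<gamma>[i - Suc p := b]))) [0..<n])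
     (all_words n i)"

definition mode_end :: "nat \<Rightarrow> nat \<Rightarrow> nat \<Rightarrow> program" where
  "mode_end n t i = layer (tilde_reg n t) (\<lambda>\<gamma>. [(mode_reg n t i \<gamma>, one_reg)]) (all_words n i)"

definition mode_program :: "nat \<Rightarrow> nat \<Rightarrow> nat \<Rightarrow> program" where
  "mode_program n t i = mode_start n t i @ concat (map (mode_step n t i) [0..<i]) @ mode_end n t i"

definition setup_program :: "nat \<Rightarrow> nat \<Rightarrow> program" where
  "setup_program n d = factor_program n
     @ concat (map (mode_program n 0) [2..<Suc d]) @ concat (map (mode_program n 1) [2..<Suc d])"

definition balancing_program :: "nat \<Rightarrow> nat \<Rightarrow> nat \<Rightarrow> program" where
  "balancing_program n d k =
     (if k = 2 then setup_program n d else equation_program n 0 k @ equation_program n 1 k)"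

section \<open>Operation count of the first stage and of the whole run\<close>

lemma flops_mode_program: "flops \<kappa> (mode_program n t i) \<le> 4 * n ^ i + 2 * (i * n ^ (i + 1))"
proof -
  have "flops \<kappa> (mode_start n t i) \<le> n ^ i * (2 * 1)" "flops \<kappa> (mode_end n t i) \<le> n ^ i * (2 * 1)"
    unfolding mode_start_def mode_end_def length_all_words[symmetric] by (rule flops_layer_le; simp)+
  moreover have "flops \<kappa> (mode_step n t i p) \<le> n ^ i * (2 * n)" for p
    unfolding mode_step_def length_all_words[of i n, symmetric] by (rule flops_layer_le) simp
  then have "(\<Sum>p\<leftarrow>[0..<i]. flops \<kappa> (mode_step n t i p)) \<le> (\<Sum>p\<leftarrow>[0..<i]. n ^ i * (2 * n))"
    by (intro sum_list_mono)
  then have "flops \<kappa> (concat (map (mode_step n t i) [0..<i])) \<le> 2 * (i * n ^ (i + 1))"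
    by (simp add: flops_concat o_def sum_list_triv algebra_simps)
  ultimately show ?thesis by (simp add: mode_program_def)
qed

text \<open>Four entrywise layers give \<open>8 * n ^ 2\<close>, three matrix products
  \<open>6 * n ^ 3\<close>, and the divisions and diagonals \<open>5 * n\<close>, together at most
  \<open>19 * n ^ 3\<close>. The remaining term is for two square-root factors and two singular
  value decompositions.\<close>

lemma flops_factor_program:
  assumes "1 \<le> n" shows "flops \<kappa> (factor_program n) \<le> (19 + 4 * \<kappa>) * n ^ 3"
proof -
  have div: "flops \<kappa> (map (\<lambda>i. Div (mat_reg 6 i 0) one_reg (mat_reg 4 i i)) [0..<n]) = n"
    by (simp add: flops_def o_def sum_list_triv)
  have diag: "flops \<kappa> (layer (diag_reg 0) (\<lambda>_. [(one_reg, one_reg)]) [0..<n]) \<le> 2 * n"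
    "flops \<kappa> (layer (diag_reg 1) (\<lambda>a. [((Out_S, a, a), (Out_S, a, a))]) [0..<n]) \<le> 2 * n"
    by (simp_all add: flops_layer sum_list_triv)
  have single: "flops \<kappa> (square x n (\<lambda>i j. [f i j])) \<le> 2 * 1 * (n * n)" for x f
    by (rule flops_square_le) simp
  have full: "flops \<kappa> (square x n (\<lambda>i j. map (f i j) [0..<n])) \<le> 2 * n * (n * n)" for x f
    by (rule flops_square_le) simp
  have inst: "flops \<kappa> [Const one_reg 1, Const two_reg 2, Const neg_reg (- 1)] = 0"
    "flops \<kappa> [Sqrt_Factor n Out_R (Temp [1, 0]), Sqrt_Factor n Out_L (Temp [1, 1])] = 2 * (\<kappa> * n ^ 3)"
    "flops \<kappa> [SVD n x y z a] = \<kappa> * n ^ 3" for x y z a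
    by (simp_all add: flops_def)
  have "flops \<kappa> (factor_program n) \<le> 8 * (n * n) + 6 * (n * (n * n)) + 5 * n + 4 * (\<kappa> * n ^ 3)"
    unfolding factor_program_def flops_append div inst
    using diag single[of "Temp [1, 0]" "\<lambda>i j. ((Coeff_v 2, i + j * n, 0), one_reg)"]
      single[of "Temp [1, 1]" "\<lambda>i j. ((Coeff_w 2, i + j * n, 0), one_reg)"]
      single[of "Temp [1, 2]" "\<lambda>i j. ((Out_R, j, i), one_reg)"]
      single[of "Temp [1, 7]" "\<lambda>i l. (mat_reg 5 i l, mat_reg 6 l 0)"]
      full[of "Temp [1, 8]" "\<lambda>i j l. (mat_reg 7 i l, mat_reg 3 j l)"]
      full[of "Temp [1, 9]" "\<lambda>i j l. ((Out_L, l, i), mat_reg 8 l j)"]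
      full[of "Out_T1" "\<lambda>i j l. (mat_reg 8 i l, (Out_V, l, j))"]
    by linarith
  moreover have "n * n \<le> n ^ 3" "n \<le> n ^ 3"
    using assms power_increasing[of 2 3 n] power_increasing[of 1 3 n] by (simp_all add: power2_eq_square)
  moreover have "n * (n * n) = n ^ 3" by (simp add: power3_eq_cube)
  ultimately show ?thesis by (simp add: algebra_simps)
qed

text \<open>Successive terms at least double, so the sum is at most twice the last one. Without this
  the sum over the stages would bring in another factor \<open>d\<close>.\<close>

lemma sum_powers_le:
  assumes "2 \<le> n" "2 \<le> d" shows "(\<Sum>i=2..d. real n ^ (i + 1)) \<le> 2 * real n ^ (d + 1)"
  using assms(2)
proof (induction d rule: dec_induct)
  case (step d)
  have "2 * real n ^ (d + 1) \<le> real n * real n ^ (d + 1)" using assms(1) by (intro mult_right_mono) auto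
  with step show ?case by simp
qed (use assms in simp)

text \<open>43 is 19 for the factorizations and 12 for each family of transformed coefficients; 12
  is \<open>4 + 2\<close> from \<open>flops_mode_program\<close>, doubled by the geometric
  sum.\<close>

lemma flops_setup_program:
  assumes "2 \<le> n" "2 \<le> d"
  shows "real (flops \<kappa> (setup_program n d)) \<le> (43 + 4 * \<kappa>) * (d * real n ^ (d + 1))"
proof -
  have "real (flops \<kappa> (mode_program n t i)) \<le> 6 * d * real n ^ (i + 1)" if "i \<in> {2..d}" for t i
  proof -
    have "4 * n ^ i + 2 * (i * n ^ (i + 1)) \<le> 4 * (d * n ^ (i + 1)) + 2 * (d * n ^ (i + 1))"
      using that assms power_increasing[of i "i + 1" n] mult_le_mono[of 1 d "n ^ i" "n ^ (i + 1)"]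
      by (intro add_mono mult_le_mono) auto
    then have "flops \<kappa> (mode_program n t i) \<le> 6 * d * n ^ (i + 1)"
      using flops_mode_program[of \<kappa> n t i] by linarith
    then show ?thesis
      by (simp only: of_nat_le_iff[where 'a = real, symmetric] of_nat_mult of_nat_power of_nat_numeral)
  qed
  then have "(\<Sum>i=2..d. real (flops \<kappa> (mode_program n t i))) \<le> (\<Sum>i=2..d. 6 * d * real n ^ (i + 1))" for t
    by (intro sum_mono)
  also have "(\<Sum>i=2..d. 6 * d * real n ^ (i + 1)) = 6 * d * (\<Sum>i=2..d. real n ^ (i + 1))"
    by (simp only: sum_distrib_left)
  also have "6 * d * (\<Sum>i=2..d. real n ^ (i + 1)) \<le> 6 * d * (2 * real n ^ (d + 1))"
    by (intro mult_left_mono sum_powers_le assms) auto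
  finally have modes: "real (flops \<kappa> (concat (map (mode_program n t) [2..<Suc d]))) \<le> 12 * (d * real n ^ (d + 1))" for t
    by (simp add: flops_concat o_def sum_list_distinct_conv_sum_set atLeastLessThanSuc_atLeastAtMost del: upt_Suc)
  have "(19 + 4 * \<kappa>) * n ^ 3 \<le> (19 + 4 * \<kappa>) * (d * n ^ (d + 1))"
    using assms power_increasing[of 3 "d + 1" n] mult_le_mono[of 1 d "n ^ 3" "n ^ (d + 1)"]
    by (intro mult_le_mono2) auto
  then have "flops \<kappa> (factor_program n) \<le> (19 + 4 * \<kappa>) * (d * n ^ (d + 1))"
    using flops_factor_program[of n \<kappa>] assms by linarith
  then have "real (flops \<kappa> (factor_program n)) \<le> (19 + 4 * \<kappa>) * (d * real n ^ (d + 1))"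
    by (simp only: of_nat_le_iff[where 'a = real, symmetric] of_nat_mult of_nat_power)
  with modes[of 0] modes[of 1] show ?thesis
    by (simp add: setup_program_def algebra_simps del: upt_Suc)
qed

text \<open>155 is 43 for the first stage and 112 for the equations: two programs with constant 28
  each, doubled by the geometric sum.\<close>

lemma total_flops_le:
  assumes "2 \<le> n" "2 \<le> d"
  shows "real (total_flops \<kappa> d (balancing_program n d)) \<le> (155 + 4 * \<kappa>) * (d * real n ^ (d + 1))"
proof -
  have "real (flops \<kappa> (balancing_program n d k)) \<le> 56 * d * real n ^ (k + 1)" if "k \<in> {3..d}" for k
  proof -
    have "real (flops \<kappa> (balancing_program n d k)) \<le> 56 * k * real n ^ (k + 1)"
      using that flops_equation_program[OF assms(1), of k \<kappa> 0] flops_equation_program[OF assms(1), of k \<kappa> 1]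
      by (simp add: balancing_program_def)
    also have "\<dots> \<le> 56 * d * real n ^ (k + 1)" using that by (intro mult_right_mono) auto
    finally show ?thesis .
  qed
  then have "(\<Sum>k=3..d. real (flops \<kappa> (balancing_program n d k))) \<le> (\<Sum>k=3..d. 56 * d * real n ^ (k + 1))"
    by (intro sum_mono)
  also have "\<dots> \<le> (\<Sum>k=2..d. 56 * d * real n ^ (k + 1))" by (rule sum_mono2) auto
  also have "\<dots> = 56 * d * (\<Sum>k=2..d. real n ^ (k + 1))" by (simp only: sum_distrib_left)
  also have "\<dots> \<le> 56 * d * (2 * real n ^ (d + 1))"
    by (intro mult_left_mono sum_powers_le assms) auto
  finally have "(\<Sum>k=3..d. real (flops \<kappa> (balancing_program n d k))) \<le> 112 * (d * real n ^ (d + 1))" by simp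
  moreover have "real (total_flops \<kappa> d (balancing_program n d))
      = real (flops \<kappa> (setup_program n d)) + (\<Sum>k=3..d. real (flops \<kappa> (balancing_program n d k)))"
    using assms(2) by (simp add: total_flops_def sum.atLeast_Suc_atMost balancing_program_def numeral_3_eq_3 numeral_2_eq_2)
  ultimately show ?thesis using flops_setup_program[OF assms, of \<kappa>] by (simp add: algebra_simps)
qed

section \<open>Linear algebra of the balancing data\<close>

lemma mat_mult_idx:
  assumes "A \<in> carrier_mat r n" "B \<in> carrier_mat n c" "i < r" "j < c"
  shows "(A * B) $$ (i, j) = (\<Sum>l<n. A $$ (i, l) * B $$ (l, j))"
  using assms by (simp add: scalar_prod_def atLeast0LessThan)

text \<open>A vector in the kernel of the transpose of \<open>R\<close> lies in the kernel of
  \<open>A\<close>, which positive definiteness excludes unless it is 0.\<close>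

lemma inv_transpose_spd:
  assumes "spd n A" "R \<in> carrier_mat n n" "R * transpose_mat R = A"
  shows "inv_transpose R \<in> carrier_mat n n" "transpose_mat R * inv_transpose R = 1\<^sub>m n"
    "inv_transpose R * transpose_mat R = 1\<^sub>m n"
proof -
  have Rt: "transpose_mat R \<in> carrier_mat n n" using assms(2) by simp
  have "det (transpose_mat R) \<noteq> 0"
  proof
    assume "det (transpose_mat R) = 0"
    then obtain x where x: "x \<in> carrier_vec n" "x \<noteq> 0\<^sub>v n" "transpose_mat R *\<^sub>v x = 0\<^sub>v n"
      using det_0_iff_vec_prod_zero[OF Rt] by auto
    have "A *\<^sub>v x = R *\<^sub>v (transpose_mat R *\<^sub>v x)"
      unfolding assms(3)[symmetric] using assms(2) Rt x(1) by (rule assoc_mult_mat_vec)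
    also have "\<dots> = 0\<^sub>v n" unfolding x(3) using assms(2) by (intro eq_vecI) auto
    finally show False using assms(1) x by (auto simp: spd_def)
  qed
  from det_non_zero_imp_unit[OF Rt this, of undefined] mat_inverse(1)[OF Rt, of undefined]
  obtain B where B: "mat_inverse (transpose_mat R) = Some B" by (cases "mat_inverse (transpose_mat R)") auto
  from mat_inverse(2)[OF Rt B] B
  show "inv_transpose R \<in> carrier_mat n n" "transpose_mat R * inv_transpose R = 1\<^sub>m n"
    "inv_transpose R * transpose_mat R = 1\<^sub>m n"
    by (auto simp: inv_transpose_def)
qed

text \<open>Orthogonal factors are inverted by transposition and the diagonal factor by reciprocals.
  The entries to be inverted are nonzero because \<open>B\<close> is invertible.\<close>

lemma inverse_from_svd:
  assumes svd: "is_svd n B (X, Y, Z)" and B: "B \<in> carrier_mat n n" and G: "G \<in> carrier_mat n n"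
    and BG: "B * G = 1\<^sub>m n"
  shows "mat n n (\<lambda>(i, l). Z $$ (i, l) * (1 / Y $$ (l, l))) * transpose_mat X = G"
proof -
  from svd have c: "X \<in> carrier_mat n n" "Y \<in> carrier_mat n n" "Z \<in> carrier_mat n n"
    and XX: "transpose_mat X * X = 1\<^sub>m n" and ZZ: "transpose_mat Z * Z = 1\<^sub>m n"
    and Y: "diagonal_mat Y" and B_eq: "B = X * Y * transpose_mat Z"
    by (auto simp: is_svd_def)
  have ct: "transpose_mat X \<in> carrier_mat n n" "transpose_mat Z \<in> carrier_mat n n" using c by auto
  have ZZ': "Z * transpose_mat Z = 1\<^sub>m n" using mat_mult_left_right_inverse[OF ct(2) c(3) ZZ] .
  have XB: "transpose_mat X * B = Y * transpose_mat Z"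
  proof -
    have "transpose_mat X * B = transpose_mat X * X * Y * transpose_mat Z"
      unfolding B_eq using c ct by (simp add: assoc_mult_mat[of _ n n _ n _ n])
    then show ?thesis using XX c by simp
  qed
  \<comment> \<open>This matrix will be a right inverse of \<open>Y\<close>. A zero on the diagonal
    of \<open>Y\<close> would mean a zero row of \<open>Y\<close>, contradicting the identity
    product.\<close>
  let ?Q = "transpose_mat Z * (G * X)"
  have Q: "?Q \<in> carrier_mat n n" using c ct G by auto
  have "Y * ?Q = (Y * transpose_mat Z) * (G * X)" using c ct G by (simp add: assoc_mult_mat[of _ n n _ n _ n])
  also have "\<dots> = transpose_mat X * (B * G) * X"
    unfolding XB[symmetric] using c ct G B by (simp add: assoc_mult_mat[of _ n n _ n _ n])
  also have "\<dots> = 1\<^sub>m n" using BG c ct XX by simp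
  finally have YQ: "Y * ?Q = 1\<^sub>m n" .
  have Y0: "Y $$ (i, i) \<noteq> 0" if "i < n" for i
  proof
    assume "Y $$ (i, i) = 0"
    then have "(\<Sum>l<n. Y $$ (i, l) * ?Q $$ (l, i)) = 0"
      using Y c(2) that by (intro sum.neutral) (auto simp: diagonal_mat_def)
    with mat_mult_idx[OF c(2) Q that that] YQ that show False by simp
  qed
  let ?P = "mat n n (\<lambda>(i, l). Z $$ (i, l) * (1 / Y $$ (l, l)))"
  let ?H = "?P * transpose_mat X"
  have P: "?P \<in> carrier_mat n n" by simp
  have PY: "?P * Y = Z"
  proof (rule eq_matI)
    fix i j assume ij: "i < dim_row Z" "j < dim_col Z"
    have "(?P * Y) $$ (i, j) = (\<Sum>l<n. ?P $$ (i, l) * Y $$ (l, j))"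
      using ij c by (intro mat_mult_idx[OF P c(2)]) auto
    also have "\<dots> = (\<Sum>l<n. if l = j then Z $$ (i, j) else 0)"
      using ij c Y Y0 by (intro sum.cong) (auto simp: diagonal_mat_def)
    finally show "(?P * Y) $$ (i, j) = Z $$ (i, j)" using ij c by simp
  qed (use c in auto)
  have H: "?H \<in> carrier_mat n n" using P ct by auto
  have "?H * B = ?P * (transpose_mat X * B)" using P ct B by (simp add: assoc_mult_mat[of _ n n _ n _ n])
  also have "\<dots> = ?P * Y * transpose_mat Z" unfolding XB using P c ct by (simp add: assoc_mult_mat[of _ n n _ n _ n])
  also have "\<dots> = 1\<^sub>m n" unfolding PY by (rule ZZ')
  finally have "?H * B = 1\<^sub>m n" .
  then have "?H * (B * G) = G" using H B G by (simp add: assoc_mult_mat[symmetric, of _ n n _ n _ n])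
  then show ?thesis unfolding BG right_mult_one_mat[OF H] .
qed

text \<open>Each congruence is a Gram matrix: of the transpose of \<open>R\<close> times
  \<open>G * V\<close>, which is \<open>V\<close>, and of the transpose of \<open>L\<close> times
  \<open>G * V\<close>, which is \<open>U * S\<close>. Orthogonality removes \<open>V\<close> and
  \<open>U\<close>.\<close>

lemma balancing_identities:
  assumes G: "G \<in> carrier_mat n n" "transpose_mat R * G = 1\<^sub>m n" and R: "R \<in> carrier_mat n n" and L: "L \<in> carrier_mat n n"
    and svd: "is_svd n (transpose_mat L * G) (U, S, V)"
  shows "transpose_mat (G * V) * (R * transpose_mat R) * (G * V) = 1\<^sub>m n"
    and "transpose_mat (G * V) * (L * transpose_mat L) * (G * V) = S * S"
proof -
  from svd have c: "U \<in> carrier_mat n n" "S \<in> carrier_mat n n" "V \<in> carrier_mat n n"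
    and UU: "transpose_mat U * U = 1\<^sub>m n" and VV: "transpose_mat V * V = 1\<^sub>m n"
    and S: "diagonal_mat S" and LG: "transpose_mat L * G = U * S * transpose_mat V"
    by (auto simp: is_svd_def)
  have ct: "transpose_mat U \<in> carrier_mat n n" "transpose_mat V \<in> carrier_mat n n"
    "transpose_mat R \<in> carrier_mat n n" "transpose_mat L \<in> carrier_mat n n" "transpose_mat G \<in> carrier_mat n n"
    using c R L G by auto
  note assoc = assoc_mult_mat[of _ n n _ n _ n]
  have gram: "transpose_mat (G * V) * (A * transpose_mat A) * (G * V)
      = transpose_mat (transpose_mat A * G * V) * (transpose_mat A * G * V)" if "A \<in> carrier_mat n n" for A
  proof -
    have At: "transpose_mat A \<in> carrier_mat n n" using that by simp
    have "transpose_mat (transpose_mat A * (G * V)) = transpose_mat (G * V) * A"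
      using transpose_mult[OF At, of "G * V" n] G c by simp
    moreover have "transpose_mat A * G * V = transpose_mat A * (G * V)" using At G c by (simp add: assoc)
    ultimately show ?thesis using that At G c by (simp add: assoc)
  qed
  show "transpose_mat (G * V) * (R * transpose_mat R) * (G * V) = 1\<^sub>m n"
    unfolding gram[OF R] G(2) using c VV by simp
  have "transpose_mat L * G * V = U * S" unfolding LG using c ct VV by (simp add: assoc)
  moreover have "transpose_mat S = S"
    using S c(2) by (intro eq_matI) (auto simp: diagonal_mat_def, metis carrier_matD)
  then have "transpose_mat (U * S) = S * transpose_mat U" using transpose_mult[OF c(1,2)] by simp
  moreover have "S * transpose_mat U * (U * S) = S * (transpose_mat U * U) * S" using c ct by (simp add: assoc)
  ultimately show "transpose_mat (G * V) * (L * transpose_mat L) * (G * V) = S * S"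
    unfolding gram[OF L] using UU c by simp
qed

section \<open>Correctness of the programs\<close>

text \<open>In a composition of \<open>l\<close> into at least two positive parts every part is
  smaller than \<open>l\<close>.\<close>

lemma T_sum_cong:
  assumes "\<And>i. 1 \<le> i \<Longrightarrow> i < l \<Longrightarrow> T i = T' i" "2 \<le> m"
  shows "T_sum n T m l = T_sum n T' m l"
proof -
  have "map T is = map T' is" if "is": "is \<in> compositions m l" for "is"
  proof (rule map_cong[OF refl])
    fix i assume i: "i \<in> set is"
    then obtain xs ys where split: "is = xs @ i # ys" by (auto simp: in_set_conv_decomp)
    have "length (xs @ ys) \<noteq> 0" using "is" assms(2) split by (auto simp: compositions_def)
    then obtain j where "j \<in> set (xs @ ys)" by (metis length_0_conv list.set_intros(1) neq_Nil_conv)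
    then have "1 \<le> j" "j \<le> sum_list (xs @ ys)"
      using "is" split member_le_sum_list[of j "xs @ ys"] by (auto simp: compositions_def)
    then have "i < l" "1 \<le> i" using "is" i split by (auto simp: compositions_def)
    then show "T i = T' i" using assms(1) by simp
  qed
  then have "(\<Sum>is\<in>compositions m l. kron_list (map T is) $$ ab) = (\<Sum>is\<in>compositions m l. kron_list (map T' is) $$ ab)" for ab
    by (intro sum.cong refl) (simp only:)
  then show ?thesis by (simp only: T_sum_def)
qed

lemma vsum_cong: "(\<And>i. i \<in> I \<Longrightarrow> F i = F' i) \<Longrightarrow> vsum N I F = vsum N I F'"
  by (simp add: vsum_def)

lemma rhs_cong:
  assumes "\<And>i. 1 \<le> i \<Longrightarrow> i < k \<Longrightarrow> T i = T' i"
  shows "rhs_c n k T u = rhs_c n k T' u" "rhs_o n k S T u = rhs_o n k S T' u"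
proof -
  have T: "T i = T' i \<and> T j = T' j" if "2 \<le> i \<and> 2 \<le> j \<and> i + j = k" for i j
    using assms[of i] assms[of j] that by auto
  have s: "vsum (n ^ k) {3..k} (\<lambda>i. transpose_mat (T_sum n T i k) *\<^sub>v u i)
      = vsum (n ^ k) {3..k} (\<lambda>i. transpose_mat (T_sum n T' i k) *\<^sub>v u i)"
  proof (rule vsum_cong)
    fix i assume "i \<in> {3..k}"
    then show "transpose_mat (T_sum n T i k) *\<^sub>v u i = transpose_mat (T_sum n T' i k) *\<^sub>v u i"
      using T_sum_cong[OF assms, where l = k and m = i and n = n] by simp
  qed
  show "rhs_c n k T u = rhs_c n k T' u" unfolding rhs_c_def s
    by (rule arg_cong[where f = "\<lambda>x. - (N_mat n k *\<^sub>v (x + _))"], rule vsum_cong) (use T in auto)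
  show "rhs_o n k S T u = rhs_o n k S T' u" unfolding rhs_o_def s
    by (rule arg_cong[where f = "\<lambda>x. - (Nhat_mat n k *\<^sub>v (x + _))"], rule vsum_cong) (use T in auto)
qed

section \<open>Balancing data and intended register values\<close>

locale balancing_setup =
  fixes n d :: nat and v w :: "nat \<Rightarrow> real Matrix.vec" and T :: "nat \<Rightarrow> real mat"
    and V2 W2 :: "real mat" and sqf :: "real mat \<Rightarrow> real mat"
    and svd :: "real mat \<Rightarrow> real mat \<times> real mat \<times> real mat"
    and R L U S V T1 :: "real mat" and vt wt :: "nat \<Rightarrow> real Matrix.vec"
  assumes n_ge: "1 \<le> n" and d_ge: "2 \<le> d"
    and v_carrier: "\<And>i. i \<in> {2..d} \<Longrightarrow> v i \<in> carrier_vec (n ^ i)"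
    and w_carrier: "\<And>i. i \<in> {2..d} \<Longrightarrow> w i \<in> carrier_vec (n ^ i)"
    and spd_V2: "spd n V2" and v2: "v 2 = vec_of V2" and spd_W2: "spd n W2" and w2: "w 2 = vec_of W2"
    and sqf: "sqrt_factorizer sqf" and svd: "svd_factorizer svd"
    and R_eq: "R = sqf V2" and L_eq: "L = sqf W2"
    and USV_eq: "(U, S, V) = svd (transpose_mat L * inv_transpose R)"
    and T1_eq: "T1 = inv_transpose R * V"
    and vt_eq: "vt = transformed_coeff T1 v" and wt_eq: "wt = transformed_coeff T1 w"
    and T_1: "T 1 = 1\<^sub>m n" and T_carrier: "\<And>i. i \<in> {2..d - 1} \<Longrightarrow> T i \<in> carrier_mat n (n ^ i)"
begin

definition G where "G = inv_transpose R"
definition X where "X = fst (svd (transpose_mat R))"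
definition Y where "Y = fst (snd (svd (transpose_mat R)))"
definition Z where "Z = snd (snd (svd (transpose_mat R)))"

lemma V2_carrier: "V2 \<in> carrier_mat n n" and W2_carrier: "W2 \<in> carrier_mat n n"
  using spd_V2 spd_W2 by (auto simp: spd_def)

lemma R_facts: "R \<in> carrier_mat n n" "R * transpose_mat R = V2"
  using sqf spd_V2 unfolding sqrt_factorizer_def R_eq by auto

lemma L_facts: "L \<in> carrier_mat n n" "L * transpose_mat L = W2"
  using sqf spd_W2 unfolding sqrt_factorizer_def L_eq by auto

lemma G_facts: "G \<in> carrier_mat n n" "transpose_mat R * G = 1\<^sub>m n"
  using inv_transpose_spd[OF spd_V2 R_facts] by (simp_all add: G_def)

lemma svd_LG: "is_svd n (transpose_mat L * G) (U, S, V)"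
proof -
  have "transpose_mat L * G \<in> carrier_mat n n" using L_facts G_facts by simp
  then show ?thesis using svd unfolding svd_factorizer_def USV_eq G_def by blast
qed

lemma USV_carrier: "U \<in> carrier_mat n n" "S \<in> carrier_mat n n" "V \<in> carrier_mat n n" and S_diag: "diagonal_mat S"
  using svd_LG by (auto simp: is_svd_def)

lemma svd_Rt: "svd (transpose_mat R) = (X, Y, Z)" "is_svd n (transpose_mat R) (X, Y, Z)"
proof -
  show eq: "svd (transpose_mat R) = (X, Y, Z)" by (simp add: X_def Y_def Z_def)
  have "transpose_mat R \<in> carrier_mat n n" using R_facts by simp
  then show "is_svd n (transpose_mat R) (X, Y, Z)" using svd unfolding svd_factorizer_def eq[symmetric] by blast
qed

lemma XYZ_carrier: "X \<in> carrier_mat n n" "Y \<in> carrier_mat n n" "Z \<in> carrier_mat n n"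
  using svd_Rt(2) by (auto simp: is_svd_def)

lemma T1_carrier: "T1 \<in> carrier_mat n n"
  unfolding T1_eq G_def[symmetric] using G_facts USV_carrier by simp

definition raw :: "nat \<Rightarrow> nat \<Rightarrow> real Matrix.vec" where "raw t = (if t = 0 then v else w)"
definition tilde :: "nat \<Rightarrow> nat \<Rightarrow> real Matrix.vec" where "tilde t = (if t = 0 then vt else wt)"
definition scale :: "nat \<Rightarrow> nat \<Rightarrow> real" where "scale t a = (if t = 0 then 1 else S $$ (a, a) * S $$ (a, a))"

text \<open>Zero matrices replace the coefficients from degree \<open>d\<close> on. This gives the
  right dimensions for every index, and a polynomial of degree below \<open>d\<close>, as the lemmas
  on words demand.\<close>

definition trunc where "trunc j = (if 1 \<le> j \<and> j < d then T j else 0\<^sub>m n (n ^ j))"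

lemma trunc_carrier: "trunc j \<in> carrier_mat n (n ^ j)"
  using T_carrier[of j] T_1 by (cases "j = 1") (auto simp: trunc_def)

lemma raw_carrier: "i \<in> {2..d} \<Longrightarrow> raw t i \<in> carrier_vec (n ^ i)"
  using v_carrier w_carrier by (simp add: raw_def)

lemma tilde_eq: "tilde t = transformed_coeff T1 (raw t)"
  unfolding tilde_def raw_def using vt_eq wt_eq by auto

lemma tilde_carrier: "tilde t i \<in> carrier_vec (n ^ i)"
  unfolding tilde_eq using T1_carrier by (rule transformed_coeff_carrier)

lemma coeff_fun_trunc_eq_0: "d \<le> length \<beta> \<Longrightarrow> coeff_fun n trunc a \<beta> = 0"
  using idx_less[of \<beta> n "length \<beta>"] by (auto simp: coeff_fun_def trunc_def words_def)

lemma coeff_fun_trunc: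
  "a < n \<Longrightarrow> \<beta> \<in> words n i \<Longrightarrow> 1 \<le> i \<Longrightarrow> coeff_fun n trunc a \<beta> = trunc i $$ (a, idx n \<beta>)"
  by (auto simp: coeff_fun_def words_def)

definition horner_val where
  "horner_val t = horner n (coeff_fun n trunc) (class_sum n (\<lambda>\<mu>. tilde t (length \<mu>) $ idx n \<mu>))"

definition total_val where
  "total_val t \<alpha> = horner_val t [] \<alpha> + gram_part n trunc (scale t) (length \<alpha>) \<alpha>"

text \<open>The last \<open>p\<close> letters are already transformed, the earlier ones still index
  the original coefficients.\<close>

definition mode_val where
  "mode_val t p \<gamma> = kron_apply n T1 (drop (length \<gamma> - p) \<gamma>)
     (\<lambda>\<beta>. raw t (length \<gamma>) $ idx n (take (length \<gamma> - p) \<gamma> @ \<beta>))"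

text \<open>Position \<open>x\<close> is the matrix kept in the array \<open>Temp [1, x]\<close>, in
  the order in which \<open>factor_program\<close> obtains them.\<close>

definition aux where
  "aux = [V2, W2, transpose_mat R, X, Y, Z, mat n 1 (\<lambda>(i, _). 1 / Y $$ (i, i)),
     mat n n (\<lambda>(i, l). Z $$ (i, l) * (1 / Y $$ (l, l))), G, transpose_mat L * G]"

definition temp_val :: "nat list \<Rightarrow> nat \<Rightarrow> nat \<Rightarrow> real" where
  "temp_val xs i j = (let tag = hd xs; ys = tl xs in
     if tag = 0 then (if j = 0 then 1 else if j = 1 then 2 else - 1)
     else if tag = 1 then (aux ! hd ys) $$ (i, j)
     else if tag = 2 then scale (hd ys) i
     else if tag = 3 then horner_val (hd ys) (tl ys) (digits n i j)
     else if tag = 4 then mode_val (ys ! 0) (ys ! 2) (digits n (ys ! 1) i)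
     else if tag = 5 then scale (ys ! 0) i * trunc (ys ! 1) $$ (i, j)
     else total_val (ys ! 0) (digits n (ys ! 1) i))"

definition reg_val :: "register \<Rightarrow> real" where
  "reg_val = (\<lambda>(x, i, j). case x of
     Coeff_v l \<Rightarrow> v l $ i | Coeff_w l \<Rightarrow> w l $ i | Lower_T l \<Rightarrow> trunc l $$ (i, j)
   | Out_R \<Rightarrow> R $$ (i, j) | Out_L \<Rightarrow> L $$ (i, j) | Out_U \<Rightarrow> U $$ (i, j) | Out_S \<Rightarrow> S $$ (i, j)
   | Out_V \<Rightarrow> V $$ (i, j) | Out_T1 \<Rightarrow> T1 $$ (i, j) | Out_vt l \<Rightarrow> vt l $ i | Out_wt l \<Rightarrow> wt l $ i
   | Out_lhs_c k \<Rightarrow> lhs_c n k $$ (i, j) | Out_rhs_c k \<Rightarrow> rhs_c n k trunc vt $ i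
   | Out_lhs_o k \<Rightarrow> lhs_o n k S $$ (i, j) | Out_rhs_o k \<Rightarrow> rhs_o n k S trunc wt $ i
   | Temp xs \<Rightarrow> temp_val xs i j)"

lemma reg_val_simps [simp]:
  "reg_val (Coeff_v l, i, j) = v l $ i" "reg_val (Coeff_w l, i, j) = w l $ i"
  "reg_val (Lower_T l, i, j) = trunc l $$ (i, j)"
  "reg_val (Out_R, i, j) = R $$ (i, j)" "reg_val (Out_L, i, j) = L $$ (i, j)"
  "reg_val (Out_U, i, j) = U $$ (i, j)" "reg_val (Out_S, i, j) = S $$ (i, j)" "reg_val (Out_V, i, j) = V $$ (i, j)"
  "reg_val (Out_T1, i, j) = T1 $$ (i, j)"
  "reg_val (Out_vt l, i, j) = vt l $ i" "reg_val (Out_wt l, i, j) = wt l $ i"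
  "reg_val (Out_lhs_c k, i, j) = lhs_c n k $$ (i, j)" "reg_val (Out_rhs_c k, i, j) = rhs_c n k trunc vt $ i"
  "reg_val (Out_lhs_o k, i, j) = lhs_o n k S $$ (i, j)" "reg_val (Out_rhs_o k, i, j) = rhs_o n k S trunc wt $ i"
  "reg_val one_reg = 1" "reg_val (Temp [0], 0, Suc 0) = 2" "reg_val neg_reg = - 1"
  "reg_val (Temp [Suc 0, x], i, j) = (aux ! x) $$ (i, j)"
  by (simp_all add: reg_val_def temp_val_def)

lemma reg_val_mat_reg [simp]: "reg_val (mat_reg x i j) = (aux ! x) $$ (i, j)"
  by (simp add: mat_reg_def)

lemma reg_val_diag_reg [simp]: "reg_val (diag_reg t a) = scale t a"
  by (simp add: diag_reg_def reg_val_def temp_val_def)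

lemma reg_val_horner_reg [simp]: "\<alpha> \<in> words n s \<Longrightarrow> reg_val (horner_reg n t \<nu> \<alpha>) = horner_val t \<nu> \<alpha>"
  using wordsD(1)[of \<alpha> n s] by (simp add: horner_reg_def reg_val_def temp_val_def)

lemma reg_val_mode_reg [simp]: "\<alpha> \<in> words n s \<Longrightarrow> reg_val (mode_reg n t p \<alpha>) = mode_val t p \<alpha>"
  using wordsD(1)[of \<alpha> n s] by (simp add: mode_reg_def reg_val_def temp_val_def)

lemma reg_val_scaled_reg [simp]: "reg_val (scaled_reg n t a \<beta>) = scale t a * trunc (length \<beta>) $$ (a, idx n \<beta>)"
  by (simp add: scaled_reg_def reg_val_def temp_val_def)

lemma reg_val_total_reg [simp]: "\<alpha> \<in> words n s \<Longrightarrow> reg_val (total_reg n t \<alpha>) = total_val t \<alpha>"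
  using wordsD(1)[of \<alpha> n s] by (simp add: total_reg_def reg_val_def temp_val_def)

lemma reg_val_T_reg [simp]: "reg_val (T_reg n a \<beta>) = trunc (length \<beta>) $$ (a, idx n \<beta>)"
  by (simp add: T_reg_def)

lemma reg_val_coeff_reg [simp]: "reg_val (coeff_reg n t \<mu>) = raw t (length \<mu>) $ idx n \<mu>"
  by (simp add: coeff_reg_def raw_def)

lemma reg_val_tilde_reg [simp]: "reg_val (tilde_reg n t \<mu>) = tilde t (length \<mu>) $ idx n \<mu>"
  by (simp add: tilde_reg_def tilde_def)

lemma reg_not_scratch [simp]:
  "fst (mat_reg x i j) \<noteq> Temp []" "fst (diag_reg t a) \<noteq> Temp []" "fst (horner_reg n t \<nu> \<alpha>) \<noteq> Temp []"
  "fst (mode_reg n t p \<alpha>) \<noteq> Temp []" "fst (scaled_reg n t a \<alpha>) \<noteq> Temp []" "fst (total_reg n t \<alpha>) \<noteq> Temp []"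
  "fst (T_reg n a \<alpha>) \<noteq> Temp []" "fst (tilde_reg n t \<alpha>) \<noteq> Temp []" "fst (lhs_reg n t r \<alpha>) \<noteq> Temp []"
  "fst (rhs_reg t k r) \<noteq> Temp []"
  by (simp_all add: reg_defs)

subsection \<open>Forming the equations\<close>

text \<open>Progress of the Horner scheme: total degrees below \<open>k\<close> are complete, and in
  total degree \<open>k\<close> the output words shorter than \<open>s\<close> are done. Nothing is
  stored in total degree below 3.\<close>

definition horner_set where
  "horner_set t k s = {horner_reg n t \<nu> \<alpha> | \<nu> \<alpha> r s'. \<nu> \<in> sorted_words n r \<and> \<alpha> \<in> words n s' \<and> 3 \<le> r + s'
     \<and> (r + s' < k \<or> r + s' = k \<and> s' < s)}"

definition T_set where
  "T_set k = {T_reg n a \<beta> | a \<beta> i. a < n \<and> \<beta> \<in> words n i \<and> 1 \<le> i \<and> i + 2 \<le> k}"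

definition scaled_set where
  "scaled_set t k = {scaled_reg n t a \<beta> | a \<beta> i. a < n \<and> \<beta> \<in> words n i \<and> 1 \<le> i \<and> i + 2 \<le> k}"

definition const_set where
  "const_set = {one_reg, two_reg, neg_reg}"

definition diag_set where "diag_set t = diag_reg t ` {..<n}"

definition tilde_set where "tilde_set t = {tilde_reg n t \<mu> | \<mu> i. \<mu> \<in> words n i \<and> i \<in> {2..d}}"

definition lhs_set where
  "lhs_set t k = {lhs_reg n t r \<alpha> | r \<alpha>. r < length (monomials n k) - row_offset n t \<and> \<alpha> \<in> words n k}"

definition rhs_set where "rhs_set t k = rhs_reg t k ` {..<length (monomials n k) - row_offset n t}"

lemma exec_horner_start:
  assumes "agree K reg_val M" "3 \<le> k" "k \<le> d" "t < 2" "const_set \<subseteq> K" "tilde_set t \<subseteq> K" "horner_set t k 0 \<subseteq> K"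
  shows "agree (K \<union> horner_set t k 1) reg_val (fold (exec sqf svd) (horner_start n t k) M)"
proof -
  let ?xs = "filter sorted (all_words n k)"
  have "agree (K \<union> (\<lambda>\<nu>. horner_reg n t \<nu> []) ` set ?xs) reg_val (fold (exec sqf svd) (horner_start n t k) M)"
    unfolding horner_start_def
  proof (rule exec_layer[OF assms(1)])
    fix \<nu> assume "\<nu> \<in> set ?xs"
    then have \<nu>: "\<nu> \<in> words n k" "sorted \<nu>" by (auto simp: set_n_lists_words)
    have "tilde_reg n t \<mu> \<in> K" if "\<mu> \<in> words n k" for \<mu>
    proof -
      have "tilde_reg n t \<mu> \<in> tilde_set t"
        using that assms(2,3) unfolding tilde_set_def by (intro CollectI exI[of _ \<mu>] exI[of _ k]) auto
      then show ?thesis using assms(6) by auto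
    qed
    then show "\<forall>p\<in>set (map (\<lambda>\<mu>. (tilde_reg n t \<mu>, one_reg)) (class_words n k \<nu>)). fst p \<in> K \<and> snd p \<in> K"
      using assms(5) by (auto simp: set_class_words const_set_def)
    have "length \<nu> = k" using \<nu> by (auto dest: wordsD)
    then show "reg_val (horner_reg n t \<nu> []) = (\<Sum>p\<leftarrow>map (\<lambda>\<mu>. (tilde_reg n t \<mu>, one_reg)) (class_words n k \<nu>). reg_val (fst p) * reg_val (snd p))"
      using \<nu>(2) assms(2) reg_val_horner_reg[of "[]" 0 t \<nu>]
      by (simp add: o_def sum_list_class_words horner_val_def horner_Nil class_sum_def)
  qed simp
  moreover have "horner_set t k 1 \<subseteq> horner_set t k 0 \<union> (\<lambda>\<nu>. horner_reg n t \<nu> []) ` set ?xs"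
    by (fastforce simp: horner_set_def set_n_lists_words sorted_words_def image_iff)
  ultimately show ?thesis using assms(7) by (elim agree_mono) auto
qed

text \<open>All operands are present because the total degree \<open>k + 1 - j\<close> is either
  smaller than \<open>k\<close>, or equal to \<open>k\<close> with a shorter output word.\<close>

lemma exec_horner_step:
  assumes "agree K reg_val M" "3 \<le> k" "1 \<le> s" "s \<le> k" "T_set k \<subseteq> K" "horner_set t k s \<subseteq> K"
  shows "agree (K \<union> horner_set t k (Suc s)) reg_val (fold (exec sqf svd) (horner_step n t k s) M)"
proof -
  let ?xs = "List.product (filter sorted (all_words n (k - s))) (all_words n s)"
  let ?dst = "\<lambda>(\<nu>, \<alpha>). horner_reg n t \<nu> \<alpha>"
  let ?ps = "\<lambda>(\<nu>, \<alpha>). map (\<lambda>(a, j). (T_reg n a (take j \<alpha>), horner_reg n t (\<nu> @ [a]) (drop j \<alpha>)))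
        (List.product (filter (\<lambda>a. sorted (\<nu> @ [a])) [0..<n]) [1..<Suc (min s (k - 2))])"
  have "agree (K \<union> ?dst ` set ?xs) reg_val (fold (exec sqf svd) (horner_step n t k s) M)"
    unfolding horner_step_def
  proof (rule exec_layer[OF assms(1)])
    fix x assume "x \<in> set ?xs"
    then obtain \<nu> \<alpha> where x: "x = (\<nu>, \<alpha>)" and \<nu>: "\<nu> \<in> words n (k - s)" "sorted \<nu>" and \<alpha>: "\<alpha> \<in> words n s"
      by (auto simp: set_n_lists_words)
    have len: "length \<nu> = k - s" "length \<alpha> = s" using \<nu> \<alpha> by (auto dest: wordsD)
    show "fst (?dst x) \<noteq> Temp []" by (simp add: x)
    have T_in: "T_reg n a (take j \<alpha>) \<in> K" if "a < n" "1 \<le> j" "j \<le> s" "j \<le> k - 2" for a j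
    proof -
      have "take j \<alpha> \<in> words n j" "j + 2 \<le> k" using that \<alpha> assms(2) by (auto intro: take_in_words)
      then have "T_reg n a (take j \<alpha>) \<in> T_set k" using that unfolding T_set_def by blast
      then show ?thesis using assms(5) by auto
    qed
    have H_in: "horner_reg n t (\<nu> @ [a]) (drop j \<alpha>) \<in> K"
      if "a < n" "sorted (\<nu> @ [a])" "1 \<le> j" "j \<le> s" "j \<le> k - 2" for a j
    proof -
      have "\<nu> @ [a] \<in> sorted_words n (k - s + 1)" "drop j \<alpha> \<in> words n (s - j)"
        using that \<nu> \<alpha> by (auto simp: sorted_words_def words_def dest: in_set_dropD)
      moreover have "3 \<le> (k - s + 1) + (s - j)" "(k - s + 1) + (s - j) < k \<or> (k - s + 1) + (s - j) = k \<and> s - j < s"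
        using that assms(2-4) by auto
      ultimately have "horner_reg n t (\<nu> @ [a]) (drop j \<alpha>) \<in> horner_set t k s"
        unfolding horner_set_def by blast
      then show ?thesis using assms(6) by auto
    qed
    show "\<forall>p\<in>set (?ps x). fst p \<in> K \<and> snd p \<in> K"
      using T_in H_in by (auto simp: x simp del: upt_Suc sorted_append)
    have "(\<Sum>p\<leftarrow>?ps x. reg_val (fst p) * reg_val (snd p))
        = (\<Sum>a\<leftarrow>filter (\<lambda>a. sorted (\<nu> @ [a])) [0..<n]. \<Sum>j\<leftarrow>[1..<Suc (min s (k - 2))].
            reg_val (T_reg n a (take j \<alpha>)) * reg_val (horner_reg n t (\<nu> @ [a]) (drop j \<alpha>)))"
      by (simp add: x o_def case_prod_unfold sum_list_product del: upt_Suc sorted_append reg_val_T_reg)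
    also have "\<dots> = (\<Sum>a | a < n \<and> sorted (\<nu> @ [a]). \<Sum>j\<in>{1..min s (k - 2)}.
            reg_val (T_reg n a (take j \<alpha>)) * reg_val (horner_reg n t (\<nu> @ [a]) (drop j \<alpha>)))"
      by (simp add: sum_list_distinct_conv_sum_set atLeastLessThanSuc_atLeastAtMost conj_commute
          del: upt_Suc sorted_append reg_val_T_reg)
    also have "\<dots> = (\<Sum>a | a < n \<and> sorted (\<nu> @ [a]). \<Sum>j\<in>{1..s}.
            coeff_fun n trunc a (take j \<alpha>) * horner_val t (\<nu> @ [a]) (drop j \<alpha>))"
    proof (rule sum.cong[OF refl])
      fix a assume a: "a \<in> {a. a < n \<and> sorted (\<nu> @ [a])}"
      have "(\<Sum>j\<in>{1..min s (k - 2)}. reg_val (T_reg n a (take j \<alpha>)) * reg_val (horner_reg n t (\<nu> @ [a]) (drop j \<alpha>)))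
          = (\<Sum>j\<in>{1..min s (k - 2)}. coeff_fun n trunc a (take j \<alpha>) * horner_val t (\<nu> @ [a]) (drop j \<alpha>))"
      proof (rule sum.cong[OF refl])
        fix j assume j: "j \<in> {1..min s (k - 2)}"
        then have "take j \<alpha> \<in> words n j" "length (take j \<alpha>) = j" "1 \<le> j" using \<alpha> len take_in_words[OF \<alpha>, of j] by auto
        then show "reg_val (T_reg n a (take j \<alpha>)) * reg_val (horner_reg n t (\<nu> @ [a]) (drop j \<alpha>))
            = coeff_fun n trunc a (take j \<alpha>) * horner_val t (\<nu> @ [a]) (drop j \<alpha>)"
          using reg_val_horner_reg[OF drop_in_words[OF \<alpha>, of j]] a by (simp add: coeff_fun_trunc)
      qed
      also have "\<dots> = (\<Sum>j\<in>{1..s}. coeff_fun n trunc a (take j \<alpha>) * horner_val t (\<nu> @ [a]) (drop j \<alpha>))"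
      proof (rule sum.mono_neutral_left)
        show "\<forall>j\<in>{1..s} - {1..min s (k - 2)}. coeff_fun n trunc a (take j \<alpha>) * horner_val t (\<nu> @ [a]) (drop j \<alpha>) = 0"
        proof
          fix j assume "j \<in> {1..s} - {1..min s (k - 2)}"
          \<comment> \<open>Here \<open>j \<ge> k - 1\<close>, so the total degree
            \<open>k + 1 - j\<close> is at most 2; this justifies the cutoff of the program.\<close>
          then have "length (\<nu> @ [a]) + length (drop j \<alpha>) < 3" using len assms(2-4) by auto
          then have "horner_val t (\<nu> @ [a]) (drop j \<alpha>) = 0"
            unfolding horner_val_def by (intro horner_eq_0[where m = 3]) (auto simp: class_sum_def)
          then show "coeff_fun n trunc a (take j \<alpha>) * horner_val t (\<nu> @ [a]) (drop j \<alpha>) = 0" by simp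
        qed
      qed auto
      finally show "(\<Sum>j\<in>{1..min s (k - 2)}. reg_val (T_reg n a (take j \<alpha>)) * reg_val (horner_reg n t (\<nu> @ [a]) (drop j \<alpha>)))
          = (\<Sum>j\<in>{1..s}. coeff_fun n trunc a (take j \<alpha>) * horner_val t (\<nu> @ [a]) (drop j \<alpha>))" .
    qed
    also have "\<dots> = horner_val t \<nu> \<alpha>"
    proof -
      have "\<alpha> \<noteq> []" using len(2) assms(3) by auto
      then show ?thesis unfolding horner_val_def len(2)[symmetric]
        by (intro horner_rec[symmetric]) simp_all
    qed
    also have "\<dots> = reg_val (?dst x)" using \<alpha> by (simp add: x)
    finally show "reg_val (?dst x) = (\<Sum>p\<leftarrow>?ps x. reg_val (fst p) * reg_val (snd p))" by simp
  qed
  moreover have "horner_set t k (Suc s) \<subseteq> horner_set t k s \<union> ?dst ` set ?xs"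
  proof
    fix r assume "r \<in> horner_set t k (Suc s)"
    then obtain \<nu> \<alpha> q s' where r: "r = horner_reg n t \<nu> \<alpha>" "\<nu> \<in> sorted_words n q" "\<alpha> \<in> words n s'" "3 \<le> q + s'"
      "q + s' < k \<or> q + s' = k \<and> s' < Suc s" unfolding horner_set_def by blast
    show "r \<in> horner_set t k s \<union> ?dst ` set ?xs"
    proof (cases "q + s' < k \<or> q + s' = k \<and> s' < s")
      case True then show ?thesis using r unfolding horner_set_def by blast
    next
      case False
      then have "s' = s" "q = k - s" using r(5) by auto
      then have "(\<nu>, \<alpha>) \<in> set ?xs" using r by (auto simp: sorted_words_def set_n_lists_words)
      then show ?thesis using r(1) by (auto simp: image_iff)
    qed
  qed
  ultimately show ?thesis using assms(6) by (elim agree_mono) auto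
qed

lemma horner_set_mono: "s \<le> s' \<Longrightarrow> horner_set t k s \<subseteq> horner_set t k s'"
  unfolding horner_set_def by fastforce

text \<open>In total degree \<open>k\<close> no output word is longer than \<open>k\<close>, so the
  end of one stage is the starting point of the next.\<close>

lemma horner_set_Suc: "horner_set t k (Suc k) = horner_set t (Suc k) 0"
  unfolding horner_set_def by (rule arg_cong[where f = Collect], rule ext) (metis Suc_leI le_add2 less_Suc_eq less_Suc_eq_le not_less_zero)

lemma exec_horner_steps:
  assumes "agree K reg_val M" "3 \<le> k" "m \<le> k" "T_set k \<subseteq> K" "horner_set t k 1 \<subseteq> K"
  shows "agree (K \<union> horner_set t k (Suc m)) reg_val (fold (exec sqf svd) (concat (map (horner_step n t k) [1..<Suc m])) M)"
  using assms(3)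
proof (induction m)
  case 0
  have "K \<union> horner_set t k (Suc 0) = K" using assms(5) by auto
  then show ?case using assms(1) by simp
next
  case (Suc m)
  let ?M = "fold (exec sqf svd) (concat (map (horner_step n t k) [1..<Suc m])) M"
  have M: "agree (K \<union> horner_set t k (Suc m)) reg_val ?M" using Suc by simp
  have "agree (K \<union> horner_set t k (Suc m) \<union> horner_set t k (Suc (Suc m))) reg_val (fold (exec sqf svd) (horner_step n t k (Suc m)) ?M)"
    by (rule exec_horner_step[OF M assms(2)]) (use Suc.prems assms(4) in auto)
  then show ?case using horner_set_mono[of "Suc m" "Suc (Suc m)" t k]
    by (simp add: Un_assoc subset_Un_eq[THEN iffD1])
qed

lemma exec_scaled_layer:
  assumes "agree K reg_val M" "3 \<le> k" "T_set k \<subseteq> K" "diag_set t \<subseteq> K" "scaled_set t (k - 1) \<subseteq> K"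
  shows "agree (K \<union> scaled_set t k) reg_val (fold (exec sqf svd) (scaled_layer n t (k - 2)) M)"
proof -
  let ?xs = "List.product [0..<n] (all_words n (k - 2))"
  let ?dst = "\<lambda>(a, \<beta>). scaled_reg n t a \<beta>"
  have "agree (K \<union> ?dst ` set ?xs) reg_val (fold (exec sqf svd) (scaled_layer n t (k - 2)) M)"
    unfolding scaled_layer_def
  proof (rule exec_layer[OF assms(1)])
    fix x assume "x \<in> set ?xs"
    then obtain a \<beta> where x: "x = (a, \<beta>)" "a < n" "\<beta> \<in> words n (k - 2)" by (auto simp: set_n_lists_words)
    have "1 \<le> k - 2 \<and> k - 2 + 2 \<le> k" using assms(2) by presburger
    then have "T_reg n a \<beta> \<in> T_set k" unfolding T_set_def using x(2,3) by blast
    moreover have "diag_reg t a \<in> K" using x(2) assms(4) by (auto simp: diag_set_def)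
    ultimately show "\<forall>p\<in>set (case x of (a, \<beta>) \<Rightarrow> [(diag_reg t a, T_reg n a \<beta>)]). fst p \<in> K \<and> snd p \<in> K"
      using assms(3) x(1) by auto
  qed auto
  moreover have "scaled_set t k \<subseteq> scaled_set t (k - 1) \<union> ?dst ` set ?xs"
  proof
    fix r assume "r \<in> scaled_set t k"
    then obtain a \<beta> i where r: "r = scaled_reg n t a \<beta>" "a < n" "\<beta> \<in> words n i" "1 \<le> i" "i + 2 \<le> k"
      unfolding scaled_set_def by blast
    show "r \<in> scaled_set t (k - 1) \<union> ?dst ` set ?xs"
    proof (cases "i = k - 2")
      case True
      then have "(a, \<beta>) \<in> set ?xs" using r by (auto simp: set_n_lists_words)
      then show ?thesis using r(1) by (auto simp: image_iff)
    next
      case False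
      then have "i + 2 \<le> k - 1" using r(5) by simp
      then show ?thesis using r unfolding scaled_set_def by blast
    qed
  qed
  ultimately show ?thesis using assms(5) by (elim agree_mono) auto
qed

text \<open>In the Gram part both \<open>i\<close> and \<open>k - i\<close> lie between 2 and
  \<open>k - 2\<close>, so the factors needed have been delivered.\<close>

lemma exec_total_layer:
  assumes "agree K reg_val M" "3 \<le> k" "T_set k \<subseteq> K" "scaled_set t k \<subseteq> K" "const_set \<subseteq> K" "horner_set t (Suc k) 0 \<subseteq> K"
  shows "agree (K \<union> total_reg n t ` words n k) reg_val (fold (exec sqf svd) (total_layer n t k) M)"
proof -
  let ?ps = "\<lambda>\<alpha>. (horner_reg n t [] \<alpha>, one_reg)
    # map (\<lambda>(i, a). (T_reg n a (drop i \<alpha>), scaled_reg n t a (take i \<alpha>))) (List.product [2..<k - 1] [0..<n])"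
  have "agree (K \<union> total_reg n t ` set (all_words n k)) reg_val (fold (exec sqf svd) (total_layer n t k) M)"
    unfolding total_layer_def
  proof (rule exec_layer[OF assms(1)])
    fix \<alpha> assume "\<alpha> \<in> set (all_words n k)"
    then have \<alpha>: "\<alpha> \<in> words n k" by (simp add: set_n_lists_words)
    have len: "length \<alpha> = k" using \<alpha> by (rule wordsD)
    have "T_reg n a (drop i \<alpha>) \<in> K \<and> scaled_reg n t a (take i \<alpha>) \<in> K" if "a < n" "2 \<le> i" "i < k - 1" for a i
    proof -
      have "drop i \<alpha> \<in> words n (k - i)" "1 \<le> k - i" "k - i + 2 \<le> k" using \<alpha> that by (auto intro: drop_in_words)
      then have "T_reg n a (drop i \<alpha>) \<in> T_set k" unfolding T_set_def using that(1) by blast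
      moreover have "take i \<alpha> \<in> words n i" "1 \<le> i" "i + 2 \<le> k" using \<alpha> that by (auto intro: take_in_words)
      then have "scaled_reg n t a (take i \<alpha>) \<in> scaled_set t k" unfolding scaled_set_def using that(1) by blast
      ultimately show ?thesis using assms(3,4) by auto
    qed
    moreover have "[] \<in> sorted_words n 0" "3 \<le> 0 + k" "0 + k < Suc k" using assms(2) by (auto simp: sorted_words_def)
    then have "horner_reg n t [] \<alpha> \<in> horner_set t (Suc k) 0" unfolding horner_set_def using \<alpha> by blast
    ultimately show "\<forall>p\<in>set (?ps \<alpha>). fst p \<in> K \<and> snd p \<in> K"
      using assms(5,6) by (auto simp: const_set_def)
    have "(\<Sum>p\<leftarrow>?ps \<alpha>. reg_val (fst p) * reg_val (snd p)) = horner_val t [] \<alpha>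
        + (\<Sum>i\<in>{2..<k - 1}. \<Sum>a<n. reg_val (T_reg n a (drop i \<alpha>)) * reg_val (scaled_reg n t a (take i \<alpha>)))"
      using reg_val_horner_reg[OF \<alpha>, of t "[]"]
      by (simp add: o_def case_prod_unfold sum_list_product sum_list_distinct_conv_sum_set atLeast0LessThan
          del: reg_val_T_reg reg_val_scaled_reg)
    also have "{2..<k - 1} = {2..k - 2}" using assms(2) by auto
    also have "(\<Sum>i\<in>{2..k - 2}. \<Sum>a<n. reg_val (T_reg n a (drop i \<alpha>)) * reg_val (scaled_reg n t a (take i \<alpha>)))
        = gram_part n trunc (scale t) (length \<alpha>) \<alpha>"
      unfolding gram_part_def len
    proof (intro sum.cong refl)
      fix i a assume "i \<in> {2..k - 2}"
      then have "min k i = i" by auto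
      then show "reg_val (T_reg n a (drop i \<alpha>)) * reg_val (scaled_reg n t a (take i \<alpha>))
        = trunc (k - i) $$ (a, idx n (drop i \<alpha>)) * (scale t a * trunc i $$ (a, idx n (take i \<alpha>)))"
        by (simp add: len)
    qed
    also have "horner_val t [] \<alpha> + gram_part n trunc (scale t) (length \<alpha>) \<alpha> = reg_val (total_reg n t \<alpha>)"
      using \<alpha> by (simp add: total_val_def)
    finally show "reg_val (total_reg n t \<alpha>) = (\<Sum>p\<leftarrow>?ps \<alpha>. reg_val (fst p) * reg_val (snd p))" by simp
  qed simp
  then show ?thesis by (simp only: set_n_lists_words)
qed

lemma reg_val_rhs_reg:
  assumes "3 \<le> k" "t < 2" "r < length (monomials n k) - row_offset n t"
  shows "reg_val (rhs_reg t k r) = - (\<Sum>\<alpha>\<in>monomial_class n k (row_offset n t + r).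
    gram_part n trunc (scale t) k \<alpha> + subst_part n trunc (tilde t) k \<alpha>)"
proof (cases "t = 0")
  case True
  have scale: "scale 0 = (\<lambda>_. 1)" by (simp add: scale_def fun_eq_iff)
  have "rhs_c n k trunc vt $ r = - (\<Sum>\<alpha>\<in>monomial_class n k r. gram_part n trunc (\<lambda>_. 1) k \<alpha> + subst_part n trunc vt k \<alpha>)"
    using assms True tilde_carrier[of 0] by (intro rhs_c_nth trunc_carrier) (auto simp: tilde_def row_offset_def)
  then show ?thesis unfolding True scale by (simp add: rhs_reg_def row_offset_def tilde_def)
next
  case False
  then have t: "t = 1" using assms(2) by simp
  have "scale 1 = (\<lambda>a. S $$ (a, a) * S $$ (a, a))" by (simp add: scale_def fun_eq_iff)
  moreover have "rhs_o n k S trunc wt $ r = - (\<Sum>\<alpha>\<in>monomial_class n k (n + r).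
      gram_part n trunc (\<lambda>a. S $$ (a, a) * S $$ (a, a)) k \<alpha> + subst_part n trunc wt k \<alpha>)"
    using assms t tilde_carrier[of 1] USV_carrier S_diag
    by (intro rhs_o_nth trunc_carrier) (auto simp: tilde_def row_offset_def)
  ultimately show ?thesis using t by (simp add: rhs_reg_def row_offset_def tilde_def)
qed

lemma exec_rhs_layer:
  assumes "agree K reg_val M" "3 \<le> k" "t < 2" "const_set \<subseteq> K" "total_reg n t ` words n k \<subseteq> K"
  shows "agree (K \<union> rhs_set t k) reg_val (fold (exec sqf svd) (rhs_layer n t k) M)"
proof -
  let ?rows = "[0..<length (monomials n k) - row_offset n t]"
  let ?ps = "\<lambda>r. map (\<lambda>\<alpha>. (total_reg n t \<alpha>, neg_reg)) (class_words n k (monomials n k ! (row_offset n t + r)))"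
  have "agree (K \<union> rhs_reg t k ` set ?rows) reg_val (fold (exec sqf svd) (rhs_layer n t k) M)"
    unfolding rhs_layer_def
  proof (rule exec_layer[OF assms(1)])
    fix r assume "r \<in> set ?rows"
    then have r: "r < length (monomials n k) - row_offset n t" by simp
    let ?C = "{\<alpha> \<in> words n k. mset \<alpha> = mset (monomials n k ! (row_offset n t + r))}"
    show "\<forall>p\<in>set (?ps r). fst p \<in> K \<and> snd p \<in> K"
      using assms(4,5) by (auto simp: set_class_words const_set_def)
    \<comment> \<open>Word by word the two sides may differ; the Horner scheme is only correct after
      summation over a monomial class, which is all that the row of \<open>N_mat\<close>
      sees.\<close>
    have horner: "(\<Sum>\<alpha>\<in>?C. horner_val t [] \<alpha>) = (\<Sum>\<alpha>\<in>?C. subst_part n trunc (tilde t) k \<alpha>)"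
    proof -
      have "(\<Sum>\<alpha>\<in>?C. horner_val t [] \<alpha>)
          = (\<Sum>\<alpha>\<in>?C. \<Sum>i=3..k. \<Sum>\<mu>\<in>words n i. tilde t (length \<mu>) $ idx n \<mu> * W (coeff_fun n trunc) \<mu> \<alpha>)"
        unfolding horner_val_def using coeff_fun_trunc_eq_0 by (intro sum_class_horner[where d = d]) auto
      also have "\<dots> = (\<Sum>\<alpha>\<in>?C. subst_part n trunc (tilde t) k \<alpha>)"
        unfolding subst_part_def by (intro sum.cong refl) (simp add: wordsD)
      finally show ?thesis .
    qed
    have "(\<Sum>p\<leftarrow>?ps r. reg_val (fst p) * reg_val (snd p)) = (\<Sum>\<alpha>\<in>?C. - reg_val (total_reg n t \<alpha>))"
      by (simp add: o_def sum_list_class_words)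
    also have "\<dots> = (\<Sum>\<alpha>\<in>?C. - total_val t \<alpha>)" by (intro sum.cong refl) auto
    also have "\<dots> = - (\<Sum>\<alpha>\<in>?C. horner_val t [] \<alpha> + gram_part n trunc (scale t) k \<alpha>)"
      unfolding sum_negf by (intro arg_cong[where f = uminus] sum.cong refl) (auto simp: total_val_def wordsD)
    also have "\<dots> = reg_val (rhs_reg t k r)"
      unfolding reg_val_rhs_reg[OF assms(2,3) r] monomial_class_def sum.distrib horner by simp
    finally show "reg_val (rhs_reg t k r) = (\<Sum>p\<leftarrow>?ps r. reg_val (fst p) * reg_val (snd p))" by simp
  qed simp
  then show ?thesis by (simp add: rhs_set_def atLeast0LessThan)
qed

lemma reg_val_lhs_reg:
  assumes "3 \<le> k" "t < 2" "r < length (monomials n k) - row_offset n t" "\<alpha> \<in> words n k"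
  shows "reg_val (lhs_reg n t r \<alpha>) = (if \<alpha> \<in> monomial_class n k (row_offset n t + r) then 2 * scale t (last \<alpha>) else 0)"
proof (cases "t = 0")
  case True
  then show ?thesis using assms lhs_c_idx[of k r n \<alpha>] wordsD(1)[OF assms(4)]
    by (simp add: lhs_reg_def row_offset_def scale_def)
next
  case False
  then have "t = 1" using assms(2) by simp
  then show ?thesis using assms lhs_o_idx[of k S n r \<alpha>] USV_carrier S_diag wordsD(1)[OF assms(4)]
    by (simp add: lhs_reg_def row_offset_def scale_def)
qed

lemma exec_lhs_layer:
  assumes "agree K reg_val M" "3 \<le> k" "t < 2" "const_set \<subseteq> K" "diag_set t \<subseteq> K"
  shows "agree (K \<union> lhs_set t k) reg_val (fold (exec sqf svd) (lhs_layer n t k) M)"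
proof -
  let ?xs = "List.product [0..<length (monomials n k) - row_offset n t] (all_words n k)"
  let ?dst = "\<lambda>(r, \<alpha>). lhs_reg n t r \<alpha>"
  let ?ps = "\<lambda>(r, \<alpha>). if mset \<alpha> = mset (monomials n k ! (row_offset n t + r)) then [(two_reg, diag_reg t (last \<alpha>))] else []"
  have "agree (K \<union> ?dst ` set ?xs) reg_val (fold (exec sqf svd) (lhs_layer n t k) M)"
    unfolding lhs_layer_def
  proof (rule exec_layer[OF assms(1)])
    fix x assume "x \<in> set ?xs"
    then obtain r \<alpha> where x: "x = (r, \<alpha>)" "r < length (monomials n k) - row_offset n t" "\<alpha> \<in> words n k"
      by (auto simp: set_n_lists_words)
    have "\<alpha> \<noteq> []" using x(3) assms(2) by (auto simp: words_def)
    then have "last \<alpha> \<in> set \<alpha>" by simp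
    then have "last \<alpha> < n" using wordsD(2)[OF x(3)] by auto
    then have "diag_reg t (last \<alpha>) \<in> K" using assms(5) by (auto simp: diag_set_def)
    then show "\<forall>p\<in>set (?ps x). fst p \<in> K \<and> snd p \<in> K" using assms(4) by (auto simp: x(1) const_set_def)
    show "reg_val (?dst x) = (\<Sum>p\<leftarrow>?ps x. reg_val (fst p) * reg_val (snd p))"
      using reg_val_lhs_reg[OF assms(2,3) x(2,3)] x(3) by (simp add: x(1) monomial_class_def)
  qed auto
  moreover have "lhs_set t k \<subseteq> ?dst ` set ?xs"
  proof
    fix x assume "x \<in> lhs_set t k"
    then obtain r \<alpha> where x: "x = ?dst (r, \<alpha>)" "r < length (monomials n k) - row_offset n t" "\<alpha> \<in> words n k"
      unfolding lhs_set_def by auto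
    from x(1) show "x \<in> ?dst ` set ?xs" by (rule image_eqI) (use x(2,3) in \<open>simp add: set_n_lists_words\<close>)
  qed
  ultimately show ?thesis by (elim agree_mono) auto
qed

lemma exec_equation_program:
  assumes "agree K reg_val M" "3 \<le> k" "k \<le> d" "t < 2"
    "const_set \<subseteq> K" "diag_set t \<subseteq> K" "tilde_set t \<subseteq> K" "T_set k \<subseteq> K"
    "horner_set t k 0 \<subseteq> K" "scaled_set t (k - 1) \<subseteq> K"
  shows "agree (K \<union> horner_set t (Suc k) 0 \<union> scaled_set t k \<union> rhs_set t k \<union> lhs_set t k) reg_val
    (fold (exec sqf svd) (equation_program n t k) M)"
proof -
  let ?e = "fold (exec sqf svd)"
  let ?M1 = "?e (horner_start n t k) M"
  let ?M2 = "?e (concat (map (horner_step n t k) [1..<Suc k])) ?M1"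
  let ?M3 = "?e (scaled_layer n t (k - 2)) ?M2"
  let ?M4 = "?e (total_layer n t k) ?M3"
  let ?M5 = "?e (rhs_layer n t k) ?M4"
  let ?K1 = "K \<union> horner_set t k 1"
  let ?K2 = "?K1 \<union> horner_set t (Suc k) 0"
  let ?K3 = "?K2 \<union> scaled_set t k"
  let ?K4 = "?K3 \<union> total_reg n t ` words n k"
  let ?K5 = "?K4 \<union> rhs_set t k"
  have "agree ?K1 reg_val ?M1" using assms by (intro exec_horner_start) auto
  then have "agree ?K2 reg_val ?M2"
    using exec_horner_steps[of ?K1 ?M1 k k t] assms by (auto simp: horner_set_Suc)
  then have "agree ?K3 reg_val ?M3" using assms by (intro exec_scaled_layer) auto
  then have "agree ?K4 reg_val ?M4" using assms by (intro exec_total_layer) auto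
  then have "agree ?K5 reg_val ?M5" using assms by (intro exec_rhs_layer) auto
  then have "agree (?K5 \<union> lhs_set t k) reg_val (?e (lhs_layer n t k) ?M5)" using assms by (intro exec_lhs_layer) auto
  then have "agree (?K5 \<union> lhs_set t k) reg_val (?e (equation_program n t k) M)"
    by (simp add: equation_program_def del: upt_Suc)
  then show ?thesis by (rule agree_mono) auto
qed

subsection \<open>Setting up\<close>

definition coeff_set where "coeff_set t = {coeff_reg n t \<mu> | \<mu> i. \<mu> \<in> words n i \<and> i \<in> {2..d}}"

definition mode_set where "mode_set t i p = mode_reg n t p ` words n i"

lemma exec_mode_start:
  assumes "agree K reg_val M" "i \<in> {2..d}" "const_set \<subseteq> K" "coeff_set t \<subseteq> K"
  shows "agree (K \<union> mode_set t i 0) reg_val (fold (exec sqf svd) (mode_start n t i) M)"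
proof -
  have "agree (K \<union> mode_reg n t 0 ` set (all_words n i)) reg_val (fold (exec sqf svd) (mode_start n t i) M)"
    unfolding mode_start_def
  proof (rule exec_layer[OF assms(1)])
    fix \<gamma> assume "\<gamma> \<in> set (all_words n i)"
    then have \<gamma>: "\<gamma> \<in> words n i" by (simp add: set_n_lists_words)
    then have "coeff_reg n t \<gamma> \<in> coeff_set t" unfolding coeff_set_def using assms(2) by blast
    then show "\<forall>p\<in>set [(coeff_reg n t \<gamma>, one_reg)]. fst p \<in> K \<and> snd p \<in> K"
      using assms(3,4) by (auto simp: const_set_def)
    show "reg_val (mode_reg n t 0 \<gamma>) = (\<Sum>p\<leftarrow>[(coeff_reg n t \<gamma>, one_reg)]. reg_val (fst p) * reg_val (snd p))"
      using \<gamma> by (simp add: mode_val_def)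
  qed simp
  then show ?thesis by (simp only: set_n_lists_words mode_set_def)
qed

text \<open>The letter at position \<open>i - Suc p\<close> leaves the untransformed prefix;
  replacing it by \<open>b\<close> in the word supplies the summation index of the
  contraction.\<close>

lemma mode_val_Suc:
  assumes "\<gamma> \<in> words n i" "p < i"
  shows "mode_val t (Suc p) \<gamma> = (\<Sum>b<n. T1 $$ (b, \<gamma> ! (i - Suc p)) * mode_val t p (\<gamma>[i - Suc p := b]))"
proof -
  have len: "length \<gamma> = i" using assms(1) by (rule wordsD)
  define q where "q = i - Suc p"
  have q: "q < i" "i - p = Suc q" "i - Suc p = q" using assms(2) by (auto simp: q_def)
  have "drop q \<gamma> = \<gamma> ! q # drop (Suc q) \<gamma>" using q(1) len by (simp add: Cons_nth_drop_Suc)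
  moreover have "drop (Suc q) (\<gamma>[q := b]) = drop (Suc q) \<gamma>" "take (Suc q) (\<gamma>[q := b]) = take q \<gamma> @ [b]" for b
    using q(1) len by (auto simp: take_Suc_conv_app_nth)
  ultimately show ?thesis by (simp add: mode_val_def len q)
qed

lemma exec_mode_step:
  assumes "agree K reg_val M" "p < i" "block Out_T1 n n \<subseteq> K" "mode_set t i p \<subseteq> K"
  shows "agree (K \<union> mode_set t i (Suc p)) reg_val (fold (exec sqf svd) (mode_step n t i p) M)"
proof -
  let ?ps = "\<lambda>\<gamma>. map (\<lambda>b. ((Out_T1, b, \<gamma> ! (i - Suc p)), mode_reg n t p (\<gamma>[i - Suc p := b]))) [0..<n]"
  have "agree (K \<union> mode_reg n t (Suc p) ` set (all_words n i)) reg_val (fold (exec sqf svd) (mode_step n t i p) M)"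
    unfolding mode_step_def
  proof (rule exec_layer[OF assms(1)])
    fix \<gamma> assume "\<gamma> \<in> set (all_words n i)"
    then have \<gamma>: "\<gamma> \<in> words n i" by (simp add: set_n_lists_words)
    then have len: "length \<gamma> = i" by (rule wordsD)
    have upd: "\<gamma>[i - Suc p := b] \<in> words n i" if "b < n" for b
      using that \<gamma> set_update_subset_insert[of \<gamma> "i - Suc p" b] by (auto simp: words_def)
    have "\<gamma> ! (i - Suc p) \<in> set \<gamma>" using len assms(2) by (intro nth_mem) simp
    then have "\<gamma> ! (i - Suc p) < n" using wordsD(2)[OF \<gamma>] by auto
    then show "\<forall>q\<in>set (?ps \<gamma>). fst q \<in> K \<and> snd q \<in> K"
      using assms(3,4) upd by (auto simp: mode_set_def)
    have "(\<Sum>q\<leftarrow>?ps \<gamma>. reg_val (fst q) * reg_val (snd q))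
        = (\<Sum>b<n. T1 $$ (b, \<gamma> ! (i - Suc p)) * reg_val (mode_reg n t p (\<gamma>[i - Suc p := b])))"
      by (simp add: o_def sum_list_distinct_conv_sum_set atLeast0LessThan)
    also have "\<dots> = reg_val (mode_reg n t (Suc p) \<gamma>)"
      unfolding reg_val_mode_reg[OF \<gamma>] mode_val_Suc[OF \<gamma> assms(2)]
      by (intro sum.cong refl) (simp add: reg_val_mode_reg[OF upd])
    finally show "reg_val (mode_reg n t (Suc p) \<gamma>) = (\<Sum>q\<leftarrow>?ps \<gamma>. reg_val (fst q) * reg_val (snd q))" by simp
  qed simp
  then show ?thesis by (simp only: set_n_lists_words mode_set_def)
qed

lemma exec_mode_steps:
  assumes "agree K reg_val M" "block Out_T1 n n \<subseteq> K" "mode_set t i 0 \<subseteq> K" "m \<le> i"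
  shows "agree (K \<union> (\<Union>p\<le>m. mode_set t i p)) reg_val (fold (exec sqf svd) (concat (map (mode_step n t i) [0..<m])) M)"
  using assms(4)
proof (induction m)
  case 0
  have "K \<union> (\<Union>p\<le>0. mode_set t i p) = K" using assms(3) by auto
  then show ?case using assms(1) by simp
next
  case (Suc m)
  let ?M = "fold (exec sqf svd) (concat (map (mode_step n t i) [0..<m])) M"
  have M: "agree (K \<union> (\<Union>p\<le>m. mode_set t i p)) reg_val ?M" using Suc by simp
  have "agree (K \<union> (\<Union>p\<le>m. mode_set t i p) \<union> mode_set t i (Suc m)) reg_val (fold (exec sqf svd) (mode_step n t i m) ?M)"
    by (rule exec_mode_step[OF M]) (use Suc.prems assms(2) in auto)
  then show ?case by (simp add: atMost_Suc Un_assoc Un_commute[of "mode_set t i (Suc m)"])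
qed

lemma exec_mode_program:
  assumes "agree K reg_val M" "i \<in> {2..d}" "const_set \<subseteq> K" "coeff_set t \<subseteq> K" "block Out_T1 n n \<subseteq> K"
  shows "agree (K \<union> tilde_reg n t ` words n i) reg_val (fold (exec sqf svd) (mode_program n t i) M)"
proof -
  let ?e = "fold (exec sqf svd)"
  let ?M1 = "?e (mode_start n t i) M"
  let ?M2 = "?e (concat (map (mode_step n t i) [0..<i])) ?M1"
  let ?K1 = "K \<union> mode_set t i 0"
  let ?K2 = "?K1 \<union> (\<Union>p\<le>i. mode_set t i p)"
  have "agree ?K1 reg_val ?M1" using assms(1-4) by (rule exec_mode_start)
  then have M2: "agree ?K2 reg_val ?M2" using assms(5) by (intro exec_mode_steps) auto
  have "agree (?K2 \<union> tilde_reg n t ` set (all_words n i)) reg_val (?e (mode_end n t i) ?M2)"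
    unfolding mode_end_def
  proof (rule exec_layer[OF M2])
    fix \<gamma> assume "\<gamma> \<in> set (all_words n i)"
    then have \<gamma>: "\<gamma> \<in> words n i" by (simp add: set_n_lists_words)
    then have len: "length \<gamma> = i" by (rule wordsD)
    have "mode_reg n t i \<gamma> \<in> mode_set t i i" using \<gamma> by (simp add: mode_set_def)
    then show "\<forall>p\<in>set [(mode_reg n t i \<gamma>, one_reg)]. fst p \<in> ?K2 \<and> snd p \<in> ?K2"
      using assms(3) by (auto simp: const_set_def)
    have "mode_val t i \<gamma> = tilde t (length \<gamma>) $ idx n \<gamma>"
      using transformed_coeff_idx[of T1 n "raw t" i \<gamma>] T1_carrier raw_carrier[OF assms(2)] \<gamma>
      by (simp add: mode_val_def len tilde_eq)
    then show "reg_val (tilde_reg n t \<gamma>) = (\<Sum>p\<leftarrow>[(mode_reg n t i \<gamma>, one_reg)]. reg_val (fst p) * reg_val (snd p))"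
      using \<gamma> by simp
  qed simp
  then have "agree (?K2 \<union> tilde_reg n t ` words n i) reg_val (?e (mode_program n t i) M)"
    by (simp add: set_n_lists_words mode_program_def)
  then show ?thesis by (rule agree_mono) auto
qed

lemma exec_mode_programs:
  assumes "agree K reg_val M" "const_set \<subseteq> K" "coeff_set t \<subseteq> K" "block Out_T1 n n \<subseteq> K" "set is \<subseteq> {2..d}"
  shows "agree (K \<union> (\<Union>i\<in>set is. tilde_reg n t ` words n i)) reg_val (fold (exec sqf svd) (concat (map (mode_program n t) is)) M)"
  using assms
proof (induction "is" arbitrary: K M)
  case (Cons i "is")
  let ?M = "fold (exec sqf svd) (mode_program n t i) M"
  let ?K = "K \<union> tilde_reg n t ` words n i"
  have "agree ?K reg_val ?M" using Cons.prems by (intro exec_mode_program) auto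
  then have "agree (?K \<union> (\<Union>i\<in>set is. tilde_reg n t ` words n i)) reg_val (fold (exec sqf svd) (concat (map (mode_program n t) is)) ?M)"
    using Cons.prems by (intro Cons.IH) auto
  then show ?case by (simp add: Un_assoc)
qed simp

lemma vec_of_reg: "A \<in> carrier_mat n n \<Longrightarrow> i < n \<Longrightarrow> j < n \<Longrightarrow> vec_of A $ (i + j * n) = A $$ (i, j)"
proof -
  assume A: "A \<in> carrier_mat n n" "i < n" "j < n"
  have "i + j * n < Suc j * n" using A(2) by simp
  also have "\<dots> \<le> n * n" using A(3) by (intro mult_le_mono1) simp
  finally show ?thesis using A by (simp add: vec_of_def)
qed

text \<open>The column \<open>j\<close> comes first in the word because \<open>vec_of\<close> stacks
  columns.\<close>

lemma coeff_set_2: "i < n \<Longrightarrow> j < n \<Longrightarrow> ((if t = 0 then Coeff_v else Coeff_w) 2, i + j * n, 0) \<in> coeff_set t"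
proof -
  assume "i < n" "j < n"
  then have "[j, i] \<in> words n 2" "(2::nat) \<in> {2..d}" using d_ge by (auto simp: words_def)
  moreover have "((if t = 0 then Coeff_v else Coeff_w) 2, i + j * n, 0) = coeff_reg n t [j, i]"
    by (simp add: coeff_reg_def numeral_2_eq_2)
  ultimately show ?thesis unfolding coeff_set_def by blast
qed

lemma agree_update: "agree K f M \<Longrightarrow> fst r \<noteq> Temp [] \<Longrightarrow> f r = y \<Longrightarrow> agree (insert r K) f (M(r := y))"
  by (auto simp: agree_def)

lemma exec_div_list:
  assumes "agree K reg_val M" "const_set \<subseteq> K" "block (Temp [1, 4]) n n \<subseteq> K" "set xs \<subseteq> {..<n}"
  shows "agree (K \<union> (\<lambda>i. mat_reg 6 i 0) ` set xs) reg_val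
    (fold (exec sqf svd) (map (\<lambda>i. Div (mat_reg 6 i 0) one_reg (mat_reg 4 i i)) xs) M)"
  using assms
proof (induction xs arbitrary: K M)
  case (Cons i xs)
  have i: "i < n" using Cons.prems(4) by simp
  have "mat_reg 4 i i \<in> K" "one_reg \<in> K" using Cons.prems(2,3) i by (auto simp: mat_reg_def const_set_def)
  then have eq: "M (mat_reg 4 i i) = Y $$ (i, i)" "M one_reg = 1"
    by (simp_all add: agreeD[OF Cons.prems(1)] aux_def)
  have M: "agree (insert (mat_reg 6 i 0) K) reg_val (M(mat_reg 6 i 0 := 1 / Y $$ (i, i)))"
    using Cons.prems(1) i by (intro agree_update) (auto simp: aux_def)
  have "agree (insert (mat_reg 6 i 0) K \<union> (\<lambda>i. mat_reg 6 i 0) ` set xs) reg_val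
    (fold (exec sqf svd) (map (\<lambda>i. Div (mat_reg 6 i 0) one_reg (mat_reg 4 i i)) xs) (M(mat_reg 6 i 0 := 1 / Y $$ (i, i))))"
    by (rule Cons.IH[OF M]) (use Cons.prems in auto)
  then show ?case by (simp add: eq)
qed simp

lemma read_mat_agree:
  assumes "agree K reg_val M" "block x r c \<subseteq> K" "A \<in> carrier_mat r c"
    "\<And>i j. i < r \<Longrightarrow> j < c \<Longrightarrow> reg_val (x, i, j) = A $$ (i, j)"
  shows "read_mat M x r c = A"
proof (rule eq_matI)
  fix i j assume ij: "i < dim_row A" "j < dim_col A"
  then have "(x, i, j) \<in> K" using assms(2,3) by auto
  then show "read_mat M x r c $$ (i, j) = A $$ (i, j)"
    using agreeD[OF assms(1)] assms(3,4) ij by (auto simp: read_mat_def)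
qed (use assms(3) in \<open>auto simp: read_mat_def\<close>)

lemma exec_SVD:
  assumes M: "agree K reg_val M" and a: "block a n n \<subseteq> K" "A \<in> carrier_mat n n"
    "\<And>i j. i < n \<Longrightarrow> j < n \<Longrightarrow> reg_val (a, i, j) = A $$ (i, j)"
    and svd_A: "svd A = (P, Q, N)" and nt: "x \<noteq> Temp []" "y \<noteq> Temp []" "z \<noteq> Temp []"
    and vals: "\<And>i j. i < n \<Longrightarrow> j < n \<Longrightarrow> reg_val (x, i, j) = P $$ (i, j)"
      "\<And>i j. i < n \<Longrightarrow> j < n \<Longrightarrow> reg_val (y, i, j) = Q $$ (i, j)"
      "\<And>i j. i < n \<Longrightarrow> j < n \<Longrightarrow> reg_val (z, i, j) = N $$ (i, j)"
  shows "agree (K \<union> block x n n \<union> block y n n \<union> block z n n) reg_val (exec sqf svd (SVD n x y z a) M)"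
proof -
  have "read_mat M a n n = A" by (rule read_mat_agree[OF M a])
  then have "exec sqf svd (SVD n x y z a) M = write_mat z n n N (write_mat y n n Q (write_mat x n n P M))"
    by (simp add: svd_A)
  moreover have "agree (K \<union> block x n n \<union> block y n n \<union> block z n n) reg_val \<dots>"
    unfolding block_def by (intro agree_write_mat M nt vals)
  ultimately show ?thesis by simp
qed

lemma exec_Sqrt_Factor:
  assumes M: "agree K reg_val M" and a: "block a n n \<subseteq> K" "A \<in> carrier_mat n n"
    "\<And>i j. i < n \<Longrightarrow> j < n \<Longrightarrow> reg_val (a, i, j) = A $$ (i, j)"
    and nt: "x \<noteq> Temp []" and vals: "\<And>i j. i < n \<Longrightarrow> j < n \<Longrightarrow> reg_val (x, i, j) = sqf A $$ (i, j)"
  shows "agree (K \<union> block x n n) reg_val (exec sqf svd (Sqrt_Factor n x a) M)"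
proof -
  have "read_mat M a n n = A" by (rule read_mat_agree[OF M a])
  moreover have "agree (K \<union> block x n n) reg_val (write_mat x n n (sqf A) M)"
    unfolding block_def by (intro agree_write_mat M nt vals)
  ultimately show ?thesis by simp
qed

lemma sum_list_upt: "(\<Sum>l\<leftarrow>[0..<n]. f l) = (\<Sum>l<n. f l)"
  by (simp add: sum_list_distinct_conv_sum_set atLeast0LessThan)

lemma exec_factor_program:
  assumes "agree K reg_val M" "coeff_set 0 \<subseteq> K" "coeff_set 1 \<subseteq> K"
  shows "agree (K \<union> const_set \<union> block Out_R n n \<union> block Out_L n n \<union> block Out_U n n \<union> block Out_S n n \<union> block Out_V n n
    \<union> block Out_T1 n n \<union> diag_set 0 \<union> diag_set 1) reg_val (fold (exec sqf svd) (factor_program n) M)"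
proof -
  let ?e = "fold (exec sqf svd)"
  let ?B = "\<lambda>x. block (Temp [1, x]) n n"
  \<comment> \<open>The computed matrix is exactly \<open>inv_transpose R\<close>. So the second
    decomposition is applied to the same matrix as in the definition of \<open>U\<close>,
    \<open>S\<close> and \<open>V\<close>, and \<open>svd\<close>, being a function, returns the
    same factors.\<close>
  have G_eq: "mat n n (\<lambda>(i, l). Z $$ (i, l) * (1 / Y $$ (l, l))) * transpose_mat X = G"
    using inverse_from_svd[OF svd_Rt(2) _ G_facts] R_facts by simp
  define M0 where "M0 = ?e [Const one_reg 1, Const two_reg 2, Const neg_reg (- 1)] M"
  define K0 where "K0 = K \<union> const_set"
  have M0: "agree K0 reg_val M0"
  proof -
    have "agree (insert neg_reg (insert two_reg (insert one_reg K))) reg_val (M(one_reg := 1, two_reg := 2, neg_reg := - 1))"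
      by (intro agree_update assms(1)) simp_all
    moreover have "insert neg_reg (insert two_reg (insert one_reg K)) = K0" by (auto simp: K0_def const_set_def)
    ultimately show ?thesis by (simp add: M0_def)
  qed
  have one: "one_reg \<in> K0" by (simp add: K0_def const_set_def)
  define M1 where "M1 = ?e (square (Temp [1, 0]) n (\<lambda>i j. [((Coeff_v 2, i + j * n, 0), one_reg)])) M0"
  have M1: "agree (K0 \<union> ?B 0) reg_val M1"
    unfolding M1_def using one assms(2) coeff_set_2[of _ _ 0]
    by (intro exec_square[OF M0]) (auto simp: K0_def v2 vec_of_reg V2_carrier aux_def)
  define M2 where "M2 = ?e (square (Temp [1, 1]) n (\<lambda>i j. [((Coeff_w 2, i + j * n, 0), one_reg)])) M1"
  have M2: "agree (K0 \<union> ?B 0 \<union> ?B 1) reg_val M2"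
    unfolding M2_def using one assms(3) coeff_set_2[of _ _ 1]
    by (intro exec_square[OF M1]) (auto simp: K0_def w2 vec_of_reg W2_carrier aux_def)
  define M3 where "M3 = exec sqf svd (Sqrt_Factor n Out_R (Temp [1, 0])) M2"
  have M3: "agree (K0 \<union> ?B 0 \<union> ?B 1 \<union> block Out_R n n) reg_val M3"
    unfolding M3_def by (rule exec_Sqrt_Factor[OF M2 _ V2_carrier]) (auto simp: aux_def R_eq[symmetric])
  define M4 where "M4 = exec sqf svd (Sqrt_Factor n Out_L (Temp [1, 1])) M3"
  have M4: "agree (K0 \<union> ?B 0 \<union> ?B 1 \<union> block Out_R n n \<union> block Out_L n n) reg_val M4"
    unfolding M4_def by (rule exec_Sqrt_Factor[OF M3 _ W2_carrier]) (auto simp: aux_def L_eq[symmetric])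
  define K4 where "K4 = K0 \<union> block Out_R n n \<union> block Out_L n n"
  have M4: "agree K4 reg_val M4" by (rule agree_mono[OF M4]) (auto simp: K4_def)
  define M5 where "M5 = ?e (square (Temp [1, 2]) n (\<lambda>i j. [((Out_R, j, i), one_reg)])) M4"
  have M5: "agree (K4 \<union> ?B 2) reg_val M5"
    unfolding M5_def using one R_facts by (intro exec_square[OF M4]) (auto simp: K4_def aux_def)
  define M6 where "M6 = exec sqf svd (SVD n (Temp [1, 3]) (Temp [1, 4]) (Temp [1, 5]) (Temp [1, 2])) M5"
  have M6: "agree (K4 \<union> ?B 2 \<union> ?B 3 \<union> ?B 4 \<union> ?B 5) reg_val M6"
    unfolding M6_def by (rule exec_SVD[OF M5 _ _ _ svd_Rt(1)]) (use R_facts in \<open>auto simp: aux_def\<close>)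
  define K6 where "K6 = K4 \<union> ?B 3 \<union> ?B 4 \<union> ?B 5"
  have M6: "agree K6 reg_val M6" by (rule agree_mono[OF M6]) (auto simp: K6_def)
  define M7 where "M7 = ?e (map (\<lambda>i. Div (mat_reg 6 i 0) one_reg (mat_reg 4 i i)) [0..<n]) M6"
  have M7: "agree (K6 \<union> (\<lambda>i. mat_reg 6 i 0) ` set [0..<n]) reg_val M7"
    unfolding M7_def by (rule exec_div_list[OF M6]) (auto simp: K6_def K4_def K0_def)
  define M8 where "M8 = ?e (square (Temp [1, 7]) n (\<lambda>i l. [(mat_reg 5 i l, mat_reg 6 l 0)])) M7"
  have M8: "agree (K6 \<union> (\<lambda>i. mat_reg 6 i 0) ` set [0..<n] \<union> ?B 7) reg_val M8"
    unfolding M8_def by (intro exec_square[OF M7]) (auto simp: K6_def mat_reg_def aux_def)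
  define K8 where "K8 = K6 \<union> ?B 7"
  have M8: "agree K8 reg_val M8" by (rule agree_mono[OF M8]) (auto simp: K8_def)
  define M9 where "M9 = ?e (square (Temp [1, 8]) n (\<lambda>i j. map (\<lambda>l. (mat_reg 7 i l, mat_reg 3 j l)) [0..<n])) M8"
  have M9: "agree (K8 \<union> ?B 8) reg_val M9"
    unfolding M9_def
  proof (rule exec_square[OF M8])
    fix i j assume ij: "i < n" "j < n"
    show "\<forall>p\<in>set (map (\<lambda>l. (mat_reg 7 i l, mat_reg 3 j l)) [0..<n]). fst p \<in> K8 \<and> snd p \<in> K8"
      using ij by (auto simp: K8_def K6_def mat_reg_def)
    have "G $$ (i, j) = (\<Sum>l<n. mat n n (\<lambda>(i, l). Z $$ (i, l) * (1 / Y $$ (l, l))) $$ (i, l) * transpose_mat X $$ (l, j))"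
      unfolding G_eq[symmetric] using ij XYZ_carrier by (intro mat_mult_idx) auto
    then show "reg_val (Temp [1, 8], i, j) = (\<Sum>p\<leftarrow>map (\<lambda>l. (mat_reg 7 i l, mat_reg 3 j l)) [0..<n]. reg_val (fst p) * reg_val (snd p))"
      using ij XYZ_carrier by (simp add: o_def sum_list_upt aux_def)
  qed simp
  define M10 where "M10 = ?e (square (Temp [1, 9]) n (\<lambda>i j. map (\<lambda>l. ((Out_L, l, i), mat_reg 8 l j)) [0..<n])) M9"
  have M10: "agree (K8 \<union> ?B 8 \<union> ?B 9) reg_val M10"
    unfolding M10_def
  proof (rule exec_square[OF M9])
    fix i j assume ij: "i < n" "j < n"
    show "\<forall>p\<in>set (map (\<lambda>l. ((Out_L, l, i), mat_reg 8 l j)) [0..<n]). fst p \<in> K8 \<union> ?B 8 \<and> snd p \<in> K8 \<union> ?B 8"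
      using ij by (auto simp: K8_def K6_def K4_def mat_reg_def)
    have "(transpose_mat L * G) $$ (i, j) = (\<Sum>l<n. transpose_mat L $$ (i, l) * G $$ (l, j))"
      using ij L_facts G_facts by (intro mat_mult_idx) auto
    then show "reg_val (Temp [1, 9], i, j) = (\<Sum>p\<leftarrow>map (\<lambda>l. ((Out_L, l, i), mat_reg 8 l j)) [0..<n]. reg_val (fst p) * reg_val (snd p))"
      using ij L_facts by (simp add: o_def sum_list_upt aux_def del: index_mult_mat)
  qed simp
  define M11 where "M11 = exec sqf svd (SVD n Out_U Out_S Out_V (Temp [1, 9])) M10"
  have "svd (transpose_mat L * G) = (U, S, V)" by (simp add: G_def USV_eq)
  then have M11: "agree (K8 \<union> ?B 8 \<union> ?B 9 \<union> block Out_U n n \<union> block Out_S n n \<union> block Out_V n n) reg_val M11"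
    unfolding M11_def by (intro exec_SVD[OF M10]) (use L_facts G_facts in \<open>auto simp: aux_def\<close>)
  define K11 where "K11 = K8 \<union> ?B 8 \<union> block Out_U n n \<union> block Out_S n n \<union> block Out_V n n"
  have M11: "agree K11 reg_val M11" by (rule agree_mono[OF M11]) (auto simp: K11_def)
  define M12 where "M12 = ?e (square Out_T1 n (\<lambda>i j. map (\<lambda>l. (mat_reg 8 i l, (Out_V, l, j))) [0..<n])) M11"
  have M12: "agree (K11 \<union> block Out_T1 n n) reg_val M12"
    unfolding M12_def
  proof (rule exec_square[OF M11])
    fix i j assume ij: "i < n" "j < n"
    show "\<forall>p\<in>set (map (\<lambda>l. (mat_reg 8 i l, (Out_V, l, j))) [0..<n]). fst p \<in> K11 \<and> snd p \<in> K11"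
      using ij by (auto simp: K11_def mat_reg_def)
    have "T1 $$ (i, j) = (\<Sum>l<n. G $$ (i, l) * V $$ (l, j))"
      unfolding T1_eq G_def[symmetric] using ij G_facts USV_carrier by (intro mat_mult_idx) auto
    then show "reg_val (Out_T1, i, j) = (\<Sum>p\<leftarrow>map (\<lambda>l. (mat_reg 8 i l, (Out_V, l, j))) [0..<n]. reg_val (fst p) * reg_val (snd p))"
      by (simp add: o_def sum_list_upt aux_def)
  qed simp
  define M13 where "M13 = ?e (layer (diag_reg 0) (\<lambda>_. [(one_reg, one_reg)]) [0..<n]) M12"
  have M13: "agree (K11 \<union> block Out_T1 n n \<union> diag_reg 0 ` set [0..<n]) reg_val M13"
    unfolding M13_def
    by (intro exec_layer[OF M12]) (auto simp: K11_def K8_def K6_def K4_def K0_def const_set_def scale_def)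
  define M14 where "M14 = ?e (layer (diag_reg 1) (\<lambda>a. [((Out_S, a, a), (Out_S, a, a))]) [0..<n]) M13"
  have M14: "agree (K11 \<union> block Out_T1 n n \<union> diag_reg 0 ` set [0..<n] \<union> diag_reg 1 ` set [0..<n]) reg_val M14"
    unfolding M14_def by (intro exec_layer[OF M13]) (auto simp: K11_def scale_def)
  have "?e (factor_program n) M = M14"
    unfolding M14_def M13_def M12_def M11_def M10_def M9_def M8_def M7_def M6_def M5_def M4_def M3_def M2_def M1_def M0_def
      factor_program_def
    by (simp only: fold_append fold_simps o_apply append.simps)
  moreover have "agree (K \<union> const_set \<union> block Out_R n n \<union> block Out_L n n \<union> block Out_U n n \<union> block Out_S n n \<union> block Out_V n n
    \<union> block Out_T1 n n \<union> diag_set 0 \<union> diag_set 1) reg_val M14"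
    by (rule agree_mono[OF M14]) (auto simp: K11_def K8_def K6_def K4_def K0_def diag_set_def atLeast0LessThan)
  ultimately show ?thesis by simp
qed

section \<open>Induction over the stages\<close>

definition data_set where
  "data_set = block Out_R n n \<union> block Out_L n n \<union> block Out_U n n \<union> block Out_S n n \<union> block Out_V n n \<union> block Out_T1 n n"

text \<open>What stage \<open>k\<close> hands on: Horner entries of total degree up to
  \<open>k\<close>, and the delivered coefficients of degree up to \<open>k - 2\<close> with their
  scaled copies.\<close>

definition known where
  "known k = const_set \<union> (\<Union>t\<in>{0, 1}. diag_set t \<union> tilde_set t \<union> horner_set t (Suc k) 0 \<union> scaled_set t k) \<union> T_set k"

definition equation_set where
  "equation_set k = (if k = 2 then data_set else \<Union>t\<in>{0, 1}. rhs_set t k \<union> lhs_set t k)"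

lemma agree_initial_memory: "agree (coeff_set 0 \<union> coeff_set 1) reg_val (initial_memory n d v w)"
proof -
  have "fst r \<noteq> Temp [] \<and> initial_memory n d v w r = reg_val r" if "r \<in> coeff_set t" for t r
  proof -
    from that obtain \<mu> i where r: "r = coeff_reg n t \<mu>" "\<mu> \<in> words n i" "i \<in> {2..d}"
      unfolding coeff_set_def by blast
    then show ?thesis using idx_less[OF r(2)] wordsD(1)[OF r(2)]
      by (auto simp: coeff_reg_def initial_memory_def)
  qed
  then show ?thesis by (auto simp: agree_def)
qed

lemma exec_setup_program:
  assumes "agree (coeff_set 0 \<union> coeff_set 1) reg_val M"
  shows "agree (known 2 \<union> equation_set 2) reg_val (fold (exec sqf svd) (setup_program n d) M)"
proof -
  let ?e = "fold (exec sqf svd)"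
  let ?is = "[2..<Suc d]"
  let ?K1 = "coeff_set 0 \<union> coeff_set 1 \<union> const_set \<union> data_set \<union> diag_set 0 \<union> diag_set 1"
  let ?M1 = "?e (factor_program n) M"
  let ?t = "\<lambda>t. \<Union>i\<in>set ?is. tilde_reg n t ` words n i"
  have M1: "agree ?K1 reg_val ?M1"
    using exec_factor_program[OF assms] by (auto simp: data_set_def elim!: agree_mono)
  have M2: "agree (?K1 \<union> ?t 0) reg_val (?e (concat (map (mode_program n 0) ?is)) ?M1)"
    by (rule exec_mode_programs[OF M1]) (auto simp: data_set_def)
  have M3: "agree (?K1 \<union> ?t 0 \<union> ?t 1) reg_val (?e (concat (map (mode_program n 1) ?is)) (?e (concat (map (mode_program n 0) ?is)) ?M1))"
    by (rule exec_mode_programs[OF M2]) (auto simp: data_set_def)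
  \<comment> \<open>The induction starts without Horner entries, since total degrees below 3 are
    excluded from \<open>horner_set\<close>.\<close>
  have empty: "T_set 2 = {}" "horner_set t (Suc 2) 0 = {}" "scaled_set t 2 = {}" for t
    by (auto simp: T_set_def horner_set_def scaled_set_def)
  have "tilde_set t \<subseteq> ?t t" for t by (auto simp: tilde_set_def)
  then have "known 2 \<union> equation_set 2 \<subseteq> ?K1 \<union> ?t 0 \<union> ?t 1"
    unfolding known_def equation_set_def empty by auto
  from agree_mono[OF M3 this] show ?thesis
    by (simp only: setup_program_def fold_append o_apply)
qed

lemma memory_after_Suc:
  "2 \<le> k \<Longrightarrow> memory_after sqf svd n d v w T P (Suc k) = fold (exec sqf svd) (P (Suc k))
     (write_mat (Lower_T (k - 1)) n (n ^ (k - 1)) (T (k - 1)) (memory_after sqf svd n d v w T P k))"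
  by (simp add: memory_after_def)

lemma agree_memory_after:
  assumes "2 \<le> k" "k \<le> d"
  shows "agree (known k \<union> equation_set k) reg_val (memory_after sqf svd n d v w T (balancing_program n d) k)"
  using assms
proof (induction k rule: dec_induct)
  case base
  show ?case using exec_setup_program[OF agree_initial_memory]
    by (simp add: memory_after_def balancing_program_def)
next
  case (step k)
  let ?e = "fold (exec sqf svd)"
  let ?M = "memory_after sqf svd n d v w T (balancing_program n d) k"
  let ?N = "write_mat (Lower_T (k - 1)) n (n ^ (k - 1)) (T (k - 1)) ?M"
  let ?H = "known k \<union> T_set (Suc k)"
  have "agree (known k \<union> equation_set k) reg_val ?M" using step by simp
  then have M: "agree (known k) reg_val ?M" by (rule agree_mono) auto
  have "agree (known k \<union> block (Lower_T (k - 1)) n (n ^ (k - 1))) reg_val ?N"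
    unfolding block_def
  proof (rule agree_write_mat[OF M])
    fix i j show "reg_val (Lower_T (k - 1), i, j) = T (k - 1) $$ (i, j)"
      using step by (auto simp: trunc_def)
  qed simp
  \<comment> \<open>The matrix delivered before stage \<open>Suc k\<close> has degree
    \<open>k - 1\<close>, the only degree by which \<open>T_set (Suc k)\<close> exceeds
    \<open>T_set k\<close>.\<close>
  moreover have "?H \<subseteq> known k \<union> block (Lower_T (k - 1)) n (n ^ (k - 1))"
  proof -
    have "r \<in> T_set k \<union> block (Lower_T (k - 1)) n (n ^ (k - 1))" if "r \<in> T_set (Suc k)" for r
    proof -
      from that obtain a \<beta> i where r: "r = T_reg n a \<beta>" "a < n" "\<beta> \<in> words n i" "1 \<le> i" "i + 2 \<le> Suc k"
        unfolding T_set_def by blast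
      show ?thesis
      proof (cases "i + 2 \<le> k")
        case True then show ?thesis using r unfolding T_set_def by blast
      next
        case False
        then have "i = k - 1" using r(5) by simp
        then show ?thesis using r idx_less[OF r(3)] wordsD(1)[OF r(3)] by (auto simp: T_reg_def)
      qed
    qed
    then show ?thesis by (auto simp: known_def)
  qed
  ultimately have M0: "agree ?H reg_val ?N" by (rule agree_mono)
  let ?S = "\<lambda>t. horner_set t (Suc (Suc k)) 0 \<union> scaled_set t (Suc k) \<union> rhs_set t (Suc k) \<union> lhs_set t (Suc k)"
  have M1: "agree (?H \<union> horner_set 0 (Suc (Suc k)) 0 \<union> scaled_set 0 (Suc k) \<union> rhs_set 0 (Suc k) \<union> lhs_set 0 (Suc k))
      reg_val (?e (equation_program n 0 (Suc k)) ?N)"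
    using step by (intro exec_equation_program[OF M0]) (auto simp: known_def)
  have "agree (?H \<union> ?S 0 \<union> horner_set 1 (Suc (Suc k)) 0 \<union> scaled_set 1 (Suc k) \<union> rhs_set 1 (Suc k) \<union> lhs_set 1 (Suc k))
      reg_val (?e (equation_program n 1 (Suc k)) (?e (equation_program n 0 (Suc k)) ?N))"
    by (rule exec_equation_program) (use M1 step in \<open>auto simp: known_def Un_assoc\<close>)
  moreover have "known (Suc k) \<union> equation_set (Suc k)
      \<subseteq> ?H \<union> ?S 0 \<union> horner_set 1 (Suc (Suc k)) 0 \<union> scaled_set 1 (Suc k) \<union> rhs_set 1 (Suc k) \<union> lhs_set 1 (Suc k)"
    using step by (auto simp: known_def equation_set_def)
  ultimately have "agree (known (Suc k) \<union> equation_set (Suc k)) reg_val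
      (?e (equation_program n 1 (Suc k)) (?e (equation_program n 0 (Suc k)) ?N))"
    by (rule agree_mono)
  moreover have "balancing_program n d (Suc k) = equation_program n 0 (Suc k) @ equation_program n 1 (Suc k)"
    using step by (simp add: balancing_program_def)
  ultimately show ?case by (simp only: memory_after_Suc[OF step(1)] fold_append o_apply)
qed

lemma read_vec_agree:
  assumes "agree K reg_val M" "u \<in> carrier_vec N" "\<And>i. i < N \<Longrightarrow> (x, i, 0) \<in> K \<and> reg_val (x, i, 0) = u $ i"
  shows "read_vec M x N = u"
  using assms by (auto simp: read_vec_def agreeD)

lemma holds_balancing_data_memory_after:
  "holds_balancing_data (memory_after sqf svd n d v w T (balancing_program n d) 2) n d R L U S V T1 vt wt"
proof -
  let ?M = "memory_after sqf svd n d v w T (balancing_program n d) 2"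
  have M: "agree (known 2 \<union> equation_set 2) reg_val ?M" using d_ge by (intro agree_memory_after) auto
  have mats: "read_mat ?M x n n = A"
    if "block x n n \<subseteq> data_set" "A \<in> carrier_mat n n" "\<And>i j. reg_val (x, i, j) = A $$ (i, j)" for x A
    using that by (intro read_mat_agree[OF M]) (auto simp: equation_set_def)
  have vecs: "read_vec ?M ((if t = 0 then Out_vt else Out_wt) i) (n ^ i) = tilde t i"
    if "i \<in> {2..d}" "t \<in> {0, 1}" for i t
  proof (rule read_vec_agree[OF M tilde_carrier])
    fix j assume "j < n ^ i"
    then obtain \<mu> where \<mu>: "\<mu> \<in> words n i" "j = idx n \<mu>" by (rule idx_cases)
    then have "tilde_reg n t \<mu> \<in> tilde_set t" unfolding tilde_set_def using that(1) by blast
    then have "tilde_reg n t \<mu> \<in> known 2" using that(2) by (auto simp: known_def)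
    moreover have "tilde_reg n t \<mu> = ((if t = 0 then Out_vt else Out_wt) i, j, 0)"
      using \<mu> wordsD(1)[OF \<mu>(1)] by (simp add: tilde_reg_def)
    ultimately show "((if t = 0 then Out_vt else Out_wt) i, j, 0) \<in> known 2 \<union> equation_set 2
        \<and> reg_val ((if t = 0 then Out_vt else Out_wt) i, j, 0) = tilde t i $ j"
      by (simp add: tilde_def)
  qed
  have "read_vec ?M (Out_vt i) (n ^ i) = vt i \<and> read_vec ?M (Out_wt i) (n ^ i) = wt i" if "i \<in> {2..d}" for i
    using vecs[OF that, of 0] vecs[OF that, of 1] by (simp add: tilde_def)
  then show ?thesis unfolding holds_balancing_data_def
    using R_facts(1) L_facts(1) USV_carrier T1_carrier by (auto simp: data_set_def intro!: mats)
qed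

lemma holds_equations_memory_after:
  assumes "k \<in> {3..d}"
  shows "holds_equations (memory_after sqf svd n d v w T (balancing_program n d) k) n k S T vt wt"
proof -
  let ?M = "memory_after sqf svd n d v w T (balancing_program n d) k"
  have k: "3 \<le> k" "k \<le> d" using assms by auto
  let ?K = "known k \<union> equation_set k"
  have M: "agree ?K reg_val ?M" using k by (intro agree_memory_after) auto
  have in_K: "rhs_set t k \<subseteq> ?K" "lhs_set t k \<subseteq> ?K" if "t \<in> {0, 1}" for t
    using that k by (auto simp: equation_set_def)
  have lhs: "((if t = 0 then Out_lhs_c else Out_lhs_o) k, r, j) \<in> ?K"
    if trj: "t \<in> {0, 1}" "r < length (monomials n k) - row_offset n t" "j < n ^ k" for t r j
  proof -
    obtain \<alpha> where \<alpha>: "\<alpha> \<in> words n k" "j = idx n \<alpha>" using trj(3) by (rule idx_cases)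
    then have "lhs_reg n t r \<alpha> \<in> lhs_set t k" unfolding lhs_set_def using trj(2) by blast
    moreover have "lhs_reg n t r \<alpha> = ((if t = 0 then Out_lhs_c else Out_lhs_o) k, r, j)"
      using \<alpha> wordsD(1)[OF \<alpha>(1)] by (simp add: lhs_reg_def)
    ultimately show ?thesis using in_K(2)[OF trj(1)] by auto
  qed
  have rhs: "((if t = 0 then Out_rhs_c else Out_rhs_o) k, r, 0) \<in> ?K"
    if "t \<in> {0, 1}" "r < length (monomials n k) - row_offset n t" for t r
    using in_K(1)[OF that(1)] that(2) by (auto simp: rhs_set_def rhs_reg_def)
  \<comment> \<open>The equations are stated with \<open>T\<close>, the registers hold values for
    \<open>trunc\<close>; below degree \<open>k \<le> d\<close> they agree.\<close>
  have T: "T i = trunc i" if "1 \<le> i" "i < k" for i using that k by (simp add: trunc_def)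
  have "read_mat ?M (Out_lhs_c k) (length (monomials n k)) (n ^ k) = lhs_c n k"
    using lhs[of 0] by (intro read_mat_agree[OF M]) (auto simp: block_def row_offset_def)
  moreover have "read_mat ?M (Out_lhs_o k) (length (monomials n k) - n) (n ^ k) = lhs_o n k S"
    using lhs[of 1] k USV_carrier by (intro read_mat_agree[OF M]) (auto simp: block_def row_offset_def)
  moreover have "read_vec ?M (Out_rhs_c k) (length (monomials n k)) = rhs_c n k T vt"
    using rhs[of 0] by (intro read_vec_agree[OF M]) (auto simp: row_offset_def rhs_cong(1)[OF T] carrier_vecI)
  moreover have "read_vec ?M (Out_rhs_o k) (length (monomials n k) - n) = rhs_o n k S T wt"
    using rhs[of 1] by (intro read_vec_agree[OF M]) (auto simp: row_offset_def rhs_cong(2)[OF T] carrier_vecI)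
  ultimately show ?thesis by (simp add: holds_equations_def)
qed

end

section \<open>Agreement to a given degree\<close>

lemma vnorm_L2_set: "x \<in> carrier_vec n \<Longrightarrow> vnorm x = L2_set (\<lambda>i. \<bar>x $ i\<bar>) {..<n}"
  by (simp add: vnorm_def L2_set_def scalar_prod_def atLeast0LessThan power2_eq_square)

lemma vnorm_nonneg: "0 \<le> vnorm x"
  by (simp add: vnorm_def scalar_prod_def sum_nonneg)

lemma abs_index_le_vnorm: "x \<in> carrier_vec n \<Longrightarrow> i < n \<Longrightarrow> \<bar>x $ i\<bar> \<le> vnorm x"
  unfolding vnorm_L2_set by (intro member_le_L2_set) auto

lemma vnorm_le_sum_abs: "x \<in> carrier_vec n \<Longrightarrow> vnorm x \<le> (\<Sum>i<n. \<bar>x $ i\<bar>)"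
  unfolding vnorm_L2_set by (intro L2_set_le_sum) auto

lemma abs_word_prod_le:
  assumes "z \<in> carrier_vec n" "set \<alpha> \<subseteq> {..<n}"
  shows "\<bar>word_prod (\<lambda>i. z $ i) \<alpha>\<bar> \<le> vnorm z ^ length \<alpha>"
  using assms(2)
proof (induction \<alpha>)
  case (Cons a \<alpha>)
  have "\<bar>z $ a\<bar> * \<bar>word_prod (\<lambda>i. z $ i) \<alpha>\<bar> \<le> vnorm z * vnorm z ^ length \<alpha>"
    using Cons abs_index_le_vnorm[OF assms(1)] vnorm_nonneg by (intro mult_mono) auto
  then show ?case by (simp add: abs_mult)
qed simp

text \<open>In the unit ball a monomial of degree at least \<open>m\<close> is bounded by the
  \<open>m\<close>th power of the norm.\<close>

lemma abs_polynomial_le: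
  assumes "\<And>\<alpha>. length \<alpha> < m \<Longrightarrow> f \<alpha> = 0" "z \<in> carrier_vec n" "vnorm z \<le> 1"
  shows "\<bar>\<Sum>\<alpha>\<in>short_words n N. f \<alpha> * word_prod (\<lambda>i. z $ i) \<alpha>\<bar> \<le> (\<Sum>\<alpha>\<in>short_words n N. \<bar>f \<alpha>\<bar>) * vnorm z ^ m"
proof -
  have "\<bar>f \<alpha> * word_prod (\<lambda>i. z $ i) \<alpha>\<bar> \<le> \<bar>f \<alpha>\<bar> * vnorm z ^ m" if "\<alpha> \<in> short_words n N" for \<alpha>
  proof (cases "length \<alpha> < m")
    case False
    have "\<bar>word_prod (\<lambda>i. z $ i) \<alpha>\<bar> \<le> vnorm z ^ length \<alpha>"
      using that assms(2) by (intro abs_word_prod_le) (auto simp: short_words_def)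
    also have "\<dots> \<le> vnorm z ^ m" using False assms(3) vnorm_nonneg by (intro power_decreasing) auto
    finally show ?thesis by (simp add: abs_mult mult_left_mono)
  qed (simp add: assms(1))
  then have "(\<Sum>\<alpha>\<in>short_words n N. \<bar>f \<alpha> * word_prod (\<lambda>i. z $ i) \<alpha>\<bar>) \<le> (\<Sum>\<alpha>\<in>short_words n N. \<bar>f \<alpha>\<bar> * vnorm z ^ m)"
    by (rule sum_mono)
  with sum_abs[of "\<lambda>\<alpha>. f \<alpha> * word_prod (\<lambda>i. z $ i) \<alpha>" "short_words n N"] show ?thesis
    unfolding sum_distrib_right by (rule order_trans)
qed

lemma agree_to_degree_trans:
  assumes "agree_to_degree n d E F" "agree_to_degree n d F H"
  shows "agree_to_degree n d E H"
proof -
  obtain C \<delta> where 1: "\<delta> > 0" "\<And>x. x \<in> carrier_vec n \<Longrightarrow> vnorm x < \<delta> \<Longrightarrow> \<bar>E x - F x\<bar> \<le> C * vnorm x ^ (d + 1)"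
    using assms(1) unfolding agree_to_degree_def by blast
  obtain C' \<delta>' where 2: "\<delta>' > 0" "\<And>x. x \<in> carrier_vec n \<Longrightarrow> vnorm x < \<delta>' \<Longrightarrow> \<bar>F x - H x\<bar> \<le> C' * vnorm x ^ (d + 1)"
    using assms(2) unfolding agree_to_degree_def by blast
  show ?thesis unfolding agree_to_degree_def
  proof (rule exI[of _ "C + C'"], rule exI[of _ "min \<delta> \<delta>'"], intro conjI ballI impI)
    fix x assume x: "x \<in> carrier_vec n" "vnorm x < min \<delta> \<delta>'"
    have "\<bar>E x - H x\<bar> \<le> \<bar>E x - F x\<bar> + \<bar>F x - H x\<bar>" by linarith
    also have "\<dots> \<le> C * vnorm x ^ (d + 1) + C' * vnorm x ^ (d + 1)"
      using x by (intro add_mono 1(2) 2(2)) auto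
    finally show "\<bar>E x - H x\<bar> \<le> (C + C') * vnorm x ^ (d + 1)" by (simp add: algebra_simps)
  qed (use 1 2 in auto)
qed

text \<open>A map bounded linearly near the origin preserves errors of order
  \<open>d + 1\<close>.\<close>

lemma agree_to_degree_compose:
  assumes "agree_to_degree n d E F" and "\<And>z. z \<in> carrier_vec n \<Longrightarrow> \<phi> z \<in> carrier_vec n"
    and "\<And>z. z \<in> carrier_vec n \<Longrightarrow> vnorm z \<le> 1 \<Longrightarrow> vnorm (\<phi> z) \<le> B * vnorm z"
  shows "agree_to_degree n d (\<lambda>z. E (\<phi> z)) (\<lambda>z. F (\<phi> z))"
proof -
  obtain C \<delta> where 1: "\<delta> > 0" "\<And>x. x \<in> carrier_vec n \<Longrightarrow> vnorm x < \<delta> \<Longrightarrow> \<bar>E x - F x\<bar> \<le> C * vnorm x ^ (d + 1)"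
    using assms(1) unfolding agree_to_degree_def by blast
  \<comment> \<open>A positive bound is needed, since the radius is divided by it.\<close>
  define D where "D = \<bar>B\<bar> + 1"
  have D: "D > 0" "B \<le> D" by (auto simp: D_def)
  show ?thesis unfolding agree_to_degree_def
  proof (rule exI[of _ "\<bar>C\<bar> * D ^ (d + 1)"], rule exI[of _ "min 1 (\<delta> / D)"], intro conjI ballI impI)
    show "0 < min 1 (\<delta> / D)" using 1(1) D by simp
    fix z assume z: "z \<in> carrier_vec n" "vnorm z < min 1 (\<delta> / D)"
    have "vnorm (\<phi> z) \<le> B * vnorm z" using z by (intro assms(3)) auto
    also have "\<dots> \<le> D * vnorm z" using D vnorm_nonneg by (intro mult_right_mono) auto
    finally have le: "vnorm (\<phi> z) \<le> D * vnorm z" .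
    also have "\<dots> < \<delta>" using z(2) D by (simp add: pos_less_divide_eq mult.commute)
    finally have "\<bar>E (\<phi> z) - F (\<phi> z)\<bar> \<le> C * vnorm (\<phi> z) ^ (d + 1)" using z(1) by (intro 1(2) assms(2))
    also have "\<dots> \<le> \<bar>C\<bar> * vnorm (\<phi> z) ^ (d + 1)" by (intro mult_right_mono zero_le_power vnorm_nonneg) simp
    also have "\<dots> \<le> \<bar>C\<bar> * (D * vnorm z) ^ (d + 1)" using le vnorm_nonneg by (intro mult_left_mono power_mono) auto
    finally show "\<bar>E (\<phi> z) - F (\<phi> z)\<bar> \<le> \<bar>C\<bar> * D ^ (d + 1) * vnorm z ^ (d + 1)"
      by (simp only: power_mult_distrib mult.assoc)
  qed
qed

lemma conv_W_Nil: "conv f (W \<tau> []) = f"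
proof
  fix \<alpha> show "conv f (W \<tau> []) \<alpha> = f \<alpha>"
  proof -
    have "conv f (W \<tau> []) \<alpha> = (\<Sum>j\<le>length \<alpha>. if j = length \<alpha> then f \<alpha> else 0)"
      unfolding conv_def by (intro sum.cong) auto
    then show ?thesis by simp
  qed
qed

lemma mat_mult_vec_idx:
  assumes "A \<in> carrier_mat r c" "u \<in> carrier_vec c" "i < r"
  shows "(A *\<^sub>v u) $ i = (\<Sum>j<c. A $$ (i, j) * u $ j)"
  using assms by (simp add: scalar_prod_def atLeast0LessThan)

context balancing_setup
begin

section \<open>The normal form\<close>

text \<open>The coordinates before the linear map: \<open>T1\<close> takes them to the transformed
  point, by \<open>phi_coords\<close>.\<close>

definition coords :: "real Matrix.vec \<Rightarrow> nat \<Rightarrow> real" where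
  "coords z a = (\<Sum>\<alpha>\<in>short_words n d. coeff_fun n trunc a \<alpha> * word_prod (\<lambda>i. z $ i) \<alpha>)"

definition composed_coeff :: "nat \<Rightarrow> nat list \<Rightarrow> real" where
  "composed_coeff t \<alpha> = (\<Sum>i=2..d. \<Sum>\<mu>\<in>words n i. tilde t i $ idx n \<mu> * W (coeff_fun n trunc) \<mu> \<alpha>)"

definition homogeneous_part :: "nat \<Rightarrow> nat \<Rightarrow> real Matrix.vec \<Rightarrow> real" where
  "homogeneous_part t k z = (\<Sum>\<alpha>\<in>words n k. composed_coeff t \<alpha> * word_prod (\<lambda>i. z $ i) \<alpha>)"

abbreviation "\<phi> \<equiv> transformation n d T1 T"

lemma phi_carrier: "\<phi> z \<in> carrier_vec n"
  by (simp add: transformation_def vsum_def)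

lemma phi_coords:
  assumes z: "z \<in> carrier_vec n" and b: "b < n"
  shows "\<phi> z $ b = (\<Sum>a<n. T1 $$ (b, a) * coords z a)"
proof -
  let ?z = "\<lambda>i. z $ i"
  have comp: "((T1 * T k) *\<^sub>v kpow_vec z k) $ b = (\<Sum>a<n. T1 $$ (b, a) * (\<Sum>\<alpha>\<in>words n k. coeff_fun n trunc a \<alpha> * word_prod ?z \<alpha>))"
    if k: "k \<in> {1..d - 1}" for k
  proof -
    have Tk: "T k = trunc k" using k by (auto simp: trunc_def)
    have zk: "kpow_vec z k \<in> carrier_vec (n ^ k)" using z by (rule kpow_vec_carrier)
    have tr: "trunc k *\<^sub>v kpow_vec z k \<in> carrier_vec n" using trunc_carrier zk by (rule mult_mat_vec_carrier)
    have "((T1 * T k) *\<^sub>v kpow_vec z k) $ b = (T1 *\<^sub>v (trunc k *\<^sub>v kpow_vec z k)) $ b"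
      unfolding Tk by (subst assoc_mult_mat_vec[OF T1_carrier trunc_carrier zk]) simp
    also have "\<dots> = (\<Sum>a<n. T1 $$ (b, a) * (trunc k *\<^sub>v kpow_vec z k) $ a)"
      by (rule mat_mult_vec_idx[OF T1_carrier tr b])
    also have "\<dots> = (\<Sum>a<n. T1 $$ (b, a) * (\<Sum>\<alpha>\<in>words n k. coeff_fun n trunc a \<alpha> * word_prod ?z \<alpha>))"
    proof (intro sum.cong refl arg_cong2[of _ _ _ _ "(*)"])
      fix a assume a: "a \<in> {..<n}"
      have "(trunc k *\<^sub>v kpow_vec z k) $ a = (\<Sum>j<n ^ k. trunc k $$ (a, j) * kpow_vec z k $ j)"
        using mat_mult_vec_idx[OF trunc_carrier zk] a by simp
      also have "\<dots> = (\<Sum>\<alpha>\<in>words n k. coeff_fun n trunc a \<alpha> * word_prod ?z \<alpha>)"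
        unfolding sum_idx using a k by (intro sum.cong refl) (simp add: kpow_vec_idx[OF z] coeff_fun_trunc)
      finally show "(trunc k *\<^sub>v kpow_vec z k) $ a = (\<Sum>\<alpha>\<in>words n k. coeff_fun n trunc a \<alpha> * word_prod ?z \<alpha>)" .
    qed
    finally show ?thesis .
  qed
  have coords: "coords z a = (\<Sum>k=1..d - 1. \<Sum>\<alpha>\<in>words n k. coeff_fun n trunc a \<alpha> * word_prod ?z \<alpha>)" for a
    unfolding coords_def sum_short_words
  proof (rule sum.mono_neutral_right)
    show "\<forall>k\<in>{..d} - {1..d - 1}. (\<Sum>\<alpha>\<in>words n k. coeff_fun n trunc a \<alpha> * word_prod ?z \<alpha>) = 0"
    proof
      fix k assume "k \<in> {..d} - {1..d - 1}"
      \<comment> \<open>There is no constant term, and degree \<open>d\<close> is cut off by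
        \<open>trunc\<close>: the transformation has degree \<open>d - 1\<close>.\<close>
      then have "k = 0 \<or> k = d" by auto
      then show "(\<Sum>\<alpha>\<in>words n k. coeff_fun n trunc a \<alpha> * word_prod ?z \<alpha>) = 0"
        by (auto simp: coeff_fun_trunc_eq_0 wordsD intro!: sum.neutral)
    qed
  qed auto
  have "\<phi> z $ b = (\<Sum>k=1..d - 1. ((T1 * T k) *\<^sub>v kpow_vec z k) $ b)"
    using b by (simp add: transformation_def vsum_def)
  also have "\<dots> = (\<Sum>k=1..d - 1. \<Sum>a<n. T1 $$ (b, a) * (\<Sum>\<alpha>\<in>words n k. coeff_fun n trunc a \<alpha> * word_prod ?z \<alpha>))"
    by (intro sum.cong refl comp)
  also have "\<dots> = (\<Sum>a<n. T1 $$ (b, a) * coords z a)"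
    unfolding coords sum_distrib_left[of "T1 $$ _"] by (rule sum.swap)
  finally show ?thesis .
qed

text \<open>Each component is a polynomial without constant term, so
  \<open>abs_polynomial_le\<close> applies with \<open>m = 1\<close>.\<close>

lemma phi_linear_bound: "\<exists>B. \<forall>z\<in>carrier_vec n. vnorm z \<le> 1 \<longrightarrow> vnorm (\<phi> z) \<le> B * vnorm z"
proof -
  define c where "c a = (\<Sum>\<alpha>\<in>short_words n d. \<bar>coeff_fun n trunc a \<alpha>\<bar>)" for a
  show ?thesis
  proof (intro exI[of _ "\<Sum>b<n. \<Sum>a<n. \<bar>T1 $$ (b, a)\<bar> * c a"] ballI impI)
    fix z assume z: "z \<in> carrier_vec n" "vnorm z \<le> 1"
    have co: "\<bar>coords z a\<bar> \<le> c a * vnorm z" for a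
      using abs_polynomial_le[where f = "coeff_fun n trunc a" and m = 1 and N = d, OF _ z]
      by (simp add: coords_def c_def)
    have "\<bar>\<phi> z $ b\<bar> \<le> (\<Sum>a<n. \<bar>T1 $$ (b, a)\<bar> * c a) * vnorm z" if "b < n" for b
    proof -
      have "\<bar>\<phi> z $ b\<bar> \<le> (\<Sum>a<n. \<bar>T1 $$ (b, a) * coords z a\<bar>)"
        unfolding phi_coords[OF z(1) that] by (rule sum_abs)
      also have "\<dots> \<le> (\<Sum>a<n. \<bar>T1 $$ (b, a)\<bar> * (c a * vnorm z))"
        unfolding abs_mult by (intro sum_mono mult_left_mono co) simp
      finally show ?thesis by (simp add: sum_distrib_right mult.assoc)
    qed
    then have "(\<Sum>b<n. \<bar>\<phi> z $ b\<bar>) \<le> (\<Sum>b<n. (\<Sum>a<n. \<bar>T1 $$ (b, a)\<bar> * c a) * vnorm z)"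
      by (intro sum_mono) auto
    then show "vnorm (\<phi> z) \<le> (\<Sum>b<n. \<Sum>a<n. \<bar>T1 $$ (b, a)\<bar> * c a) * vnorm z"
      using vnorm_le_sum_abs[OF phi_carrier, of z] by (simp add: sum_distrib_right)
  qed
qed

text \<open>By adjointness the original coefficients at \<open>T1\<close> times
  \<open>coords z\<close> are the transformed ones at \<open>coords z\<close>, and the product of
  polynomials is then multiplied out. At most \<open>d\<close> factors of degree at most
  \<open>d\<close> explain the bound \<open>d * d\<close>.\<close>

lemma expansion_phi:
  assumes z: "z \<in> carrier_vec n"
  shows "(\<Sum>i=2..d. raw t i \<bullet> kpow_vec (\<phi> z) i)
    = (\<Sum>\<alpha>\<in>short_words n (d * d). composed_coeff t \<alpha> * word_prod (\<lambda>i. z $ i) \<alpha>)"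
proof -
  let ?z = "\<lambda>i. z $ i"
  let ?W = "W (coeff_fun n trunc)"
  have "raw t i \<bullet> kpow_vec (\<phi> z) i
      = (\<Sum>\<mu>\<in>words n i. \<Sum>\<alpha>\<in>short_words n (d * d). tilde t i $ idx n \<mu> * ?W \<mu> \<alpha> * word_prod ?z \<alpha>)" if i: "i \<in> {2..d}" for i
  proof -
    let ?f = "\<lambda>\<beta>. raw t i $ idx n \<beta>"
    have "raw t i \<bullet> kpow_vec (\<phi> z) i = (\<Sum>\<beta>\<in>words n i. ?f \<beta> * word_prod (\<lambda>b. \<phi> z $ b) \<beta>)"
      using raw_carrier[OF i, of t] kpow_vec_carrier[OF phi_carrier]
      by (subst scalar_prod_words) (auto simp: kpow_vec_idx[OF phi_carrier])
    also have "\<dots> = (\<Sum>\<beta>\<in>words n i. ?f \<beta> * word_prod (\<lambda>b. \<Sum>a<n. T1 $$ (b, a) * coords z a) \<beta>)"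
    proof (intro sum.cong refl arg_cong2[of _ _ _ _ "(*)"])
      fix \<beta> assume "\<beta> \<in> words n i"
      then have "set \<beta> \<subseteq> {..<n}" by (rule wordsD)
      then show "word_prod (\<lambda>b. \<phi> z $ b) \<beta> = word_prod (\<lambda>b. \<Sum>a<n. T1 $$ (b, a) * coords z a) \<beta>"
        by (induction \<beta>) (auto simp: phi_coords[OF z])
    qed
    also have "\<dots> = (\<Sum>\<mu>\<in>words n i. kron_apply n T1 \<mu> ?f * word_prod (coords z) \<mu>)"
      by (rule kron_apply_word_prod[symmetric])
    also have "\<dots> = (\<Sum>\<mu>\<in>words n i. tilde t i $ idx n \<mu> * (\<Sum>\<alpha>\<in>short_words n (d * d). ?W \<mu> \<alpha> * word_prod ?z \<alpha>))"
    proof (intro sum.cong refl arg_cong2[of _ _ _ _ "(*)"])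
      fix \<mu> assume \<mu>: "\<mu> \<in> words n i"
      show "kron_apply n T1 \<mu> ?f = tilde t i $ idx n \<mu>"
        unfolding tilde_eq using transformed_coeff_idx[where v = "raw t" and i = i, OF T1_carrier raw_carrier[OF i] \<mu>] by simp
      have "length \<mu> * d \<le> d * d" using wordsD(1)[OF \<mu>] i by simp
      have "word_prod (coords z) \<mu> = (\<Sum>\<alpha>\<in>short_words n (length \<mu> * d). ?W \<mu> \<alpha> * word_prod ?z \<alpha>)"
        unfolding coords_def using coeff_fun_trunc_eq_0 by (intro word_prod_substitute) auto
      also have "\<dots> = (\<Sum>\<alpha>\<in>short_words n (d * d). ?W \<mu> \<alpha> * word_prod ?z \<alpha>)"
      proof (rule sum.mono_neutral_left)
        show "short_words n (length \<mu> * d) \<subseteq> short_words n (d * d)"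
          using \<open>length \<mu> * d \<le> d * d\<close> unfolding short_words_def by (blast intro: le_trans)
        show "\<forall>\<alpha>\<in>short_words n (d * d) - short_words n (length \<mu> * d). ?W \<mu> \<alpha> * word_prod ?z \<alpha> = 0"
        proof
          fix \<alpha> assume "\<alpha> \<in> short_words n (d * d) - short_words n (length \<mu> * d)"
          then have "length \<mu> * d < length \<alpha>" by (auto simp: short_words_def)
          then have "?W \<mu> \<alpha> = 0" using coeff_fun_trunc_eq_0 by (intro W_eq_0_long[where d = d]) auto
          then show "?W \<mu> \<alpha> * word_prod ?z \<alpha> = 0" by simp
        qed
      qed simp
      finally show "word_prod (coords z) \<mu> = (\<Sum>\<alpha>\<in>short_words n (d * d). ?W \<mu> \<alpha> * word_prod ?z \<alpha>)" .
    qed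
    finally show ?thesis by (simp add: sum_distrib_left mult.assoc)
  qed
  then have "(\<Sum>i=2..d. raw t i \<bullet> kpow_vec (\<phi> z) i)
      = (\<Sum>i=2..d. \<Sum>\<mu>\<in>words n i. \<Sum>\<alpha>\<in>short_words n (d * d). tilde t i $ idx n \<mu> * ?W \<mu> \<alpha> * word_prod ?z \<alpha>)"
    by (intro sum.cong refl)
  also have "\<dots> = (\<Sum>i=2..d. \<Sum>\<alpha>\<in>short_words n (d * d). \<Sum>\<mu>\<in>words n i. tilde t i $ idx n \<mu> * ?W \<mu> \<alpha> * word_prod ?z \<alpha>)"
    by (intro sum.cong refl sum.swap)
  also have "\<dots> = (\<Sum>\<alpha>\<in>short_words n (d * d). \<Sum>i=2..d. \<Sum>\<mu>\<in>words n i. tilde t i $ idx n \<mu> * ?W \<mu> \<alpha> * word_prod ?z \<alpha>)"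
    by (rule sum.swap)
  finally show ?thesis by (simp add: composed_coeff_def sum_distrib_right)
qed

text \<open>The difference contains only words longer than \<open>d\<close>. Degrees 0 and 1 are
  absent because at least two factors without constant term are multiplied.\<close>

lemma expansion_phi_agree:
  "agree_to_degree n d (\<lambda>z. 1/2 * (\<Sum>i=2..d. raw t i \<bullet> kpow_vec (\<phi> z) i)) (\<lambda>z. 1/2 * (\<Sum>k=2..d. homogeneous_part t k z))"
proof -
  let ?g = "\<lambda>\<alpha>. if length \<alpha> \<le> d then 0 else composed_coeff t \<alpha>"
  have eq: "(\<Sum>i=2..d. raw t i \<bullet> kpow_vec (\<phi> z) i) - (\<Sum>k=2..d. homogeneous_part t k z)
      = (\<Sum>\<alpha>\<in>short_words n (d * d). ?g \<alpha> * word_prod (\<lambda>i. z $ i) \<alpha>)" if z: "z \<in> carrier_vec n" for z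
  proof -
    let ?z = "\<lambda>i. z $ i"
    have zero: "composed_coeff t \<alpha> = 0" if "length \<alpha> < 2" for \<alpha>
      unfolding composed_coeff_def using that
      by (intro sum.neutral ballI) (auto simp: wordsD intro!: W_eq_0_short)
    have "(\<Sum>k=2..d. homogeneous_part t k z) = (\<Sum>k\<le>d. homogeneous_part t k z)"
      by (rule sum.mono_neutral_left) (auto simp: homogeneous_part_def zero wordsD intro!: sum.neutral)
    also have "\<dots> = (\<Sum>\<alpha>\<in>short_words n d. composed_coeff t \<alpha> * word_prod ?z \<alpha>)"
      by (simp only: homogeneous_part_def sum_short_words)
    also have "\<dots> = (\<Sum>\<alpha>\<in>short_words n (d * d). if length \<alpha> \<le> d then composed_coeff t \<alpha> * word_prod ?z \<alpha> else 0)"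
    proof -
      have "d \<le> d * d" by simp
      then have "short_words n d = {\<alpha> \<in> short_words n (d * d). length \<alpha> \<le> d}"
        by (auto simp: short_words_def intro: le_trans[OF _ \<open>d \<le> d * d\<close>])
      then show ?thesis by (simp add: sum.inter_filter)
    qed
    finally show ?thesis unfolding expansion_phi[OF z]
      by (simp only: sum_subtractf[symmetric]) (intro sum.cong refl, simp)
  qed
  show ?thesis unfolding agree_to_degree_def
  proof (rule exI[of _ "\<Sum>\<alpha>\<in>short_words n (d * d). \<bar>?g \<alpha>\<bar>"], rule exI[of _ "1::real"], intro conjI ballI impI)
    fix z assume z: "z \<in> carrier_vec n" "vnorm z < 1"
    let ?D = "(\<Sum>i=2..d. raw t i \<bullet> kpow_vec (\<phi> z) i) - (\<Sum>k=2..d. homogeneous_part t k z)"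
    have "\<bar>?D\<bar> \<le> (\<Sum>\<alpha>\<in>short_words n (d * d). \<bar>?g \<alpha>\<bar>) * vnorm z ^ (d + 1)"
      unfolding eq[OF z(1)] using z by (intro abs_polynomial_le) auto
    moreover have "\<bar>1/2 * (\<Sum>i=2..d. raw t i \<bullet> kpow_vec (\<phi> z) i) - 1/2 * (\<Sum>k=2..d. homogeneous_part t k z)\<bar> = 1/2 * \<bar>?D\<bar>"
      unfolding right_diff_distrib[symmetric] abs_mult by simp
    ultimately show "\<bar>1/2 * (\<Sum>i=2..d. raw t i \<bullet> kpow_vec (\<phi> z) i) - 1/2 * (\<Sum>k=2..d. homogeneous_part t k z)\<bar>
        \<le> (\<Sum>\<alpha>\<in>short_words n (d * d). \<bar>?g \<alpha>\<bar>) * vnorm z ^ (d + 1)"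
      using abs_ge_zero[of ?D] by linarith
  qed simp
qed

text \<open>The coefficients are the entries of the congruence of \<open>V2\<close> or
  \<open>W2\<close> by \<open>T1\<close>, which \<open>balancing_identities\<close> makes
  diagonal.\<close>

lemma tilde_2:
  assumes "a < n" "b < n"
  shows "tilde t 2 $ idx n [a, b] = (if a = b then scale t a else 0)"
proof -
  define A where "A = (if t = 0 then V2 else W2)"
  have A: "A \<in> carrier_mat n n" "raw t 2 = vec_of A" using V2_carrier W2_carrier v2 w2 by (auto simp: A_def raw_def)
  have T1t: "transpose_mat T1 \<in> carrier_mat n n" using T1_carrier by simp
  have ab: "[a, b] \<in> words n 2" using assms by (auto simp: words_def)
  have 2: "2 \<in> {2..d}" using d_ge by simp
  have "tilde t 2 $ idx n [a, b] = (\<Sum>c<n. T1 $$ (c, a) * (\<Sum>e<n. T1 $$ (e, b) * A $$ (e, c)))"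
    unfolding tilde_eq transformed_coeff_idx[where v = "raw t" and i = 2, OF T1_carrier raw_carrier[OF 2] ab]
    by (simp add: A vec_of_reg add.commute)
  also have "\<dots> = (\<Sum>c<n. (transpose_mat T1 * A) $$ (b, c) * T1 $$ (c, a))"
    using assms A T1_carrier by (intro sum.cong refl) (simp add: mat_mult_idx[OF T1t A(1)] mult.commute del: index_mult_mat)
  also have "\<dots> = (transpose_mat T1 * A * T1) $$ (b, a)"
    using assms A T1_carrier by (intro mat_mult_idx[symmetric, of _ n n _ n]) auto
  also have "transpose_mat T1 * A * T1 = (if t = 0 then 1\<^sub>m n else S * S)"
    using balancing_identities[OF G_facts R_facts(1) L_facts(1) svd_LG]
    by (simp add: A_def T1_eq G_def R_facts L_facts)
  also have "(if t = 0 then 1\<^sub>m n else S * S) $$ (b, a) = (if a = b then scale t a else 0)"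
  proof -
    have "(S * S) $$ (b, a) = (S * S * 1\<^sub>m n) $$ (b, a)" using USV_carrier by simp
    also have "\<dots> = S $$ (b, b) * S $$ (b, b) * 1\<^sub>m n $$ (b, a)"
      using USV_carrier S_diag assms by (intro diagonal_mult_idx) auto
    finally show ?thesis using assms by (auto simp: scale_def)
  qed
  finally show ?thesis .
qed

text \<open>The quadratic form is diagonal, so only squares of single coordinates remain.\<close>

lemma quadratic_part:
  "(\<Sum>\<mu>\<in>words n 2. tilde t 2 $ idx n \<mu> * W (coeff_fun n trunc) \<mu> \<alpha>)
    = (\<Sum>a<n. scale t a * conv (coeff_fun n trunc a) (coeff_fun n trunc a) \<alpha>)"
proof -
  let ?\<tau> = "coeff_fun n trunc"
  have "(\<Sum>\<mu>\<in>words n 2. tilde t 2 $ idx n \<mu> * W ?\<tau> \<mu> \<alpha>)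
      = (\<Sum>a<n. \<Sum>b<n. tilde t 2 $ idx n [a, b] * W ?\<tau> [a, b] \<alpha>)"
    by (simp only: numeral_2_eq_2 sum_words_Suc words_0) simp
  also have "\<dots> = (\<Sum>a<n. \<Sum>b<n. if b = a then scale t a * conv (?\<tau> a) (?\<tau> a) \<alpha> else 0)"
  proof (intro sum.cong refl)
    fix a b assume "a \<in> {..<n}" "b \<in> {..<n}"
    then show "tilde t 2 $ idx n [a, b] * W ?\<tau> [a, b] \<alpha> = (if b = a then scale t a * conv (?\<tau> a) (?\<tau> a) \<alpha> else 0)"
      using tilde_2[of a b t] by (auto simp: conv_W_Nil[of _ ?\<tau>, simplified W.simps] simp del: idx.simps)
  qed
  finally show ?thesis by simp
qed

lemma coeff_fun_single: "a < n \<Longrightarrow> b < n \<Longrightarrow> coeff_fun n trunc a [b] = (if a = b then 1 else 0)"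
  using d_ge by (simp add: coeff_fun_def trunc_def T_1[unfolded One_nat_def])

lemma sum_coeff_fun_single: "a < n \<Longrightarrow> (\<Sum>b<n. coeff_fun n trunc a [b] * f b) = f a"
proof -
  assume a: "a < n"
  then have "(\<Sum>b<n. coeff_fun n trunc a [b] * f b) = (\<Sum>b<n. if b = a then f a else 0)"
    by (intro sum.cong) (auto simp: coeff_fun_single)
  then show ?thesis using a by simp
qed

lemma homogeneous_part_2: "homogeneous_part t 2 z = (\<Sum>a<n. scale t a * (z $ a)\<^sup>2)"
proof -
  let ?\<tau> = "coeff_fun n trunc"
  have coeff: "composed_coeff t \<alpha> = (\<Sum>a<n. scale t a * (?\<tau> a [c] * ?\<tau> a [e]))" if "\<alpha> = [c, e]" for \<alpha> c e
  proof -
    have "composed_coeff t \<alpha> = (\<Sum>i\<in>{2}. \<Sum>\<mu>\<in>words n i. tilde t i $ idx n \<mu> * W ?\<tau> \<mu> \<alpha>)"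
      unfolding composed_coeff_def using d_ge that
      by (intro sum.mono_neutral_right) (auto simp: wordsD intro!: sum.neutral W_eq_0_short)
    also have "\<dots> = (\<Sum>a<n. scale t a * conv (?\<tau> a) (?\<tau> a) \<alpha>)" by (simp add: quadratic_part)
    also have "\<dots> = (\<Sum>a<n. scale t a * (?\<tau> a [c] * ?\<tau> a [e]))"
      by (simp add: conv_def that atMost_Suc numeral_2_eq_2)
    finally show ?thesis .
  qed
  have "homogeneous_part t 2 z = (\<Sum>c<n. \<Sum>e<n. (\<Sum>a<n. scale t a * (?\<tau> a [c] * ?\<tau> a [e])) * (z $ c * z $ e))"
    by (simp only: homogeneous_part_def numeral_2_eq_2 sum_words_Suc words_0) (simp add: coeff)
  also have "\<dots> = (\<Sum>c<n. \<Sum>e<n. \<Sum>a<n. scale t a * (?\<tau> a [c] * z $ c) * (?\<tau> a [e] * z $ e))"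
    unfolding sum_distrib_right by (intro sum.cong refl) simp
  also have "\<dots> = (\<Sum>c<n. \<Sum>a<n. \<Sum>e<n. scale t a * (?\<tau> a [c] * z $ c) * (?\<tau> a [e] * z $ e))"
    by (intro sum.cong refl sum.swap)
  also have "\<dots> = (\<Sum>a<n. \<Sum>c<n. \<Sum>e<n. scale t a * (?\<tau> a [c] * z $ c) * (?\<tau> a [e] * z $ e))"
    by (rule sum.swap)
  also have "\<dots> = (\<Sum>a<n. scale t a * (z $ a)\<^sup>2)"
    by (intro sum.cong refl)
       (simp add: sum_distrib_left[symmetric] sum_distrib_right[symmetric] sum_coeff_fun_single power2_eq_square mult.assoc)
  finally show ?thesis .
qed

text \<open>The share of the unknown \<open>T (k - 1)\<close>, written as on the left-hand side of
  the equations. The factor 2 merges the two products of a linear term with a term of degree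
  \<open>k - 1\<close> in the square of a coordinate.\<close>

definition leading_coeff :: "nat \<Rightarrow> nat \<Rightarrow> nat list \<Rightarrow> real" where
  "leading_coeff t k \<alpha> = 2 * scale t (last \<alpha>) * trunc (k - 1) $$ (last \<alpha>, idx n (butlast \<alpha>))"

definition residual :: "nat \<Rightarrow> nat \<Rightarrow> nat \<Rightarrow> real" where
  "residual t k r = (\<Sum>\<alpha>\<in>monomial_class n k r.
     leading_coeff t k \<alpha> + gram_part n trunc (scale t) k \<alpha> + subst_part n trunc (tilde t) k \<alpha>)"

text \<open>Cutting a word of length \<open>k\<close> in the quadratic part gives
  \<open>T (k - 1)\<close> at the cuts 1 and \<open>k - 1\<close>, zero at the ends, and the Gram
  part in between. The two outer cuts contribute equally only after multiplication by commuting
  variables, so the identity concerns values and not the coefficients of single words.\<close>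

lemma homogeneous_part_eq:
  assumes "3 \<le> k" "k \<le> d"
  shows "homogeneous_part t k z = (\<Sum>\<alpha>\<in>words n k.
     (leading_coeff t k \<alpha> + gram_part n trunc (scale t) k \<alpha> + subst_part n trunc (tilde t) k \<alpha>) * word_prod (\<lambda>i. z $ i) \<alpha>)"
proof -
  let ?\<tau> = "coeff_fun n trunc" and ?z = "\<lambda>i. z $ i"
  obtain m where k: "k = Suc m" "2 \<le> m" using assms(1) by (cases k) auto
  define p where "p a = (\<Sum>\<beta>\<in>words n m. ?\<tau> a \<beta> * word_prod ?z \<beta>)" for a
  have coeff: "composed_coeff t \<alpha> = (\<Sum>a<n. scale t a * (?\<tau> a (take 1 \<alpha>) * ?\<tau> a (drop 1 \<alpha>)))
      + (\<Sum>a<n. scale t a * (?\<tau> a (take m \<alpha>) * ?\<tau> a (drop m \<alpha>)))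
      + gram_part n trunc (scale t) k \<alpha> + subst_part n trunc (tilde t) k \<alpha>" if \<alpha>: "\<alpha> \<in> words n k" for \<alpha>
  proof -
    have len: "length \<alpha> = k" using \<alpha> by (rule wordsD)
    let ?f = "\<lambda>i. \<Sum>\<mu>\<in>words n i. tilde t i $ idx n \<mu> * W ?\<tau> \<mu> \<alpha>"
    have "composed_coeff t \<alpha> = (\<Sum>i=2..k. ?f i)"
      unfolding composed_coeff_def using assms len
      by (intro sum.mono_neutral_right) (auto simp: wordsD intro!: sum.neutral W_eq_0_short)
    also have "\<dots> = ?f 2 + (\<Sum>i=3..k. ?f i)" using assms(1) by (simp add: sum.atLeast_Suc_atMost numeral_3_eq_3 numeral_2_eq_2)
    finally have "composed_coeff t \<alpha> = (\<Sum>a<n. scale t a * conv (?\<tau> a) (?\<tau> a) \<alpha>) + subst_part n trunc (tilde t) k \<alpha>"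
      by (simp add: quadratic_part subst_part_def)
    moreover have "(\<Sum>a<n. scale t a * conv (?\<tau> a) (?\<tau> a) \<alpha>) = (\<Sum>a<n. scale t a * (?\<tau> a (take 1 \<alpha>) * ?\<tau> a (drop 1 \<alpha>)))
      + (\<Sum>a<n. scale t a * (?\<tau> a (take m \<alpha>) * ?\<tau> a (drop m \<alpha>)))
      + (\<Sum>a<n. \<Sum>i=2..k-2. trunc (k - i) $$ (a, idx n (drop i \<alpha>)) * (scale t a * trunc i $$ (a, idx n (take i \<alpha>))))"
      unfolding sum.distrib[symmetric]
    proof (intro sum.cong refl)
      fix a assume a: "a \<in> {..<n}"
      let ?c = "\<lambda>j. ?\<tau> a (take j \<alpha>) * ?\<tau> a (drop j \<alpha>)"
      \<comment> \<open>The cuts 1 and \<open>m\<close> are distinct because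
        \<open>k \<ge> 3\<close>, so splitting off both from the sum is legitimate.\<close>
      have "conv (?\<tau> a) (?\<tau> a) \<alpha> = (\<Sum>j\<in>insert 1 (insert m {2..k-2}). ?c j)"
        unfolding conv_def len
      proof (rule sum.mono_neutral_right)
        show "\<forall>j\<in>{..k} - insert 1 (insert m {2..k - 2}). ?c j = 0"
        proof
          fix j assume "j \<in> {..k} - insert 1 (insert m {2..k - 2})"
          then have "j = 0 \<or> j = k" using k by auto
          then show "?c j = 0" using len by auto
        qed
      qed (use k in auto)
      also have "\<dots> = ?c 1 + (?c m + (\<Sum>j=2..k-2. ?c j))" using k by simp
      also have "(\<Sum>j=2..k-2. ?c j) = (\<Sum>i=2..k-2. trunc (k - i) $$ (a, idx n (drop i \<alpha>)) * trunc i $$ (a, idx n (take i \<alpha>)))"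
      proof (intro sum.cong refl)
        fix i assume i: "i \<in> {2..k-2}"
        then have "take i \<alpha> \<in> words n i" "drop i \<alpha> \<in> words n (k - i)" "1 \<le> i" "1 \<le> k - i"
          using \<alpha> by (auto intro: take_in_words drop_in_words)
        then show "?c i = trunc (k - i) $$ (a, idx n (drop i \<alpha>)) * trunc i $$ (a, idx n (take i \<alpha>))"
          using a by (simp add: coeff_fun_trunc)
      qed
      finally show "scale t a * conv (?\<tau> a) (?\<tau> a) \<alpha> = scale t a * ?c 1 + scale t a * ?c m
        + (\<Sum>i=2..k-2. trunc (k - i) $$ (a, idx n (drop i \<alpha>)) * (scale t a * trunc i $$ (a, idx n (take i \<alpha>))))"
        by (simp add: algebra_simps sum_distrib_left)
    qed
    moreover have "(\<Sum>a<n. \<Sum>i=2..k-2. trunc (k - i) $$ (a, idx n (drop i \<alpha>)) * (scale t a * trunc i $$ (a, idx n (take i \<alpha>))))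
        = gram_part n trunc (scale t) k \<alpha>"
      unfolding gram_part_def by (rule sum.swap)
    ultimately show ?thesis by simp
  qed
  have first: "(\<Sum>\<alpha>\<in>words n k. (\<Sum>a<n. scale t a * (?\<tau> a (take 1 \<alpha>) * ?\<tau> a (drop 1 \<alpha>))) * word_prod ?z \<alpha>) = (\<Sum>a<n. scale t a * (z $ a * p a))"
  proof -
    have "(\<Sum>\<alpha>\<in>words n k. (\<Sum>a<n. scale t a * (?\<tau> a (take 1 \<alpha>) * ?\<tau> a (drop 1 \<alpha>))) * word_prod ?z \<alpha>)
        = (\<Sum>\<alpha>\<in>words n k. \<Sum>a<n. scale t a * (?\<tau> a (take 1 \<alpha>) * ?\<tau> a (drop 1 \<alpha>)) * word_prod ?z \<alpha>)"
      by (simp only: sum_distrib_right)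
    also have "\<dots> = (\<Sum>a<n. \<Sum>\<alpha>\<in>words n k. scale t a * (?\<tau> a (take 1 \<alpha>) * ?\<tau> a (drop 1 \<alpha>)) * word_prod ?z \<alpha>)"
      by (rule sum.swap)
    also have "\<dots> = (\<Sum>a<n. \<Sum>b<n. \<Sum>\<beta>\<in>words n m. scale t a * ((?\<tau> a [b] * z $ b) * (?\<tau> a \<beta> * word_prod ?z \<beta>)))"
      unfolding k(1) sum_words_Suc by (intro sum.cong refl) simp
    also have "\<dots> = (\<Sum>a<n. scale t a * ((\<Sum>b<n. ?\<tau> a [b] * z $ b) * p a))"
      unfolding p_def sum_product by (simp only: sum_distrib_left)
    finally show ?thesis by (simp add: sum_coeff_fun_single)
  qed
  have second: "(\<Sum>\<alpha>\<in>words n k. (\<Sum>a<n. scale t a * (?\<tau> a (take m \<alpha>) * ?\<tau> a (drop m \<alpha>))) * word_prod ?z \<alpha>) = (\<Sum>a<n. scale t a * (z $ a * p a))"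
  proof -
    have "(\<Sum>\<alpha>\<in>words n k. (\<Sum>a<n. scale t a * (?\<tau> a (take m \<alpha>) * ?\<tau> a (drop m \<alpha>))) * word_prod ?z \<alpha>)
        = (\<Sum>\<alpha>\<in>words n k. \<Sum>a<n. scale t a * (?\<tau> a (take m \<alpha>) * ?\<tau> a (drop m \<alpha>)) * word_prod ?z \<alpha>)"
      by (simp only: sum_distrib_right)
    also have "\<dots> = (\<Sum>a<n. \<Sum>\<alpha>\<in>words n k. scale t a * (?\<tau> a (take m \<alpha>) * ?\<tau> a (drop m \<alpha>)) * word_prod ?z \<alpha>)"
      by (rule sum.swap)
    also have "\<dots> = (\<Sum>a<n. \<Sum>b<n. \<Sum>\<beta>\<in>words n m. scale t a * ((?\<tau> a [b] * z $ b) * (?\<tau> a \<beta> * word_prod ?z \<beta>)))"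
      unfolding k(1) sum_words_snoc by (intro sum.cong refl) (simp add: wordsD)
    also have "\<dots> = (\<Sum>a<n. scale t a * ((\<Sum>b<n. ?\<tau> a [b] * z $ b) * p a))"
      unfolding p_def sum_product by (simp only: sum_distrib_left)
    finally show ?thesis by (simp add: sum_coeff_fun_single)
  qed
  have lead: "(\<Sum>\<alpha>\<in>words n k. leading_coeff t k \<alpha> * word_prod ?z \<alpha>) = 2 * (\<Sum>a<n. scale t a * (z $ a * p a))"
  proof -
    have "(\<Sum>\<alpha>\<in>words n k. leading_coeff t k \<alpha> * word_prod ?z \<alpha>)
        = (\<Sum>a<n. \<Sum>\<beta>\<in>words n m. 2 * scale t a * ?\<tau> a \<beta> * (word_prod ?z \<beta> * z $ a))"
      unfolding k(1) sum_words_snoc leading_coeff_def using k(2)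
      by (intro sum.cong refl) (simp add: coeff_fun_trunc)
    then show ?thesis by (simp add: p_def sum_distrib_left algebra_simps)
  qed
  show ?thesis
    unfolding homogeneous_part_def using first second lead
    by (simp add: coeff sum.distrib distrib_right)
qed

lemma homogeneous_part_residual:
  assumes "3 \<le> k" "k \<le> d"
  shows "homogeneous_part t k z = (\<Sum>r<length (monomials n k). residual t k r * word_prod (\<lambda>i. z $ i) (monomials n k ! r))"
proof -
  have "1 \<le> k" using assms by simp
  have "homogeneous_part t k z = (\<Sum>r<length (monomials n k). \<Sum>\<alpha>\<in>monomial_class n k r.
      (leading_coeff t k \<alpha> + gram_part n trunc (scale t) k \<alpha> + subst_part n trunc (tilde t) k \<alpha>) * word_prod (\<lambda>i. z $ i) \<alpha>)"
    unfolding homogeneous_part_eq[OF assms] monomial_class_def by (rule sum_words_by_monomial[OF \<open>1 \<le> k\<close>])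
  also have "\<dots> = (\<Sum>r<length (monomials n k). \<Sum>\<alpha>\<in>monomial_class n k r.
      (leading_coeff t k \<alpha> + gram_part n trunc (scale t) k \<alpha> + subst_part n trunc (tilde t) k \<alpha>) * word_prod (\<lambda>i. z $ i) (monomials n k ! r))"
    by (intro sum.cong refl arg_cong2[of _ _ _ _ "(*)"] word_prod_cong) (auto simp: monomial_class_def)
  finally show ?thesis by (simp only: residual_def sum_distrib_right)
qed

text \<open>The residual is the left-hand side minus the right-hand side in the row of this
  monomial; for the second equation such a row exists only from \<open>n\<close> on.\<close>

lemma residual_eq_0:
  assumes k: "3 \<le> k" "k \<le> d" and t: "t < 2" and sat: "satisfies_equations n k S T vt wt"
    and r: "row_offset n t \<le> r" "r < length (monomials n k)"
  shows "residual t k r = 0"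
proof -
  define s where "s = r - row_offset n t"
  have s: "s < length (monomials n k) - row_offset n t" "row_offset n t + s = r" using r by (auto simp: s_def)
  have Tk: "T (k - 1) = trunc (k - 1)" and T: "\<And>i. 1 \<le> i \<Longrightarrow> i < k \<Longrightarrow> T i = trunc i" using k by (auto simp: trunc_def)
  define A where "A = (if t = 0 then lhs_c n k else lhs_o n k S)"
  define b where "b = (if t = 0 then rhs_c n k trunc vt else rhs_o n k S trunc wt)"
  have eq: "A *\<^sub>v vec_of (trunc (k - 1)) = b"
    using sat rhs_cong[OF T, where k = k and n = n] unfolding satisfies_equations_def A_def b_def Tk by auto
  have A: "A \<in> carrier_mat (length (monomials n k) - row_offset n t) (n ^ k)"
    using k USV_carrier by (auto simp: A_def row_offset_def)
  have kk: "k = Suc (k - 1)" using k by simp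
  have vdim: "vec_of (trunc (k - 1)) \<in> carrier_vec (n ^ k)"
    using trunc_carrier[of "k - 1"] by (subst (2) kk) (simp add: vec_of_def carrier_vecI)
  have ent: "A $$ (s, idx n \<alpha>) = (if \<alpha> \<in> monomial_class n k r then 2 * scale t (last \<alpha>) else 0)" if "\<alpha> \<in> words n k" for \<alpha>
    using reg_val_lhs_reg[OF k(1) t s(1) that] wordsD(1)[OF that] s(2)
    by (auto simp: lhs_reg_def A_def split: if_splits)
  have vec: "vec_of (trunc (k - 1)) $ idx n \<alpha> = trunc (k - 1) $$ (last \<alpha>, idx n (butlast \<alpha>))" if \<alpha>: "\<alpha> \<in> words n k" for \<alpha>
  proof -
    have ne: "\<alpha> \<noteq> []" using \<alpha> k by (auto simp: words_def)
    then have "last \<alpha> \<in> set \<alpha>" by simp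
    then have last: "last \<alpha> < n" using wordsD(2)[OF \<alpha>] by auto
    have "idx n (butlast \<alpha> @ [last \<alpha>]) mod n = last \<alpha>" "idx n (butlast \<alpha> @ [last \<alpha>]) div n = idx n (butlast \<alpha>)"
      using idx_snoc_mod[OF last, of "butlast \<alpha>"] .
    then have "idx n \<alpha> mod n = last \<alpha>" "idx n \<alpha> div n = idx n (butlast \<alpha>)" using ne by simp_all
    moreover have "idx n \<alpha> < n * n ^ (k - 1)" using idx_less[OF \<alpha>] by (subst (asm) kk) simp
    ultimately show ?thesis using trunc_carrier[of "k - 1"] by (simp add: vec_of_def)
  qed
  have "b $ s = (A *\<^sub>v vec_of (trunc (k - 1))) $ s" by (simp only: eq)
  also have "\<dots> = (\<Sum>j<n ^ k. A $$ (s, j) * vec_of (trunc (k - 1)) $ j)"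
    using A vdim s(1) by (simp add: scalar_prod_def atLeast0LessThan)
  also have "\<dots> = (\<Sum>\<alpha>\<in>words n k. if \<alpha> \<in> monomial_class n k r then leading_coeff t k \<alpha> else 0)"
    unfolding sum_idx by (intro sum.cong refl) (simp add: ent vec leading_coeff_def del: One_nat_def)
  also have "\<dots> = (\<Sum>\<alpha>\<in>monomial_class n k r. leading_coeff t k \<alpha>)"
    by (simp add: monomial_class_def sum.inter_filter)
  finally have "b $ s = (\<Sum>\<alpha>\<in>monomial_class n k r. leading_coeff t k \<alpha>)" .
  moreover have "b $ s = - (\<Sum>\<alpha>\<in>monomial_class n k r. gram_part n trunc (scale t) k \<alpha> + subst_part n trunc (tilde t) k \<alpha>)"
    using reg_val_rhs_reg[OF k(1) t s(1)] s(2) by (auto simp: b_def rhs_reg_def split: if_splits)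
  ultimately show ?thesis by (simp add: residual_def sum.distrib add.assoc)
qed

lemma homogeneous_part_0:
  assumes "3 \<le> k" "k \<le> d" "satisfies_equations n k S T vt wt"
  shows "homogeneous_part 0 k z = 0"
  unfolding homogeneous_part_residual[OF assms(1,2)]
  using residual_eq_0[OF assms(1,2) _ assms(3), of 0] by (intro sum.neutral) (auto simp: row_offset_def)

text \<open>No equation is imposed on the pure powers, which are exactly the terms that survive:
  this is the diagonal form of the output energy.\<close>

lemma homogeneous_part_1:
  assumes "3 \<le> k" "k \<le> d" "satisfies_equations n k S T vt wt"
  shows "homogeneous_part 1 k z = (\<Sum>r<n. residual 1 k r * (z $ r) ^ k)"
proof -
  have "homogeneous_part 1 k z = (\<Sum>r<n. residual 1 k r * word_prod (\<lambda>i. z $ i) (monomials n k ! r))"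
    unfolding homogeneous_part_residual[OF assms(1,2)]
    using residual_eq_0[OF assms(1,2) _ assms(3), of 1] length_monomials_ge[of n k]
    by (intro sum.mono_neutral_right) (auto simp: row_offset_def)
  also have "\<dots> = (\<Sum>r<n. residual 1 k r * (z $ r) ^ k)"
    by (intro sum.cong refl) (simp add: monomials_nth_pure word_prod_def)
  finally show ?thesis .
qed

lemma normal_form:
  assumes Ec: "energy_expansion n d v Ec" and Eo: "energy_expansion n d w Eo"
    and sat: "\<And>k. k \<in> {3..d} \<Longrightarrow> satisfies_equations n k S T vt wt"
  shows "input_normal_output_diagonal n d (\<lambda>z. Ec (\<phi> z)) (\<lambda>z. Eo (\<phi> z))"
proof -
  from phi_linear_bound obtain B where "\<forall>z\<in>carrier_vec n. vnorm z \<le> 1 \<longrightarrow> vnorm (\<phi> z) \<le> B * vnorm z" ..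
  then have B: "vnorm (\<phi> z) \<le> B * vnorm z" if "z \<in> carrier_vec n" "vnorm z \<le> 1" for z
    using that by simp
  have agree: "agree_to_degree n d (\<lambda>z. E (\<phi> z)) (\<lambda>z. 1/2 * (\<Sum>k=2..d. homogeneous_part t k z))"
    if "energy_expansion n d (raw t) E" for E t
  proof (rule agree_to_degree_trans)
    show "agree_to_degree n d (\<lambda>z. E (\<phi> z)) (\<lambda>z. 1/2 * (\<Sum>i=2..d. raw t i \<bullet> kpow_vec (\<phi> z) i))"
    proof (rule agree_to_degree_compose)
      show "agree_to_degree n d E (\<lambda>x. 1/2 * (\<Sum>i=2..d. raw t i \<bullet> kpow_vec x i))"
        using that by (simp add: energy_expansion_def)
    qed (rule phi_carrier, rule B)
  qed (rule expansion_phi_agree)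
  have split: "(\<Sum>k=2..d. f k) = f 2 + (\<Sum>k=3..d. f k)" for f :: "nat \<Rightarrow> real"
    using d_ge by (simp add: sum.atLeast_Suc_atMost numeral_3_eq_3 numeral_2_eq_2)
  have "1/2 * (\<Sum>k=2..d. homogeneous_part 0 k z) = 1/2 * (\<Sum>i<n. (z $ i)\<^sup>2)" for z
    using sat by (simp add: split homogeneous_part_2 homogeneous_part_0 scale_def)
  then have c: "agree_to_degree n d (\<lambda>z. Ec (\<phi> z)) (\<lambda>z. 1/2 * (\<Sum>i<n. (z $ i)\<^sup>2))"
    using agree[of 0 Ec] Ec by (simp only: raw_def simp_thms if_True)
  \<comment> \<open>The constant term is the squared singular value. A pure power of degree
    \<open>k\<close> has the residual as its coefficient, and one factor of \<open>z $ i\<close>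
    squared stands outside, hence the exponent \<open>k - 2\<close>.\<close>
  define \<sigma> where "\<sigma> i = [:scale 1 i:] + (\<Sum>k=3..d. monom (residual 1 k i) (k - 2))" for i
  have "1/2 * (\<Sum>k=2..d. homogeneous_part 1 k z) = 1/2 * (\<Sum>i<n. (z $ i)\<^sup>2 * poly (\<sigma> i) (z $ i))" for z
  proof -
    have "(\<Sum>k=3..d. homogeneous_part 1 k z) = (\<Sum>k=3..d. \<Sum>i<n. (z $ i)\<^sup>2 * (residual 1 k i * (z $ i) ^ (k - 2)))"
    proof (intro sum.cong refl)
      fix k assume k: "k \<in> {3..d}"
      then have k': "3 \<le> k" "k \<le> d" by simp_all
      then have "k = 2 + (k - 2)" by simp
      then have pow: "x ^ k = x\<^sup>2 * x ^ (k - 2)" for x :: real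
        by (metis power_add)
      show "homogeneous_part 1 k z = (\<Sum>i<n. (z $ i)\<^sup>2 * (residual 1 k i * (z $ i) ^ (k - 2)))"
        unfolding homogeneous_part_1[OF k' sat[OF k]] by (intro sum.cong refl) (simp only: pow ac_simps)
    qed
    also have "\<dots> = (\<Sum>i<n. (z $ i)\<^sup>2 * (\<Sum>k=3..d. residual 1 k i * (z $ i) ^ (k - 2)))"
      unfolding sum_distrib_left by (rule sum.swap)
    finally show ?thesis
      by (simp add: split homogeneous_part_2 \<sigma>_def poly_sum poly_monom sum.distrib distrib_left mult.commute)
  qed
  then have o: "agree_to_degree n d (\<lambda>z. Eo (\<phi> z)) (\<lambda>z. 1/2 * (\<Sum>i<n. (z $ i)\<^sup>2 * poly (\<sigma> i) (z $ i)))"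
    using agree[of 1 Eo] Eo by (simp add: raw_def)
  show ?thesis unfolding input_normal_output_diagonal_def using c o by blast
qed

end

text \<open>The programs are fixed before the system, the energies, the factorizations and the
  \<open>T i\<close> are given. They depend only on \<open>n\<close>, \<open>d\<close> and the
  stage, so the operation count cannot exploit particular data.\<close>

theorem proposition1:
  fixes \<kappa> :: nat
  shows "\<exists>P :: nat \<Rightarrow> nat \<Rightarrow> nat \<Rightarrow> program.
    (\<lambda>(n, d). real (total_flops \<kappa> d (P n d)))
      \<in> O[principal {(n, d). 2 \<le> n \<and> 2 \<le> d}](\<lambda>(n, d). real d * real n ^ (d + 1)) \<and>
    (\<forall>n d m p f g h Ec Eo v w V2 W2 sqf svd R L U S V T1 vt wt T.
       1 \<le> n \<longrightarrow> 2 \<le> d \<longrightarrow>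
       control_affine_system n m p f g h \<longrightarrow>
       controllability_energy n m f g Ec \<longrightarrow> observability_energy n m f g h Eo \<longrightarrow>
       energy_expansion n d v Ec \<longrightarrow> energy_expansion n d w Eo \<longrightarrow>
       spd n V2 \<longrightarrow> v 2 = vec_of V2 \<longrightarrow> spd n W2 \<longrightarrow> w 2 = vec_of W2 \<longrightarrow>
       sqrt_factorizer sqf \<longrightarrow> svd_factorizer svd \<longrightarrow>
       R = sqf V2 \<longrightarrow> L = sqf W2 \<longrightarrow> (U, S, V) = svd (transpose_mat L * inv_transpose R) \<longrightarrow>
       T1 = inv_transpose R * V \<longrightarrow>
       vt = transformed_coeff T1 v \<longrightarrow> wt = transformed_coeff T1 w \<longrightarrow>
       T 1 = 1\<^sub>m n \<longrightarrow> (\<forall>i\<in>{2..d - 1}. T i \<in> carrier_mat n (n ^ i)) \<longrightarrow>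
       holds_balancing_data (memory_after sqf svd n d v w T (P n d) 2) n d R L U S V T1 vt wt \<and>
       (\<forall>k\<in>{3..d}. holds_equations (memory_after sqf svd n d v w T (P n d) k) n k S T vt wt) \<and>
       ((\<forall>k\<in>{3..d}. satisfies_equations n k S T vt wt) \<longrightarrow>
          input_normal_output_diagonal n d
            (\<lambda>z. Ec (transformation n d T1 T z)) (\<lambda>z. Eo (transformation n d T1 T z))))"
proof (intro exI[of _ balancing_program] conjI allI impI)
  show "(\<lambda>(n, d). real (total_flops \<kappa> d (balancing_program n d)))
      \<in> O[principal {(n, d). 2 \<le> n \<and> 2 \<le> d}](\<lambda>(n, d). real d * real n ^ (d + 1))"
    by (rule bigoI[where c = "155 + 4 * real \<kappa>"]) (auto simp: eventually_principal dest: total_flops_le[of _ _ \<kappa>])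
next
  fix n d m p f g h Ec Eo v w V2 W2 sqf svd R L U S V T1 vt wt and T :: "nat \<Rightarrow> real mat"
  assume *: "1 \<le> (n::nat)" "2 \<le> (d::nat)" "energy_expansion n d v Ec" "energy_expansion n d w Eo"
    "spd n V2" "v 2 = vec_of V2" "spd n W2" "w 2 = vec_of W2" "sqrt_factorizer sqf" "svd_factorizer svd"
    "R = sqf V2" "L = sqf W2" "(U, S, V) = svd (transpose_mat L * inv_transpose R)" "T1 = inv_transpose R * V"
    "vt = transformed_coeff T1 v" "wt = transformed_coeff T1 w" "T 1 = 1\<^sub>m n"
    "\<forall>i\<in>{2..d - 1}. T i \<in> carrier_mat n (n ^ i)"
  interpret balancing_setup n d v w T V2 W2 sqf svd R L U S V T1 vt wt
    by unfold_locales (use * in \<open>auto simp: energy_expansion_def\<close>)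
  show "holds_balancing_data (memory_after sqf svd n d v w T (balancing_program n d) 2) n d R L U S V T1 vt wt"
    by (rule holds_balancing_data_memory_after)
  show "\<forall>k\<in>{3..d}. holds_equations (memory_after sqf svd n d v w T (balancing_program n d) k) n k S T vt wt"
    using holds_equations_memory_after by blast
  assume "\<forall>k\<in>{3..d}. satisfies_equations n k S T vt wt"
  then show "input_normal_output_diagonal n d
      (\<lambda>z. Ec (transformation n d T1 T z)) (\<lambda>z. Eo (transformation n d T1 T z))"
    using normal_form[OF *(3,4)] by blast
qed

end
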